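(* $\operatorname{Kor}(G)$ is trivial whenever $G$ is a compact group, a locally compact abelian group, or an abelian pro-Lie group. In fact, $\operatorname{Kor}(G)$ is trivial for every abelian proto-Lie group $G$.
   Context: All topological groups are Hausdorff. For a topological group $G$, an ordinary representation of $G$ is a continuous homomorphism $\rho\colon G\to \mathrm{GL}_n(\mathbb{C})$ for some positive integer $n$, and $\operatorname{Kor}(G)$ denotes the intersection of the kernels of all ordinary representations of $G$ (over all $n$). Lie groups are real finite-dimensional Lie groups without any separability assumption (so every discrete group is a Lie group). A proto-Lie group is a topological group $G$ in which every identity neighborhood contains a closed normal subgroup $N$ such that $G/N$ is a Lie group. A pro-Lie group is a complete proto-Lie group. *)

theory Defs
  imports "HOL-Analysis.Analysis" "HOL-Algebra.Coset" "Jordan_Normal_Form.Matrix"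
begin

section \<open>Topological groups\<close>

definition topological_group :: "('a, 'b) monoid_scheme \<Rightarrow> 'a topology \<Rightarrow> bool" where
  "topological_group G T \<longleftrightarrow>
     Group.group G \<and> topspace T = carrier G \<and> Hausdorff_space T \<and>
     continuous_map (prod_topology T T) T (\<lambda>(x, y). x \<otimes>\<^bsub>G\<^esub> y) \<and>
     continuous_map T T (\<lambda>x. inv\<^bsub>G\<^esub> x)"

definition coset_topology ::
    "('a, 'b) monoid_scheme \<Rightarrow> 'a topology \<Rightarrow> 'a set \<Rightarrow> 'a set topology" where
  "coset_topology G T N =
     topology (\<lambda>V. V \<subseteq> carrier (G Mod N) \<and> openin T {x \<in> carrier G. N #>\<^bsub>G\<^esub> x \<in> V})"

lemma openin_coset_topology:
  assumes "topspace T = carrier G"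
  shows "openin (coset_topology G T N) V \<longleftrightarrow>
           V \<subseteq> carrier (G Mod N) \<and> openin T {x \<in> carrier G. N #>\<^bsub>G\<^esub> x \<in> V}"
proof -
  let ?P = "\<lambda>V. V \<subseteq> carrier (G Mod N) \<and> openin T {x \<in> carrier G. N #>\<^bsub>G\<^esub> x \<in> V}"
  have "istopology ?P"
    unfolding istopology_def
  proof (intro conjI allI impI)
    fix S S' assume "?P S" "?P S'"
    moreover have "{x \<in> carrier G. N #>\<^bsub>G\<^esub> x \<in> S \<inter> S'} =
        {x \<in> carrier G. N #>\<^bsub>G\<^esub> x \<in> S} \<inter> {x \<in> carrier G. N #>\<^bsub>G\<^esub> x \<in> S'}"
      by auto
    ultimately show "S \<inter> S' \<subseteq> carrier (G Mod N)"
      "openin T {x \<in> carrier G. N #>\<^bsub>G\<^esub> x \<in> S \<inter> S'}"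
      by (auto simp only: openin_Int)
  next
    fix \<K> assume "\<forall>K\<in>\<K>. ?P K"
    moreover have "{x \<in> carrier G. N #>\<^bsub>G\<^esub> x \<in> \<Union>\<K>} =
        (\<Union>K\<in>\<K>. {x \<in> carrier G. N #>\<^bsub>G\<^esub> x \<in> K})"
      by auto
    ultimately show "\<Union>\<K> \<subseteq> carrier (G Mod N)" "openin T {x \<in> carrier G. N #>\<^bsub>G\<^esub> x \<in> \<Union>\<K>}"
      by auto
  qed
  then show ?thesis
    by (simp add: coset_topology_def)
qed

lemma quotient_map_coset_topology:
  assumes "topspace T = carrier G"
  shows "quotient_map T (coset_topology G T N) (\<lambda>x. N #>\<^bsub>G\<^esub> x)"
proof -
  have "{x \<in> carrier G. N #>\<^bsub>G\<^esub> x \<in> carrier (G Mod N)} = topspace T"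
    using assms by (auto simp: carrier_FactGroup)
  then have "openin (coset_topology G T N) (carrier (G Mod N))"
    using assms openin_topspace[of T] by (simp add: openin_coset_topology)
  then have "topspace (coset_topology G T N) = carrier (G Mod N)"
    using assms by (metis openin_coset_topology openin_subset openin_topspace subset_antisym)
  then show ?thesis
    using assms by (auto simp: quotient_map_def openin_coset_topology carrier_FactGroup)
qed

text \<open>Completeness refers to the left uniformity, whose basic entourages are
  \<open>{(x, y). x\<inverse> y \<in> U}\<close> for identity neighbourhoods \<open>U\<close>; left and right completeness
  are equivalent because inversion exchanges the two uniformities.\<close>

definition Cauchy_filter_on :: "('a, 'b) monoid_scheme \<Rightarrow> 'a topology \<Rightarrow> 'a filter \<Rightarrow> bool" where
  "Cauchy_filter_on G T F \<longleftrightarrow>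
     F \<noteq> bot \<and> (\<forall>\<^sub>F x in F. x \<in> carrier G) \<and>
     (\<forall>U. openin T U \<and> \<one>\<^bsub>G\<^esub> \<in> U \<longrightarrow> (\<forall>\<^sub>F (x, y) in F \<times>\<^sub>F F. inv\<^bsub>G\<^esub> x \<otimes>\<^bsub>G\<^esub> y \<in> U))"

definition complete_group :: "('a, 'b) monoid_scheme \<Rightarrow> 'a topology \<Rightarrow> bool" where
  "complete_group G T \<longleftrightarrow> (\<forall>F. Cauchy_filter_on G T F \<longrightarrow> (\<exists>x. limitin T (\<lambda>y. y) x F))"

section \<open>Ordinary representations\<close>

definition GL :: "nat \<Rightarrow> complex mat monoid" where
  "GL n = units_of (ring_mat TYPE(complex) n ())"

text \<open>The topology induced by identifying a matrix with its family of entries.\<close>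

definition GL_topology :: "nat \<Rightarrow> complex mat topology" where
  "GL_topology n =
     pullback_topology (carrier (GL n)) (\<lambda>A. restrict (($$) A) ({..<n} \<times> {..<n}))
       (product_topology (\<lambda>_. euclidean) ({..<n} \<times> {..<n}))"

definition ordinary_rep ::
    "('a, 'b) monoid_scheme \<Rightarrow> 'a topology \<Rightarrow> nat \<Rightarrow> ('a \<Rightarrow> complex mat) \<Rightarrow> bool" where
  "ordinary_rep G T n \<rho> \<longleftrightarrow> n > 0 \<and> \<rho> \<in> hom G (GL n) \<and> continuous_map T (GL_topology n) \<rho>"

definition Kor :: "('a, 'b) monoid_scheme \<Rightarrow> 'a topology \<Rightarrow> 'a set" where
  "Kor G T = \<Inter>{kernel G (GL n) \<rho> |n \<rho>. ordinary_rep G T n \<rho>}"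

section \<open>Lie groups\<close>

text \<open>Points of \<open>\<real>\<^sup>n\<close> are sequences vanishing from index \<open>n\<close> on, as in
  \<^const>\<open>Euclidean_space\<close>. The sets \<open>\<Omega>\<close> below are meant to be open in \<open>\<real>\<^sup>n\<close>.\<close>

primrec C_diff :: "nat \<Rightarrow> nat \<Rightarrow> (nat \<Rightarrow> real) set \<Rightarrow> ((nat \<Rightarrow> real) \<Rightarrow> real) \<Rightarrow> bool" where
  "C_diff n 0 \<Omega> f \<longleftrightarrow> continuous_map (subtopology (Euclidean_space n) \<Omega>) euclideanreal f"
| "C_diff n (Suc k) \<Omega> f \<longleftrightarrow>
     continuous_map (subtopology (Euclidean_space n) \<Omega>) euclideanreal f \<and>
     (\<forall>i<n. \<exists>g. (\<forall>x\<in>\<Omega>. ((\<lambda>t. f (x(i := t))) has_real_derivative g x) (at (x i))) \<and>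
                C_diff n k \<Omega> g)"

definition smooth_on :: "nat \<Rightarrow> (nat \<Rightarrow> real) set \<Rightarrow> ((nat \<Rightarrow> real) \<Rightarrow> real) \<Rightarrow> bool" where
  "smooth_on n \<Omega> f \<longleftrightarrow> (\<forall>k. C_diff n k \<Omega> f)"

text \<open>A chart is a pair \<open>(U, \<phi>)\<close> of its domain and its coordinate map.\<close>

type_synonym 'a chart = "'a set \<times> ('a \<Rightarrow> nat \<Rightarrow> real)"

definition is_chart :: "'a topology \<Rightarrow> nat \<Rightarrow> 'a chart \<Rightarrow> bool" where
  "is_chart T n = (\<lambda>(U, \<phi>). openin T U \<and> openin (Euclidean_space n) (\<phi> ` U) \<and>
     homeomorphic_map (subtopology T U) (subtopology (Euclidean_space n) (\<phi> ` U)) \<phi>)"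

text \<open>Smoothness of a \<^emph>\<open>continuous\<close> map \<open>f\<close> from an \<open>n\<close>-manifold with atlas \<open>A\<close> to
  an \<open>m\<close>-manifold with atlas \<open>B\<close>. For the identity map and \<open>A = B\<close> this is
  the smoothness of the transition maps.\<close>

definition smooth_map ::
    "nat \<Rightarrow> 'a chart set \<Rightarrow> nat \<Rightarrow> 'b chart set \<Rightarrow> ('a \<Rightarrow> 'b) \<Rightarrow> bool" where
  "smooth_map n A m B f \<longleftrightarrow>
     (\<forall>(U, \<phi>)\<in>A. \<forall>(V, \<psi>)\<in>B. \<forall>j<m.
        smooth_on n (\<phi> ` {x \<in> U. f x \<in> V}) (\<lambda>z. \<psi> (f (inv_into U \<phi> z)) j))"

definition smooth_atlas :: "'a topology \<Rightarrow> nat \<Rightarrow> 'a chart set \<Rightarrow> bool" where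
  "smooth_atlas T n A \<longleftrightarrow>
     (\<forall>c\<in>A. is_chart T n c) \<and> (\<Union>(U, \<phi>)\<in>A. U) = topspace T \<and> smooth_map n A n A (\<lambda>x. x)"

definition prod_chart :: "nat \<Rightarrow> 'a chart \<Rightarrow> 'b chart \<Rightarrow> ('a \<times> 'b) chart" where
  "prod_chart n = (\<lambda>(U, \<phi>) (V, \<psi>).
     (U \<times> V, \<lambda>(x, y) i. if i < n then \<phi> x i else \<psi> y (i - n)))"

text \<open>If \<open>A\<close> has dimension \<open>n\<close> and \<open>B\<close> has dimension \<open>m\<close>, this is an atlas of
  dimension \<open>n + m\<close> for the product.\<close>

definition prod_atlas :: "nat \<Rightarrow> 'a chart set \<Rightarrow> 'b chart set \<Rightarrow> ('a \<times> 'b) chart set" where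
  "prod_atlas n A B = {prod_chart n c d |c d. c \<in> A \<and> d \<in> B}"

definition Lie_group :: "('a, 'b) monoid_scheme \<Rightarrow> 'a topology \<Rightarrow> bool" where
  "Lie_group G T \<longleftrightarrow> topological_group G T \<and>
     (\<exists>n A. smooth_atlas T n A \<and>
        smooth_map (n + n) (prod_atlas n A A) n A (\<lambda>(x, y). x \<otimes>\<^bsub>G\<^esub> y) \<and>
        smooth_map n A n A (\<lambda>x. inv\<^bsub>G\<^esub> x))"

definition proto_Lie_group :: "('a, 'b) monoid_scheme \<Rightarrow> 'a topology \<Rightarrow> bool" where
  "proto_Lie_group G T \<longleftrightarrow> topological_group G T \<and>
     (\<forall>U. openin T U \<and> \<one>\<^bsub>G\<^esub> \<in> U \<longrightarrow>
        (\<exists>N. N \<lhd> G \<and> closedin T N \<and> N \<subseteq> U \<and> Lie_group (G Mod N) (coset_topology G T N)))"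

definition pro_Lie_group :: "('a, 'b) monoid_scheme \<Rightarrow> 'a topology \<Rightarrow> bool" where
  "pro_Lie_group G T \<longleftrightarrow> proto_Lie_group G T \<and> complete_group G T"

end

(*
  For a compact group, the Haar mean is obtained from von Neumann's finite averages of translates;
  two-sided averages give its invariance, and averages on G x G give Fubini. Let x be different
  from 1 and k a continuous function with L_x k different from k. For h = g * g^~ with
  g = L_x k - k, where * is convolution and g^~(y) = cnj (g(y^-1)), the normalised convolution
  powers of h converge uniformly to an idempotent q = q^~ orthogonal to all functions fixed by the
  left translation L_x. The space of all u with u * q = u is translation-invariant, has dimension
  at most q(1) by Bessel's inequality, and carries a unitary representation that is nontrivial at x.
  In a compact abelian group, an idempotent of almost minimal trace below q is an eigenfunction of
  all translations, that is, a multiple of a character.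

  In a locally compact abelian group, let V be a compact neighbourhood of 1 containing x, and let D
  be maximal among the subgroups that meet V^2 only in 1. By Weil's lemma all cyclic subgroups of
  G/D are relatively compact, so G/D has a compact open subgroup containing xD. A character of this
  subgroup extends to G/D because the circle is divisible. Finally, Lie groups are locally compact,
  so an abelian proto-Lie group is handled through its Lie quotients.
*)
theory Submission
  imports Defs "HOL-Algebra.Generated_Groups"
begin

section \<open>Finite averages of translates\<close>

text \<open>The spectral part stays inside the continuous functions. What makes this work is
  \<open>conv_bound\<close>: a convolution is controlled uniformly by the L2 norms of its factors,
  so a sequence that is only L2-Cauchy becomes uniformly Cauchy after one more convolution, and its
  limit is again continuous. The function h has the form g * g^~ because it is then self-adjoint and
  h(1) is the squared norm of g, so it cannot vanish. The trace q(1) of a self-adjoint idempotent q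
  equals its squared norm and plays the role of a dimension; it is at least 1 unless q = 0. The
  subgroup D acts like a lattice. In the real line it is an infinite cyclic group, and the quotient
  is a circle in which x is still visible. Noncompact directions are wrapped up in this way before a
  compact open subgroup is sought. The maximality lemma that produces D also extends characters,
  when applied to graphs of partial homomorphisms.\<close>

locale top_group = group G for G :: "('a, 'b) monoid_scheme" (structure) +
  fixes T :: "'a topology"
  assumes topological_group: "topological_group G T"
begin

lemma topspace_eq [simp]: "topspace T = carrier G"
  and Hausdorff: "Hausdorff_space T"
  and continuous_mult: "continuous_map (prod_topology T T) T (\<lambda>(x, y). x \<otimes> y)"
  and continuous_inv: "continuous_map T T (\<lambda>x. inv x)"
  using topological_group by (auto simp: topological_group_def)

lemma continuous_map_mult:
  assumes "continuous_map X T f" "continuous_map X T g"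
  shows "continuous_map X T (\<lambda>x. f x \<otimes> g x)"
proof -
  have "continuous_map X (prod_topology T T) (\<lambda>x. (f x, g x))"
    using assms by (simp add: continuous_map_paired)
  from continuous_map_compose[OF this continuous_mult] show ?thesis
    by (simp add: o_def)
qed

lemma continuous_map_inv:
  assumes "continuous_map X T f"
  shows "continuous_map X T (\<lambda>x. inv f x)"
  using continuous_map_compose[OF assms continuous_inv] by (simp add: o_def)

lemma continuous_map_cst [intro]: "a \<in> carrier G \<Longrightarrow> continuous_map X T (\<lambda>x. a)"
  by simp

lemma continuous_map_translate [intro]: "a \<in> carrier G \<Longrightarrow> continuous_map T T (\<lambda>x. a \<otimes> x)"
  by (intro continuous_map_mult) auto

lemma openin_translate:
  assumes "openin T V" "a \<in> carrier G"
  shows "openin T ((\<lambda>x. a \<otimes> x) ` V)"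
proof -
  have V: "V \<subseteq> carrier G"
    using openin_subset[OF assms(1)] by simp
  have "(\<lambda>x. a \<otimes> x) ` V = {x \<in> topspace T. inv a \<otimes> x \<in> V}"
  proof (intro equalityI subsetI)
    fix x assume "x \<in> {x \<in> topspace T. inv a \<otimes> x \<in> V}"
    then have "x = a \<otimes> (inv a \<otimes> x)" "inv a \<otimes> x \<in> V"
      using assms by (auto simp: inv_solve_left m_assoc[symmetric])
    then show "x \<in> (\<lambda>x. a \<otimes> x) ` V" by blast
  qed (use V assms in \<open>auto simp: m_assoc[symmetric] subset_iff\<close>)
  then show ?thesis
    using openin_continuous_map_preimage[OF continuous_map_translate[of "inv a"] assms(1)] assms
    by simp
qed

text \<open>The centres of the covering translates are drawn from a prescribed set \<open>A\<close>,
  since later uses need them in the compact set itself or among the positive powers of one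
  element.\<close>

lemma compactin_translate_cover:
  assumes C: "compactin T C" and U: "openin T U" and A: "A \<subseteq> carrier G"
    and cov: "\<forall>c\<in>C. \<exists>a\<in>A. inv a \<otimes> c \<in> U"
  obtains F where "finite F" "F \<subseteq> A" "\<forall>c\<in>C. \<exists>a\<in>F. inv a \<otimes> c \<in> U"
proof -
  have Cc: "C \<subseteq> carrier G" using compactin_subset_topspace[OF C] by simp
  have Uc: "U \<subseteq> carrier G" using openin_subset[OF U] by simp
  have mem: "c \<in> (\<lambda>x. a \<otimes> x) ` U \<longleftrightarrow> inv a \<otimes> c \<in> U" if "a \<in> A" "c \<in> C" for a c
  proof -
    have ac: "a \<in> carrier G" "c \<in> carrier G" using that A Cc by auto
    show ?thesis
    proof
      assume "inv a \<otimes> c \<in> U"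
      moreover have "c = a \<otimes> (inv a \<otimes> c)" using ac by (simp add: m_assoc[symmetric])
      ultimately show "c \<in> (\<lambda>x. a \<otimes> x) ` U" by blast
    next
      assume "c \<in> (\<lambda>x. a \<otimes> x) ` U"
      then obtain u where "u \<in> U" "c = a \<otimes> u" by blast
      then show "inv a \<otimes> c \<in> U" using ac Uc by (auto simp: m_assoc[symmetric] subset_iff)
    qed
  qed
  have "C \<subseteq> \<Union> ((\<lambda>a. (\<lambda>x. a \<otimes> x) ` U) ` A)"
    using cov mem by blast
  then obtain \<F> where \<F>: "finite \<F>" "\<F> \<subseteq> (\<lambda>a. (\<lambda>x. a \<otimes> x) ` U) ` A" "C \<subseteq> \<Union>\<F>"
    using compactinD[OF C, of "(\<lambda>a. (\<lambda>x. a \<otimes> x) ` U) ` A"] openin_translate[OF U] A by blast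
  obtain F where F: "finite F" "F \<subseteq> A" "\<F> = (\<lambda>a. (\<lambda>x. a \<otimes> x) ` U) ` F"
    using finite_subset_image[OF \<F>(1,2)] by blast
  have "\<forall>c\<in>C. \<exists>a\<in>F. inv a \<otimes> c \<in> U"
  proof
    fix c assume c: "c \<in> C"
    then obtain a where "a \<in> F" "c \<in> (\<lambda>x. a \<otimes> x) ` U" using \<F>(3) F(3) by blast
    then show "\<exists>a\<in>F. inv a \<otimes> c \<in> U" using mem[of a c] F(2) c by blast
  qed
  then show thesis using that F by blast
qed

end

locale compact_group = top_group +
  assumes compact: "compact_space T"

lemma sum_list_swap:
  "(\<Sum>x\<leftarrow>xs. \<Sum>y\<leftarrow>ys. F x y) = (\<Sum>y\<leftarrow>ys. \<Sum>x\<leftarrow>xs. F x y :: 'c :: comm_monoid_add)"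
  by (induction xs) (simp_all add: sum_list_addf)

definition lavg :: "('a, 'b) monoid_scheme \<Rightarrow> 'a list \<Rightarrow> ('a \<Rightarrow> real) \<Rightarrow> 'a \<Rightarrow> real" where
  "lavg G as f x = (\<Sum>a\<leftarrow>as. f (a \<otimes>\<^bsub>G\<^esub> x)) / real (length as)"

text \<open>The average of the right translates of \<open>f\<close> by the inverses of \<open>bs\<close>.\<close>

definition ravg :: "('a, 'b) monoid_scheme \<Rightarrow> 'a list \<Rightarrow> ('a \<Rightarrow> real) \<Rightarrow> 'a \<Rightarrow> real" where
  "ravg G bs f x = lavg G bs (\<lambda>y. f (inv\<^bsub>G\<^esub> y)) (inv\<^bsub>G\<^esub> x)"

definition translators :: "('a, 'b) monoid_scheme \<Rightarrow> 'a list set" where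
  "translators G = {as. as \<noteq> [] \<and> set as \<subseteq> carrier G}"

text \<open>Only the existence of a suitable left average is recorded, so the contraction step can
  be iterated without tracking the lists of translators.\<close>

definition lavg_between :: "('a, 'b) monoid_scheme \<Rightarrow> ('a \<Rightarrow> real) \<Rightarrow> real \<Rightarrow> real \<Rightarrow> bool" where
  "lavg_between G f m M \<longleftrightarrow>
     (\<exists>as\<in>translators G. \<forall>x\<in>carrier G. m \<le> lavg G as f x \<and> lavg G as f x \<le> M)"

lemma mean_le:
  fixes h :: "'a \<Rightarrow> real"
  assumes "as \<noteq> []" "\<And>a. a \<in> set as \<Longrightarrow> h a \<le> c"
  shows "(\<Sum>a\<leftarrow>as. h a) / real (length as) \<le> c"
proof -
  have "(\<Sum>a\<leftarrow>as. h a) \<le> (\<Sum>a\<leftarrow>as. c)"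
    using assms(2) by (intro sum_list_mono)
  then show ?thesis
    using assms(1) by (simp add: sum_list_triv divide_le_eq mult.commute)
qed

lemma mean_ge:
  fixes h :: "'a \<Rightarrow> real"
  assumes "as \<noteq> []" "\<And>a. a \<in> set as \<Longrightarrow> h a \<ge> c"
  shows "(\<Sum>a\<leftarrow>as. h a) / real (length as) \<ge> c"
proof -
  have "(\<Sum>a\<leftarrow>as. h a) \<ge> (\<Sum>a\<leftarrow>as. c)"
    using assms(2) by (intro sum_list_mono)
  then show ?thesis
    using assms(1) by (simp add: sum_list_triv le_divide_eq mult.commute)
qed

lemma mean_approx:
  fixes h :: "'a \<Rightarrow> real"
  assumes "as \<noteq> []" "\<And>a. a \<in> set as \<Longrightarrow> \<bar>h a - c\<bar> \<le> e"
  shows "\<bar>(\<Sum>a\<leftarrow>as. h a) / real (length as) - c\<bar> \<le> e"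
proof -
  have "(\<Sum>a\<leftarrow>as. h a) / real (length as) \<le> c + e"
    using assms(2) by (intro mean_le[OF assms(1)]) force
  moreover have "(\<Sum>a\<leftarrow>as. h a) / real (length as) \<ge> c - e"
    using assms(2) by (intro mean_ge[OF assms(1)]) force
  ultimately show ?thesis by linarith
qed

text \<open>A single entry below m lowers the trivial bound M by its share of the mean. This is the
  gain in each contraction step.\<close>

lemma mean_le_one_small:
  fixes h :: "'a \<Rightarrow> real"
  assumes "\<And>a. a \<in> set as \<Longrightarrow> h a \<le> M" "b \<in> set as" "h b \<le> m"
  shows "(\<Sum>a\<leftarrow>as. h a) / real (length as) \<le> M - (M - m) / real (length as)"
proof -
  obtain us vs where as: "as = us @ b # vs"
    using assms(2) by (meson split_list)
  have "(\<Sum>a\<leftarrow>us. h a) \<le> (\<Sum>a\<leftarrow>us. M)" "(\<Sum>a\<leftarrow>vs. h a) \<le> (\<Sum>a\<leftarrow>vs. M)"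
    using assms(1) as by (auto intro!: sum_list_mono)
  then have "(\<Sum>a\<leftarrow>as. h a) \<le> real (length as) * M - (M - m)"
    using assms(3) as by (simp add: sum_list_triv algebra_simps)
  then have "(\<Sum>a\<leftarrow>as. h a) / real (length as) \<le> (real (length as) * M - (M - m)) / real (length as)"
    by (intro divide_right_mono) auto
  also have "\<dots> = M - (M - m) / real (length as)"
    using as by (simp add: diff_divide_distrib)
  finally show ?thesis .
qed

context group begin

lemma lavg_approx:
  assumes "as \<in> translators G" "\<And>x. x \<in> carrier G \<Longrightarrow> \<bar>f x - c\<bar> \<le> e" "x \<in> carrier G"
  shows "\<bar>lavg G as f x - c\<bar> \<le> e"
  unfolding lavg_def using assms by (intro mean_approx) (auto simp: translators_def)

lemma ravg_approx:
  assumes "as \<in> translators G" "\<And>x. x \<in> carrier G \<Longrightarrow> \<bar>f x - c\<bar> \<le> e" "x \<in> carrier G"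
  shows "\<bar>ravg G as f x - c\<bar> \<le> e"
  unfolding ravg_def using assms by (intro lavg_approx) auto

lemma ravg_eq:
  assumes "bs \<in> translators G" "x \<in> carrier G"
  shows "ravg G bs f x = (\<Sum>b\<leftarrow>bs. f (x \<otimes> inv b)) / real (length bs)"
proof -
  have "map (\<lambda>b. f (inv (b \<otimes> inv x))) bs = map (\<lambda>b. f (x \<otimes> inv b)) bs"
    using assms by (intro map_cong) (auto simp: translators_def inv_mult_group subset_iff)
  then show ?thesis by (simp only: ravg_def lavg_def)
qed

text \<open>Left and right multiplication commute by associativity, so the two double sums differ
  only in order. Every comparison of left with right averages rests on this.\<close>

lemma lavg_ravg:
  assumes "as \<in> translators G" "bs \<in> translators G" "x \<in> carrier G"
  shows "lavg G as (ravg G bs f) x = ravg G bs (lavg G as f) x"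
proof -
  have c: "a \<in> carrier G" "b \<in> carrier G" if "a \<in> set as" "b \<in> set bs" for a b
    using assms that by (auto simp: translators_def)
  have "map (\<lambda>a. ravg G bs f (a \<otimes> x)) as = map (\<lambda>a. (\<Sum>b\<leftarrow>bs. f (a \<otimes> (x \<otimes> inv b))) / real (length bs)) as"
  proof (intro map_cong refl)
    fix a assume a: "a \<in> set as"
    then have "map (\<lambda>b. f (a \<otimes> x \<otimes> inv b)) bs = map (\<lambda>b. f (a \<otimes> (x \<otimes> inv b))) bs"
      using c assms(3) by (intro map_cong) (auto simp: m_assoc)
    moreover have "a \<otimes> x \<in> carrier G" using a assms by (auto simp: translators_def)
    ultimately show "ravg G bs f (a \<otimes> x) = (\<Sum>b\<leftarrow>bs. f (a \<otimes> (x \<otimes> inv b))) / real (length bs)"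
      by (simp only: ravg_eq[OF assms(2)])
  qed
  then show ?thesis
    using sum_list_swap[of "\<lambda>a b. f (a \<otimes> (x \<otimes> inv b))" bs as]
    by (simp add: ravg_eq assms lavg_def divide_inverse sum_list_mult_const sum_list_const_mult mult_ac del: map_eq_conv)
qed

text \<open>Averaging twice on the left is averaging once over all products a b. Lists rather than
  sets of translators keep the multiplicities of coinciding products.\<close>

lemma lavg_lavg:
  assumes "as \<in> translators G" "bs \<in> translators G"
  obtains cs where "cs \<in> translators G"
    "\<And>f x. x \<in> carrier G \<Longrightarrow> lavg G bs (lavg G as f) x = lavg G cs f x"
proof -
  define cs where "cs = concat (map (\<lambda>b. map (\<lambda>a. a \<otimes> b) as) bs)"
  have "cs \<in> translators G"
    using assms by (cases as; cases bs) (auto simp: cs_def translators_def)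
  moreover have "lavg G bs (lavg G as f) x = lavg G cs f x" if x: "x \<in> carrier G" for f x
  proof -
    have "(\<Sum>b\<leftarrow>bs. \<Sum>a\<leftarrow>as. f (a \<otimes> (b \<otimes> x))) = (\<Sum>b\<leftarrow>bs. \<Sum>a\<leftarrow>as. f (a \<otimes> b \<otimes> x))"
      using assms x by (intro arg_cong[where f = sum_list] map_cong refl)
        (auto simp: translators_def m_assoc subset_iff)
    also have "\<dots> = (\<Sum>c\<leftarrow>cs. f (c \<otimes> x))"
      unfolding cs_def by (induction bs) (simp_all add: o_def)
    finally have "(\<Sum>b\<leftarrow>bs. \<Sum>a\<leftarrow>as. f (a \<otimes> (b \<otimes> x))) = (\<Sum>c\<leftarrow>cs. f (c \<otimes> x))" .
    moreover have "length cs = length as * length bs"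
      unfolding cs_def by (induction bs) (simp_all)
    ultimately show ?thesis
      by (simp add: lavg_def divide_inverse sum_list_mult_const sum_list_const_mult mult_ac)
  qed
  ultimately show thesis using that by blast
qed

end

section \<open>Almost constant averages of a continuous function\<close>

context compact_group begin

text \<open>The pairs (x, v) with f (x v) close to f x form an open set that contains G x {1}; the
  tube lemma yields one V for all x.\<close>

lemma uniformly_continuous_right:
  assumes f: "continuous_map T euclideanreal f" and "e > 0"
  obtains V where "openin T V" "\<one> \<in> V"
    "\<And>x v. x \<in> carrier G \<Longrightarrow> v \<in> V \<Longrightarrow> \<bar>f (x \<otimes> v) - f x\<bar> < e"
proof -
  define W where "W = {p \<in> topspace (prod_topology T T). \<bar>f (fst p \<otimes> snd p) - f (fst p)\<bar> \<in> {..<e}}"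
  have "continuous_map (prod_topology T T) euclideanreal (\<lambda>p. f (fst p \<otimes> snd p))"
       "continuous_map (prod_topology T T) euclideanreal (\<lambda>p. f (fst p))"
    using continuous_map_compose[OF continuous_mult f] continuous_map_compose[OF continuous_map_fst f]
    by (simp_all add: o_def case_prod_unfold)
  then have "continuous_map (prod_topology T T) euclideanreal (\<lambda>p. \<bar>f (fst p \<otimes> snd p) - f (fst p)\<bar>)"
    by (intro continuous_map_real_abs continuous_map_diff)
  then have "openin (prod_topology T T) W"
    unfolding W_def by (rule openin_continuous_map_preimage) auto
  moreover have "compactin T (carrier G)" "carrier G \<times> {\<one>} \<subseteq> W"
    using compact \<open>e > 0\<close> by (auto simp: compact_space_def W_def)
  ultimately obtain U V where UV: "openin T U" "openin T V" "carrier G \<subseteq> U" "\<one> \<in> V" "U \<times> V \<subseteq> W"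
    using tube_lemma_left[of T T W "carrier G" \<one>] by auto
  have "\<bar>f (x \<otimes> v) - f x\<bar> < e" if "x \<in> carrier G" "v \<in> V" for x v
  proof -
    have "(x, v) \<in> W" using UV that by blast
    then show ?thesis by (simp add: W_def)
  qed
  then show thesis
    using that[of V] UV by blast
qed

text \<open>The translate of V by x v^-1 contains x, so any nonempty open V will do, not only a
  neighbourhood of 1.\<close>

lemma finite_translate_cover:
  assumes "openin T V" "v \<in> V"
  obtains gs where "gs \<in> translators G" "\<And>x. x \<in> carrier G \<Longrightarrow> \<exists>g\<in>set gs. inv g \<otimes> x \<in> V"
proof -
  have v: "v \<in> carrier G" using openin_subset[OF assms(1)] assms(2) by auto
  have C: "compactin T (carrier G)"
    using compact by (simp add: compact_space_def)
  have "\<forall>x\<in>carrier G. \<exists>a\<in>carrier G. inv a \<otimes> x \<in> V"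
  proof
    fix x assume x: "x \<in> carrier G"
    have "inv (x \<otimes> inv v) \<otimes> x = v"
      using x v by (simp add: inv_mult_group m_assoc)
    then show "\<exists>a\<in>carrier G. inv a \<otimes> x \<in> V"
      using x v assms(2) by (intro bexI[of _ "x \<otimes> inv v"]) simp_all
  qed
  then obtain F where F: "finite F" "F \<subseteq> carrier G" "\<forall>x\<in>carrier G. \<exists>a\<in>F. inv a \<otimes> x \<in> V"
    by (rule compactin_translate_cover[OF C assms(1) subset_refl])
  obtain gs where gs: "set gs = F" using F(1) finite_list by blast
  have "gs \<noteq> []" using F(3) gs one_closed by fastforce
  then show thesis using that[of gs] gs F by (auto simp: translators_def)
qed

text \<open>The excess of the oscillation over 2e shrinks by a factor that depends on f and e only.
  The same V serves all left averages of f, because left translation preserves right uniform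
  continuity; hence the number N of translates of V that cover G is fixed in advance.\<close>

lemma oscillation_contraction:
  assumes f: "continuous_map T euclideanreal f" and e: "e > 0"
  shows "\<exists>q::real. 0 \<le> q \<and> q < 1 \<and> (\<forall>m M. lavg_between G f m M \<longrightarrow>
    (\<exists>m' M'. lavg_between G f m' M' \<and> M' - m' - 2 * e \<le> q * (M - m - 2 * e)))"
proof -
  obtain V where V: "openin T V" "\<one> \<in> V"
    "\<And>x v. x \<in> carrier G \<Longrightarrow> v \<in> V \<Longrightarrow> \<bar>f (x \<otimes> v) - f x\<bar> < e"
    using uniformly_continuous_right[OF f e] by blast
  have Vc: "V \<subseteq> carrier G" using openin_subset[OF V(1)] by simp
  obtain gs where gs: "gs \<in> translators G" "\<And>x. x \<in> carrier G \<Longrightarrow> \<exists>g\<in>set gs. inv g \<otimes> x \<in> V"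
    using finite_translate_cover[OF V(1,2)] by blast
  define N where "N = real (length gs)"
  have N: "N \<ge> 1"
    using gs(1) by (cases gs) (auto simp: N_def translators_def)
  \<comment> \<open>With w = M - m, one averaging step replaces w by w - w / (2N) + e / N. This
    affine map has fixed point 2e and slope q.\<close>
  define q where "q = 1 - 1 / (2 * N)"
  have q: "q \<ge> 1/2" "q < 1" using N by (auto simp: q_def field_simps)
  have "\<exists>m' M'. lavg_between G f m' M' \<and> M' - m' - 2 * e \<le> q * (M - m - 2 * e)"
    if between: "lavg_between G f m M" for m M
  proof -
    obtain as where as: "as \<in> translators G"
      and b: "\<forall>x\<in>carrier G. m \<le> lavg G as f x \<and> lavg G as f x \<le> M"
      using between by (auto simp: lavg_between_def)
    show ?thesis
    proof (cases "\<exists>x0\<in>carrier G. lavg G as f x0 \<le> (m + M) / 2")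
      case True
      then obtain x0 where x0: "x0 \<in> carrier G" "lavg G as f x0 \<le> (m + M) / 2" by blast
      \<comment> \<open>For every x some g in \<open>gs\<close> has g^-1 x in V, so one of the N
        points x0 g^-1 x lies in x0 V, where the average is at most the midpoint plus e.\<close>
      define bs where "bs = map (\<lambda>g. x0 \<otimes> inv g) gs"
      have bs: "bs \<in> translators G" "length bs = length gs"
        using gs(1) x0 by (auto simp: bs_def translators_def)
      obtain cs where cs: "cs \<in> translators G"
        "\<And>f x. x \<in> carrier G \<Longrightarrow> lavg G bs (lavg G as f) x = lavg G cs f x"
        using lavg_lavg[OF as bs(1)] by blast
      have near: "lavg G as f (x0 \<otimes> v) \<le> (m + M) / 2 + e" if v: "v \<in> V" for v
      proof -
        have "\<bar>(\<Sum>a\<leftarrow>as. f (a \<otimes> x0 \<otimes> v) - f (a \<otimes> x0)) / real (length as) - 0\<bar> \<le> e"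
          using as V(3)[OF _ v] x0 by (intro mean_approx) (auto simp: translators_def subset_iff intro: less_imp_le)
        also have "(\<Sum>a\<leftarrow>as. f (a \<otimes> x0 \<otimes> v) - f (a \<otimes> x0)) = (\<Sum>a\<leftarrow>as. f (a \<otimes> (x0 \<otimes> v)) - f (a \<otimes> x0))"
          using as x0 v Vc by (intro arg_cong[where f = sum_list] map_cong refl)
            (auto simp: translators_def subset_iff m_assoc)
        finally have "\<bar>lavg G as f (x0 \<otimes> v) - lavg G as f x0\<bar> \<le> e"
          by (simp add: lavg_def sum_list_subtractf diff_divide_distrib)
        then show ?thesis using x0 by linarith
      qed
      define M' where "M' = M - (M - ((m + M) / 2 + e)) / N"
      have "m \<le> lavg G cs f x \<and> lavg G cs f x \<le> M'" if x: "x \<in> carrier G" for x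
      proof -
        obtain g where g: "g \<in> set gs" "inv g \<otimes> x \<in> V" using gs(2)[OF x] by blast
        have gc: "g \<in> carrier G" using g gs(1) by (auto simp: translators_def)
        have "lavg G as f (x0 \<otimes> inv g \<otimes> x) \<le> (m + M) / 2 + e"
          using near[OF g(2)] x0 gc x by (simp add: m_assoc)
        then have "lavg G bs (lavg G as f) x \<le> M'"
          unfolding lavg_def[of G bs] M'_def N_def bs(2)[symmetric]
          using bs g x b by (intro mean_le_one_small[where b = "x0 \<otimes> inv g"])
            (auto simp: bs_def translators_def subset_iff)
        moreover have "m \<le> lavg G bs (lavg G as f) x"
          unfolding lavg_def[of G bs] using b x bs by (intro mean_ge) (auto simp: translators_def)
        ultimately show ?thesis using cs(2)[OF x] by simp
      qed
      moreover have "M' - m - 2 * e = q * (M - m - 2 * e)"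
        using N by (simp add: M'_def q_def field_simps)
      ultimately show ?thesis
        unfolding lavg_between_def using cs(1) by (intro exI[of _ m] exI[of _ M']) auto
    next
      \<comment> \<open>The average stays above the midpoint, so the lower bound can be raised to it
        at once. Halving the interval suffices because q \<ge> 1/2.\<close>
      case False
      have "M \<ge> m" using b[rule_format, OF one_closed] by linarith
      have "(M - m) * (1/2) \<le> (M - m) * q" using \<open>M \<ge> m\<close> q by (intro mult_left_mono) auto
      moreover have "2 * e * q \<le> 2 * e * 1" using q e by (intro mult_left_mono) auto
      ultimately have "M - (m + M) / 2 - 2 * e \<le> q * (M - m - 2 * e)"
        by (simp add: field_simps)
      moreover have "\<forall>x\<in>carrier G. (m + M) / 2 \<le> lavg G as f x \<and> lavg G as f x \<le> M"
        using False b by fastforce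
      ultimately show ?thesis
        unfolding lavg_between_def using as by (intro exI[of _ "(m + M) / 2"] exI[of _ M]) auto
    qed
  qed
  then show ?thesis using q by (intro exI[of _ q]) simp
qed

lemma bounded_real:
  assumes f: "continuous_map T euclideanreal f"
  obtains B where "B > 0" "\<And>x. x \<in> carrier G \<Longrightarrow> \<bar>f x\<bar> \<le> B"
proof -
  have "compactin euclideanreal (f ` carrier G)"
    using image_compactin[OF _ f, of "carrier G"] compact by (simp add: compact_space_def)
  then have "bounded (f ` carrier G)"
    by (simp add: compact_imp_bounded)
  then show thesis
    using that by (auto simp: bounded_pos)
qed

lemma lavg_almost_constant:
  assumes f: "continuous_map T euclideanreal f" and d: "d > 0"
  obtains as c where "as \<in> translators G" "\<And>x. x \<in> carrier G \<Longrightarrow> \<bar>lavg G as f x - c\<bar> \<le> d"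
proof -
  \<comment> \<open>After n steps M - m \<le> 2e + q^n 2B, and n is chosen so that the last term is
    below e; the total 3e is less than d.\<close>
  define e where "e = d / 4"
  have e: "e > 0" using d by (simp add: e_def)
  obtain q :: real where q: "0 \<le> q" "q < 1" and step: "\<forall>m M. lavg_between G f m M \<longrightarrow>
      (\<exists>m' M'. lavg_between G f m' M' \<and> M' - m' - 2 * e \<le> q * (M - m - 2 * e))"
    using oscillation_contraction[OF f e] by (elim exE conjE) (rule that)
  obtain B where B: "B > 0" "\<And>x. x \<in> carrier G \<Longrightarrow> \<bar>f x\<bar> \<le> B"
    using bounded_real[OF f] by blast
  have iter: "\<exists>m M. lavg_between G f m M \<and> M - m - 2 * e \<le> q ^ n * (2 * B)" for n
  proof (induction n)
    case 0
    have "\<forall>x\<in>carrier G. - B \<le> lavg G [\<one>] f x \<and> lavg G [\<one>] f x \<le> B"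
      using B(2) by (fastforce simp: lavg_def abs_le_iff)
    then have "lavg_between G f (- B) B"
      unfolding lavg_between_def by (intro bexI[of _ "[\<one>]"]) (auto simp: translators_def)
    moreover have "B - (- B) - 2 * e \<le> q ^ 0 * (2 * B)" using e by simp
    ultimately show ?case by blast
  next
    case (Suc n)
    then obtain m M where *: "lavg_between G f m M" "M - m - 2 * e \<le> q ^ n * (2 * B)" by blast
    obtain m' M' where **: "lavg_between G f m' M'" "M' - m' - 2 * e \<le> q * (M - m - 2 * e)"
      using step *(1) by blast
    have "q * (M - m - 2 * e) \<le> q * (q ^ n * (2 * B))"
      using *(2) q by (intro mult_left_mono)
    then have "M' - m' - 2 * e \<le> q ^ Suc n * (2 * B)"
      using **(2) by (simp only: power_Suc mult.assoc)
    then show ?case using **(1) by blast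
  qed
  have "(\<lambda>n. q ^ n * (2 * B)) \<longlonglongrightarrow> 0 * (2 * B)"
    using q by (intro tendsto_intros LIMSEQ_realpow_zero) auto
  then have "\<forall>\<^sub>F n in sequentially. q ^ n * (2 * B) < e"
    using e by (auto dest: order_tendstoD(2))
  then obtain n where n: "q ^ n * (2 * B) < e"
    by (meson eventually_sequentially order_refl)
  obtain m M as where *: "as \<in> translators G"
    "\<forall>x\<in>carrier G. m \<le> lavg G as f x \<and> lavg G as f x \<le> M" "M - m - 2 * e \<le> q ^ n * (2 * B)"
    using iter[of n] by (auto simp: lavg_between_def)
  have "M - m \<le> d" using * n e by (simp add: e_def)
  then have "\<bar>lavg G as f x - m\<bar> \<le> d" if "x \<in> carrier G" for x
    using *(2) that by fastforce
  then show thesis using that[of as m] * by blast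
qed

end

section \<open>The Haar mean of a compact group\<close>

lemma eq_if_arbitrarily_close:
  fixes x y K :: real
  assumes "\<And>d. d > 0 \<Longrightarrow> \<bar>x - y\<bar> \<le> K * d"
  shows "x = y"
proof (rule ccontr)
  assume "x \<noteq> y"
  define d where "d = \<bar>x - y\<bar> / (2 * (\<bar>K\<bar> + 1))"
  have d: "d > 0" using \<open>x \<noteq> y\<close> by (simp add: d_def)
  have "\<bar>x - y\<bar> \<le> K * d" by (rule assms[OF d])
  also have "\<dots> \<le> (\<bar>K\<bar> + 1) * d" using d by (intro mult_right_mono) auto
  also have "\<dots> = \<bar>x - y\<bar> / 2"
    by (simp add: d_def divide_simps add_nonneg_eq_0_iff)
  finally show False using \<open>x \<noteq> y\<close> by simp
qed

text \<open>Using only upper bounds of left averages defines a number for every function. For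
  continuous f it is the common constant that left and right averages of f can approach.\<close>

definition haar_mean :: "('a, 'b) monoid_scheme \<Rightarrow> ('a \<Rightarrow> real) \<Rightarrow> real" where
  "haar_mean G f = Inf {u. \<exists>as\<in>translators G. \<forall>x\<in>carrier G. lavg G as f x \<le> u}"

context group begin

lemma one_translators: "[\<one>] \<in> translators G"
  by (simp add: translators_def)

lemma lavg_le:
  assumes "as \<in> translators G" "\<forall>x\<in>carrier G. f x \<le> u" "x \<in> carrier G"
  shows "lavg G as f x \<le> u"
  unfolding lavg_def using assms by (intro mean_le) (auto simp: translators_def)

lemma lavg_ge:
  assumes "as \<in> translators G" "\<forall>x\<in>carrier G. l \<le> f x" "x \<in> carrier G"
  shows "l \<le> lavg G as f x"
  unfolding lavg_def using assms by (intro mean_ge) (auto simp: translators_def)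

lemma ravg_le:
  assumes "as \<in> translators G" "\<forall>x\<in>carrier G. f x \<le> u" "x \<in> carrier G"
  shows "ravg G as f x \<le> u"
  unfolding ravg_def using assms by (intro lavg_le) auto

lemma ravg_ge:
  assumes "as \<in> translators G" "\<forall>x\<in>carrier G. l \<le> f x" "x \<in> carrier G"
  shows "l \<le> ravg G as f x"
  unfolding ravg_def using assms by (intro lavg_ge) auto

text \<open>Apply both averages to f. They commute, and the value at 1 lies above l in one order and
  below u in the other.\<close>

lemma lower_right_le_upper_left:
  assumes "as \<in> translators G" "bs \<in> translators G"
    and "\<forall>x\<in>carrier G. lavg G as f x \<le> u" "\<forall>x\<in>carrier G. l \<le> ravg G bs f x"
  shows "l \<le> u"
  using lavg_ge[OF assms(1,4) one_closed] ravg_le[OF assms(2,3) one_closed]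
    lavg_ravg[OF assms(1,2) one_closed, of f] by simp

lemma lower_left_le_upper_right:
  assumes "as \<in> translators G" "bs \<in> translators G"
    and "\<forall>x\<in>carrier G. l \<le> lavg G as f x" "\<forall>x\<in>carrier G. ravg G bs f x \<le> u"
  shows "l \<le> u"
  using lavg_le[OF assms(1,4) one_closed] ravg_ge[OF assms(2,3) one_closed]
    lavg_ravg[OF assms(1,2) one_closed, of f] by simp

lemma map_inv_translators: "as \<in> translators G \<Longrightarrow> map (\<lambda>a. inv a) as \<in> translators G"
  by (auto simp: translators_def)

lemma lavg_cong:
  assumes "as \<in> translators G" "x \<in> carrier G" "\<And>x. x \<in> carrier G \<Longrightarrow> f x = g x"
  shows "lavg G as f x = lavg G as g x"
proof -
  have "map (\<lambda>a. f (a \<otimes> x)) as = map (\<lambda>a. g (a \<otimes> x)) as"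
    using assms by (intro map_cong) (auto simp: translators_def subset_iff)
  then show ?thesis by (simp only: lavg_def)
qed

lemma haar_mean_cong:
  assumes "\<And>x. x \<in> carrier G \<Longrightarrow> f x = g x"
  shows "haar_mean G f = haar_mean G g"
proof -
  have "(\<exists>as\<in>translators G. \<forall>x\<in>carrier G. lavg G as f x \<le> u) \<longleftrightarrow>
        (\<exists>as\<in>translators G. \<forall>x\<in>carrier G. lavg G as g x \<le> u)" for u
    using lavg_cong[OF _ _ assms] by (intro bex_cong ball_cong refl) auto
  then show ?thesis by (simp add: haar_mean_def)
qed

end

section \<open>One-sided averages as approximations of the mean\<close>

context compact_group begin

abbreviation "cont f \<equiv> continuous_map T euclideanreal f"

lemma cont_inv: "cont f \<Longrightarrow> cont (\<lambda>x. f (inv x))"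
  using continuous_map_compose[OF continuous_inv] by (fastforce simp: o_def)

lemma cont_translate: "cont f \<Longrightarrow> a \<in> carrier G \<Longrightarrow> cont (\<lambda>x. f (a \<otimes> x))"
  using continuous_map_compose[OF continuous_map_translate] by (fastforce simp: o_def)

lemma cont_lavg:
  assumes "cont f" "as \<in> translators G"
  shows "cont (lavg G as f)"
proof -
  have "cont (\<lambda>x. \<Sum>a\<leftarrow>as. f (a \<otimes> x))" if "set as \<subseteq> carrier G" for as
    using that by (induction as) (auto intro!: continuous_map_add cont_translate assms)
  then show ?thesis
    using assms(2) unfolding lavg_def divide_inverse
    by (intro continuous_map_real_mult) (auto simp: translators_def)
qed

lemma cont_ravg: "cont f \<Longrightarrow> as \<in> translators G \<Longrightarrow> cont (ravg G as f)"
  unfolding ravg_def[abs_def] by (intro cont_inv[of "lavg G as _"] cont_lavg cont_inv[of f])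

lemma ravg_almost_constant:
  assumes f: "cont f" and d: "d > 0"
  obtains bs c where "bs \<in> translators G" "\<And>x. x \<in> carrier G \<Longrightarrow> \<bar>ravg G bs f x - c\<bar> \<le> d"
proof -
  obtain bs c where "bs \<in> translators G"
    "\<And>x. x \<in> carrier G \<Longrightarrow> \<bar>lavg G bs (\<lambda>x. f (inv x)) x - c\<bar> \<le> d"
    using lavg_almost_constant[OF cont_inv[OF f] d] by blast
  then show thesis using that[of bs c] by (simp add: ravg_def)
qed

lemma haar_mean_le_lavg:
  assumes f: "cont f" and as: "as \<in> translators G" and "\<forall>x\<in>carrier G. lavg G as f x \<le> u"
  shows "haar_mean G f \<le> u"
proof -
  obtain B where "B > 0" and B: "\<And>x. x \<in> carrier G \<Longrightarrow> \<bar>f x\<bar> \<le> B"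
    using bounded_real[OF f] by blast
  have B': "\<forall>x\<in>carrier G. - B \<le> ravg G [\<one>] f x"
    using B by (fastforce simp: ravg_def lavg_def abs_le_iff)
  have "bdd_below {u. \<exists>as\<in>translators G. \<forall>x\<in>carrier G. lavg G as f x \<le> u}"
    unfolding bdd_below_def using lower_right_le_upper_left[OF _ one_translators _ B'] by blast
  then show ?thesis
    unfolding haar_mean_def using as assms(3) by (intro cInf_lower) blast+
qed

lemma haar_mean_ge_ravg:
  assumes f: "cont f" and bs: "bs \<in> translators G" and l: "\<forall>x\<in>carrier G. l \<le> ravg G bs f x"
  shows "l \<le> haar_mean G f"
proof -
  obtain B where "B > 0" and B: "\<And>x. x \<in> carrier G \<Longrightarrow> \<bar>f x\<bar> \<le> B"
    using bounded_real[OF f] by blast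
  have "\<forall>x\<in>carrier G. lavg G [\<one>] f x \<le> B"
    using B by (fastforce simp: lavg_def abs_le_iff)
  then have "{u. \<exists>as\<in>translators G. \<forall>x\<in>carrier G. lavg G as f x \<le> u} \<noteq> {}"
    using one_translators by blast
  then show ?thesis
    unfolding haar_mean_def using lower_right_le_upper_left[OF _ bs _ l] by (intro cInf_greatest) blast+
qed

text \<open>Lower bounds of left averages do not occur in the definition. They are compared with the
  value c of an almost constant right average, which does bound the mean from below.\<close>

lemma haar_mean_ge_lavg:
  assumes f: "cont f" and as: "as \<in> translators G" and l: "\<forall>x\<in>carrier G. l \<le> lavg G as f x"
  shows "l \<le> haar_mean G f"
proof (rule field_le_epsilon)
  fix e :: real assume "e > 0"
  then have "e / 2 > 0" by simp
  then obtain bs c where bs: "bs \<in> translators G" "\<And>x. x \<in> carrier G \<Longrightarrow> \<bar>ravg G bs f x - c\<bar> \<le> e / 2"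
    using ravg_almost_constant[OF f] by metis
  have "c - e / 2 \<le> haar_mean G f"
    by (rule haar_mean_ge_ravg[OF f bs(1)]) (use bs(2) in \<open>simp only: abs_diff_le_iff, blast\<close>)
  moreover have "l \<le> c + e / 2"
    by (rule lower_left_le_upper_right[OF as bs(1) l]) (use bs(2) in \<open>simp only: abs_diff_le_iff, blast\<close>)
  ultimately show "l \<le> haar_mean G f + e" by linarith
qed

lemma haar_mean_le_ravg:
  assumes f: "cont f" and bs: "bs \<in> translators G" and u: "\<forall>x\<in>carrier G. ravg G bs f x \<le> u"
  shows "haar_mean G f \<le> u"
proof (rule field_le_epsilon)
  fix e :: real assume "e > 0"
  then have "e / 2 > 0" by simp
  then obtain as c where as: "as \<in> translators G" "\<And>x. x \<in> carrier G \<Longrightarrow> \<bar>lavg G as f x - c\<bar> \<le> e / 2"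
    using lavg_almost_constant[OF f] by metis
  have "haar_mean G f \<le> c + e / 2"
    by (rule haar_mean_le_lavg[OF f as(1)]) (use as(2) in \<open>simp only: abs_diff_le_iff, blast\<close>)
  moreover have "c - e / 2 \<le> u"
    by (rule lower_left_le_upper_right[OF as(1) bs _ u]) (use as(2) in \<open>simp only: abs_diff_le_iff, blast\<close>)
  ultimately show "haar_mean G f \<le> u + e" by linarith
qed

lemma haar_mean_approx_lavg:
  assumes "cont f" "as \<in> translators G" "\<And>x. x \<in> carrier G \<Longrightarrow> \<bar>lavg G as f x - c\<bar> \<le> e"
  shows "\<bar>haar_mean G f - c\<bar> \<le> e"
proof -
  have "\<forall>x\<in>carrier G. lavg G as f x \<le> c + e" "\<forall>x\<in>carrier G. c - e \<le> lavg G as f x"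
    using assms(3) by (fastforce simp: abs_le_iff)+
  from haar_mean_le_lavg[OF assms(1,2) this(1)] haar_mean_ge_lavg[OF assms(1,2) this(2)]
  show ?thesis by linarith
qed

lemma haar_mean_approx_ravg:
  assumes "cont f" "as \<in> translators G" "\<And>x. x \<in> carrier G \<Longrightarrow> \<bar>ravg G as f x - c\<bar> \<le> e"
  shows "\<bar>haar_mean G f - c\<bar> \<le> e"
proof -
  have "\<forall>x\<in>carrier G. ravg G as f x \<le> c + e" "\<forall>x\<in>carrier G. c - e \<le> ravg G as f x"
    using assms(3) by (fastforce simp: abs_le_iff)+
  from haar_mean_le_ravg[OF assms(1,2) this(1)] haar_mean_ge_ravg[OF assms(1,2) this(2)]
  show ?thesis by linarith
qed

lemma haar_mean_approx:
  assumes "cont f" "\<And>x. x \<in> carrier G \<Longrightarrow> \<bar>f x - c\<bar> \<le> e"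
  shows "\<bar>haar_mean G f - c\<bar> \<le> e"
  by (rule haar_mean_approx_lavg[OF assms(1) one_translators lavg_approx[OF one_translators assms(2)]])

lemma lavg_near_haar_mean:
  assumes f: "cont f" and d: "d > 0"
  obtains as where "as \<in> translators G" "\<And>x. x \<in> carrier G \<Longrightarrow> \<bar>lavg G as f x - haar_mean G f\<bar> \<le> d"
proof -
  have "d / 2 > 0" using d by simp
  then obtain as c where as: "as \<in> translators G" "\<And>x. x \<in> carrier G \<Longrightarrow> \<bar>lavg G as f x - c\<bar> \<le> d / 2"
    using lavg_almost_constant[OF f] by metis
  have "\<bar>haar_mean G f - c\<bar> \<le> d / 2" by (rule haar_mean_approx_lavg[OF f as])
  then have "\<bar>lavg G as f x - haar_mean G f\<bar> \<le> d" if "x \<in> carrier G" for x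
    using as(2)[OF that] by linarith
  then show thesis using that as(1) by blast
qed

lemma ravg_near_haar_mean:
  assumes f: "cont f" and d: "d > 0"
  obtains as where "as \<in> translators G" "\<And>x. x \<in> carrier G \<Longrightarrow> \<bar>ravg G as f x - haar_mean G f\<bar> \<le> d"
proof -
  have "d / 2 > 0" using d by simp
  then obtain as c where as: "as \<in> translators G" "\<And>x. x \<in> carrier G \<Longrightarrow> \<bar>ravg G as f x - c\<bar> \<le> d / 2"
    using ravg_almost_constant[OF f] by metis
  have "\<bar>haar_mean G f - c\<bar> \<le> d / 2" by (rule haar_mean_approx_ravg[OF f as])
  then have "\<bar>ravg G as f x - haar_mean G f\<bar> \<le> d" if "x \<in> carrier G" for x
    using as(2)[OF that] by linarith
  then show thesis using that as(1) by blast
qed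

text \<open>A right average that makes f almost constant makes \<open>lavg G as f\<close> almost
  constant with the same value, because the two averages commute.\<close>

lemma haar_mean_lavg:
  assumes f: "cont f" and as: "as \<in> translators G"
  shows "haar_mean G (lavg G as f) = haar_mean G f"
proof (rule eq_if_arbitrarily_close[where K = 1])
  fix d :: real assume "d > 0"
  then obtain bs where bs: "bs \<in> translators G"
    "\<And>x. x \<in> carrier G \<Longrightarrow> \<bar>ravg G bs f x - haar_mean G f\<bar> \<le> d"
    using ravg_near_haar_mean[OF f] by blast
  have "\<bar>ravg G bs (lavg G as f) x - haar_mean G f\<bar> \<le> d" if "x \<in> carrier G" for x
    using lavg_approx[OF as, of "ravg G bs f"] bs(2) lavg_ravg[OF as bs(1)] that by simp
  then show "\<bar>haar_mean G (lavg G as f) - haar_mean G f\<bar> \<le> 1 * d"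
    by (simp add: haar_mean_approx_ravg[OF cont_lavg[OF f as] bs(1)])
qed

lemma haar_mean_ravg:
  assumes f: "cont f" and as: "as \<in> translators G"
  shows "haar_mean G (ravg G as f) = haar_mean G f"
proof (rule eq_if_arbitrarily_close[where K = 1])
  fix d :: real assume "d > 0"
  then obtain bs where bs: "bs \<in> translators G"
    "\<And>x. x \<in> carrier G \<Longrightarrow> \<bar>lavg G bs f x - haar_mean G f\<bar> \<le> d"
    using lavg_near_haar_mean[OF f] by blast
  have "\<bar>lavg G bs (ravg G as f) x - haar_mean G f\<bar> \<le> d" if "x \<in> carrier G" for x
    using ravg_approx[OF as, of "lavg G bs f"] bs(2) lavg_ravg[OF bs(1) as] that by simp
  then show "\<bar>haar_mean G (ravg G as f) - haar_mean G f\<bar> \<le> 1 * d"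
    by (simp add: haar_mean_approx_lavg[OF cont_ravg[OF f as] bs(1)])
qed

section \<open>Invariance, linearity and positivity of the mean\<close>

lemma haar_mean_translate:
  assumes "cont f" "a \<in> carrier G"
  shows "haar_mean G (\<lambda>x. f (a \<otimes> x)) = haar_mean G f"
  using haar_mean_lavg[of f "[a]"] assms by (simp add: lavg_def[abs_def] translators_def)

text \<open>Inversion turns left averages into right averages, and the mean can be computed from
  either kind.\<close>

lemma haar_mean_inv:
  assumes f: "cont f"
  shows "haar_mean G (\<lambda>x. f (inv x)) = haar_mean G f"
proof (rule eq_if_arbitrarily_close[where K = 1])
  fix d :: real assume "d > 0"
  then obtain as where as: "as \<in> translators G"
    "\<And>x. x \<in> carrier G \<Longrightarrow> \<bar>lavg G as f x - haar_mean G f\<bar> \<le> d"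
    using lavg_near_haar_mean[OF f] by blast
  have "\<bar>ravg G as (\<lambda>x. f (inv x)) x - haar_mean G f\<bar> \<le> d" if x: "x \<in> carrier G" for x
    using as lavg_cong[OF as(1) inv_closed[OF x], of "\<lambda>y. f (inv (inv y))" f] x by (simp add: ravg_def)
  then show "\<bar>haar_mean G (\<lambda>x. f (inv x)) - haar_mean G f\<bar> \<le> 1 * d"
    by (simp add: haar_mean_approx_ravg[OF cont_inv[OF f] as(1)])
qed

text \<open>Here f is averaged on the left and g on the right. The two averages commute, so their
  composite makes both functions almost constant at the same time.\<close>

lemma haar_mean_add:
  assumes f: "cont f" and g: "cont g"
  shows "haar_mean G (\<lambda>x. f x + g x) = haar_mean G f + haar_mean G g"
proof (rule eq_if_arbitrarily_close[where K = 2])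
  fix d :: real assume d: "d > 0"
  obtain as where as: "as \<in> translators G"
    "\<And>x. x \<in> carrier G \<Longrightarrow> \<bar>lavg G as f x - haar_mean G f\<bar> \<le> d"
    using lavg_near_haar_mean[OF f d] by blast
  obtain bs where bs: "bs \<in> translators G"
    "\<And>x. x \<in> carrier G \<Longrightarrow> \<bar>ravg G bs g x - haar_mean G g\<bar> \<le> d"
    using ravg_near_haar_mean[OF g d] by blast
  have fg: "cont (\<lambda>x. f x + g x)" using f g by (intro continuous_map_add)
  let ?h = "lavg G as (ravg G bs (\<lambda>x. f x + g x))"
  have "haar_mean G ?h = haar_mean G (\<lambda>x. f x + g x)"
    using fg as(1) bs(1) by (simp add: haar_mean_lavg haar_mean_ravg cont_ravg)
  moreover have "\<bar>haar_mean G ?h - (haar_mean G f + haar_mean G g)\<bar> \<le> 2 * d"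
  proof (rule haar_mean_approx)
    show "cont ?h" using fg as(1) bs(1) by (intro cont_lavg cont_ravg)
    fix x assume x: "x \<in> carrier G"
    have "ravg G bs (\<lambda>x. f x + g x) = (\<lambda>x. ravg G bs f x + ravg G bs g x)"
      by (simp add: ravg_def lavg_def fun_eq_iff sum_list_addf add_divide_distrib)
    then have "?h x = lavg G as (ravg G bs f) x + lavg G as (ravg G bs g) x"
      by (simp add: lavg_def sum_list_addf add_divide_distrib)
    moreover have "\<bar>lavg G as (ravg G bs f) x - haar_mean G f\<bar> \<le> d"
      using lavg_ravg[OF as(1) bs(1) x] ravg_approx[OF bs(1) as(2) x] by simp
    moreover have "\<bar>lavg G as (ravg G bs g) x - haar_mean G g\<bar> \<le> d"
      using lavg_approx[OF as(1) bs(2) x] by simp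
    ultimately show "\<bar>?h x - (haar_mean G f + haar_mean G g)\<bar> \<le> 2 * d" by linarith
  qed
  ultimately show "\<bar>haar_mean G (\<lambda>x. f x + g x) - (haar_mean G f + haar_mean G g)\<bar> \<le> 2 * d" by simp
qed

lemma haar_mean_const [simp]: "haar_mean G (\<lambda>x. c) = c"
  using haar_mean_approx[of "\<lambda>x. c" c 0] by simp

lemma haar_mean_scale:
  assumes f: "cont f"
  shows "haar_mean G (\<lambda>x. c * f x) = c * haar_mean G f"
proof (rule eq_if_arbitrarily_close[where K = "\<bar>c\<bar>"])
  fix d :: real assume "d > 0"
  then obtain as where as: "as \<in> translators G"
    "\<And>x. x \<in> carrier G \<Longrightarrow> \<bar>lavg G as f x - haar_mean G f\<bar> \<le> d"
    using lavg_near_haar_mean[OF f] by blast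
  have "lavg G as (\<lambda>x. c * f x) x - c * haar_mean G f = c * (lavg G as f x - haar_mean G f)" for x
    by (simp add: lavg_def sum_list_const_mult algebra_simps)
  then show "\<bar>haar_mean G (\<lambda>x. c * f x) - c * haar_mean G f\<bar> \<le> \<bar>c\<bar> * d"
    using as f by (intro haar_mean_approx_lavg[OF _ as(1)])
      (auto simp: abs_mult intro!: mult_left_mono continuous_map_real_mult)
qed

lemma haar_mean_mono:
  assumes "cont f" "cont g" "\<And>x. x \<in> carrier G \<Longrightarrow> f x \<le> g x"
  shows "haar_mean G f \<le> haar_mean G g"
proof -
  have h: "cont (\<lambda>x. g x + (-1) * f x)" using assms by (intro continuous_map_add continuous_map_real_mult) auto
  have "0 \<le> haar_mean G (\<lambda>x. g x + (-1) * f x)"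
    using assms(3) by (intro haar_mean_ge_lavg[OF h one_translators]) (auto simp: lavg_def)
  also have "\<dots> = haar_mean G g - haar_mean G f"
    using haar_mean_add[of g "\<lambda>x. (-1) * f x"] haar_mean_scale[of f "-1"] assms continuous_map_real_mult[of T "\<lambda>x. -1" f] by simp
  finally show ?thesis by simp
qed

lemma haar_mean_nonneg:
  assumes "cont f" "\<And>x. x \<in> carrier G \<Longrightarrow> 0 \<le> f x"
  shows "0 \<le> haar_mean G f"
  using haar_mean_mono[of "\<lambda>x. 0" f] assms by simp

text \<open>Finitely many translates of the set where f exceeds f x0 / 2 cover G. Averaging over the
  inverse translators gives at least f x0 / 2 divided by their number.\<close>

lemma haar_mean_pos:
  assumes f: "cont f" and nn: "\<And>x. x \<in> carrier G \<Longrightarrow> 0 \<le> f x" and x0: "x0 \<in> carrier G" "f x0 \<noteq> 0"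
  shows "0 < haar_mean G f"
proof -
  have x0': "f x0 > 0" using nn[OF x0(1)] x0 by simp
  define V where "V = {x \<in> topspace T. f x \<in> {f x0 / 2<..}}"
  have V: "openin T V" "x0 \<in> V"
    unfolding V_def by (rule openin_continuous_map_preimage[OF f]) (use x0 x0' in auto)
  obtain gs where gs: "gs \<in> translators G" "\<And>x. x \<in> carrier G \<Longrightarrow> \<exists>g\<in>set gs. inv g \<otimes> x \<in> V"
    using finite_translate_cover[OF V] by blast
  define as where "as = map (\<lambda>g. inv g) gs"
  have as: "as \<in> translators G" using map_inv_translators[OF gs(1)] by (simp add: as_def)
  have N: "real (length as) > 0" using as by (auto simp: translators_def)
  have "f x0 / 2 / real (length as) \<le> lavg G as f x" if x: "x \<in> carrier G" for x
  proof -
    obtain g where g: "g \<in> set gs" "inv g \<otimes> x \<in> V" using gs(2)[OF x] by blast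
    then obtain us vs where uv: "gs = us @ g # vs" by (meson split_list)
    have "0 \<le> (\<Sum>a\<leftarrow>us. f (inv a \<otimes> x))" "0 \<le> (\<Sum>a\<leftarrow>vs. f (inv a \<otimes> x))"
      using gs(1) nn x uv by (auto intro!: sum_list_nonneg nn simp: translators_def subset_iff)
    moreover have "f x0 / 2 \<le> f (inv g \<otimes> x)" using g by (auto simp: V_def)
    ultimately have "f x0 / 2 \<le> (\<Sum>a\<leftarrow>as. f (a \<otimes> x))" by (simp add: as_def uv o_def)
    then show ?thesis unfolding lavg_def using N by (intro divide_right_mono) auto
  qed
  then have "f x0 / 2 / real (length as) \<le> haar_mean G f"
    by (intro haar_mean_ge_lavg[OF f as]) blast
  moreover have "f x0 / 2 / real (length as) > 0" using x0' N by simp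
  ultimately show ?thesis by linarith
qed

text \<open>For x' near x the tube lemma makes F x' uniformly close to F x on the compact group, and
  the mean is 1-Lipschitz for the uniform distance.\<close>

lemma continuous_map_haar_mean:
  assumes F: "continuous_map (prod_topology X T) euclideanreal (\<lambda>(x, y). F x y)"
  shows "continuous_map X euclideanreal (\<lambda>x. haar_mean G (F x))"
proof -
  have slice: "cont (F x)" if "x \<in> topspace X" for x
  proof -
    have "continuous_map T (prod_topology X T) (\<lambda>y. (x, y))"
      using that by (simp add: continuous_map_paired)
    from continuous_map_compose[OF this F] show ?thesis by (simp add: o_def)
  qed
  have "\<exists>U. openin X U \<and> x \<in> U \<and> (\<forall>x'\<in>U. \<bar>haar_mean G (F x') - haar_mean G (F x)\<bar> < e)"
    if x: "x \<in> topspace X" and e: "e > 0" for x e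
  proof -
    define W where "W = {p \<in> topspace (prod_topology X T). \<bar>F (fst p) (snd p) - F x (snd p)\<bar> \<in> {..<e/2}}"
    have "continuous_map (prod_topology X T) euclideanreal (\<lambda>p. F (fst p) (snd p))"
      using F by (simp add: case_prod_unfold)
    moreover have "continuous_map (prod_topology X T) euclideanreal (\<lambda>p. F x (snd p))"
      using continuous_map_compose[OF continuous_map_snd slice[OF x]] by (simp add: o_def)
    ultimately have "continuous_map (prod_topology X T) euclideanreal (\<lambda>p. \<bar>F (fst p) (snd p) - F x (snd p)\<bar>)"
      by (intro continuous_map_real_abs continuous_map_diff)
    then have "openin (prod_topology X T) W"
      unfolding W_def by (rule openin_continuous_map_preimage) auto
    moreover have "compactin T (carrier G)" "{x} \<times> carrier G \<subseteq> W"
      using compact x e by (auto simp: compact_space_def W_def)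
    ultimately obtain U V where UV: "openin X U" "x \<in> U" "carrier G \<subseteq> V" "U \<times> V \<subseteq> W"
      using tube_lemma_right[of X T W "carrier G" x] x by auto
    have "\<bar>haar_mean G (F x') - haar_mean G (F x)\<bar> < e" if x': "x' \<in> U" for x'
    proof -
      have x'X: "x' \<in> topspace X" using x' UV(1) openin_subset by blast
      have c: "cont (\<lambda>y. (-1) * F x y)" using slice[OF x] by (intro continuous_map_real_mult) auto
      have c': "cont (\<lambda>y. F x' y + (-1) * F x y)" using slice[OF x'X] c by (intro continuous_map_add)
      have "\<bar>haar_mean G (\<lambda>y. F x' y + (-1) * F x y) - 0\<bar> \<le> e / 2"
      proof (rule haar_mean_approx[OF c'])
        fix y assume "y \<in> carrier G"
        then have "(x', y) \<in> W" using UV x' by blast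
        then show "\<bar>F x' y + (-1) * F x y - 0\<bar> \<le> e / 2" by (simp add: W_def)
      qed
      then show ?thesis
        using haar_mean_add[OF slice[OF x'X] c] haar_mean_scale[OF slice[OF x], of "-1"] e by simp
    qed
    then show ?thesis using UV by blast
  qed
  then have "\<exists>U. openin X U \<and> x \<in> U \<and> (\<forall>x'\<in>U. haar_mean G (F x') \<in> V)"
    if "open V" "x \<in> topspace X" "haar_mean G (F x) \<in> V" for V x
    using that unfolding open_dist dist_real_def by metis
  then show ?thesis
    by (simp add: continuous_map_eq_topcontinuous_at topcontinuous_at_def)
qed

section \<open>Fubini for the Haar mean\<close>

lemma compact_group_square: "compact_group (G \<times>\<times> G) (prod_topology T T)"
proof (intro compact_group.intro top_group.intro top_group_axioms.intro compact_group_axioms.intro)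
  interpret P: group "G \<times>\<times> G" by (rule DirProd_group[OF group_axioms group_axioms])
  show "group (G \<times>\<times> G)" by (rule P.is_group)
  have "continuous_map (prod_topology (prod_topology T T) (prod_topology T T)) (prod_topology T T)
     (\<lambda>p. (fst (fst p) \<otimes> fst (snd p), snd (fst p) \<otimes> snd (snd p)))"
    by (intro continuous_map_pairedI continuous_map_mult)
      (auto intro: continuous_map_compose[OF continuous_map_fst continuous_map_fst, unfolded o_def]
        continuous_map_compose[OF continuous_map_snd continuous_map_fst, unfolded o_def]
        continuous_map_compose[OF continuous_map_fst continuous_map_snd, unfolded o_def]
        continuous_map_compose[OF continuous_map_snd continuous_map_snd, unfolded o_def])
  then have "continuous_map (prod_topology (prod_topology T T) (prod_topology T T)) (prod_topology T T)
     (\<lambda>(p, q). p \<otimes>\<^bsub>G \<times>\<times> G\<^esub> q)"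
    by (rule continuous_map_eq) (auto simp: mult_DirProd)
  moreover have "continuous_map (prod_topology T T) (prod_topology T T) (\<lambda>p. (inv (fst p), inv (snd p)))"
    by (intro continuous_map_pairedI continuous_map_inv continuous_map_fst continuous_map_snd)
  then have "continuous_map (prod_topology T T) (prod_topology T T) (\<lambda>p. inv\<^bsub>G \<times>\<times> G\<^esub> p)"
    by (rule continuous_map_eq) (auto simp: inv_DirProd group_axioms)
  ultimately show "topological_group (G \<times>\<times> G) (prod_topology T T)"
    unfolding topological_group_def
    using P.is_group Hausdorff by (simp add: Hausdorff_space_prod_topology)
  show "compact_space (prod_topology T T)"
    using compact by (simp add: compact_space_prod_topology)
qed

lemma haar_mean_mean:
  assumes "\<And>a. a \<in> set as \<Longrightarrow> cont (h a)"
  shows "haar_mean G (\<lambda>x. (\<Sum>a\<leftarrow>as. h a x) / n) = (\<Sum>a\<leftarrow>as. haar_mean G (h a)) / n"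
proof -
  have "cont (\<lambda>x. \<Sum>a\<leftarrow>as. h a x) \<and> haar_mean G (\<lambda>x. \<Sum>a\<leftarrow>as. h a x) = (\<Sum>a\<leftarrow>as. haar_mean G (h a))"
    using assms by (induction as) (auto simp: haar_mean_add intro!: continuous_map_add)
  then show ?thesis
    using haar_mean_scale[of "\<lambda>x. \<Sum>a\<leftarrow>as. h a x" "inverse n"] by (simp add: divide_inverse mult.commute)
qed

lemma cont_slice:
  assumes F: "continuous_map (prod_topology T T) euclideanreal (\<lambda>(x, y). F x y)" and "x \<in> carrier G"
  shows "cont (F x)"
proof -
  have "continuous_map T (prod_topology T T) (\<lambda>y. (x, y))"
    using assms by (simp add: continuous_map_paired)
  from continuous_map_compose[OF this F] show ?thesis by (simp add: o_def)
qed

text \<open>Invariance in each variable keeps the iterated mean fixed when F is averaged over a list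
  of pairs. If that average is close to c everywhere, so is the iterated mean.\<close>

lemma iterated_haar_mean_approx:
  assumes F: "continuous_map (prod_topology T T) euclideanreal (\<lambda>(x, y). F x y)"
    and ps: "ps \<noteq> []" "set ps \<subseteq> carrier G \<times> carrier G"
    and approx: "\<And>x y. x \<in> carrier G \<Longrightarrow> y \<in> carrier G \<Longrightarrow>
      \<bar>(\<Sum>p\<leftarrow>ps. F (fst p \<otimes> x) (snd p \<otimes> y)) / real (length ps) - c\<bar> \<le> d"
  shows "\<bar>haar_mean G (\<lambda>x. haar_mean G (F x)) - c\<bar> \<le> d"
proof -
  define H where "H x y = (\<Sum>p\<leftarrow>ps. F (fst p \<otimes> x) (snd p \<otimes> y)) / real (length ps)" for x y
  have MF: "cont (\<lambda>x. haar_mean G (F x))"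
    by (rule continuous_map_haar_mean[OF F])
  have inner: "haar_mean G (H x) = (\<Sum>p\<leftarrow>ps. haar_mean G (F (fst p \<otimes> x))) / real (length ps)"
    if x: "x \<in> carrier G" for x
  proof -
    have "cont (\<lambda>y. F (fst p \<otimes> x) (snd p \<otimes> y))" if "p \<in> set ps" for p
      using that ps x by (intro cont_translate cont_slice[OF F]) auto
    then have "haar_mean G (H x) = (\<Sum>p\<leftarrow>ps. haar_mean G (\<lambda>y. F (fst p \<otimes> x) (snd p \<otimes> y))) / real (length ps)"
      unfolding H_def by (rule haar_mean_mean)
    also have "map (\<lambda>p. haar_mean G (\<lambda>y. F (fst p \<otimes> x) (snd p \<otimes> y))) ps = map (\<lambda>p. haar_mean G (F (fst p \<otimes> x))) ps"
      using ps x by (intro map_cong refl haar_mean_translate cont_slice[OF F]) auto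
    finally show ?thesis .
  qed
  have "haar_mean G (\<lambda>x. haar_mean G (H x)) =
      haar_mean G (\<lambda>x. (\<Sum>p\<leftarrow>ps. haar_mean G (F (fst p \<otimes> x))) / real (length ps))"
    by (rule haar_mean_cong[OF inner])
  also have "\<dots> = (\<Sum>p\<leftarrow>ps. haar_mean G (\<lambda>x. haar_mean G (F (fst p \<otimes> x)))) / real (length ps)"
    using ps by (intro haar_mean_mean cont_translate[OF MF]) auto
  also have "map (\<lambda>p. haar_mean G (\<lambda>x. haar_mean G (F (fst p \<otimes> x)))) ps = map (\<lambda>p. haar_mean G (\<lambda>x. haar_mean G (F x))) ps"
    using ps by (intro map_cong refl haar_mean_translate[OF MF]) auto
  finally have eq: "haar_mean G (\<lambda>x. haar_mean G (H x)) = haar_mean G (\<lambda>x. haar_mean G (F x))"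
    using ps by (simp add: sum_list_triv)
  have contH: "cont (H x)" if x: "x \<in> carrier G" for x
  proof -
    have "cont (\<lambda>y. \<Sum>p\<leftarrow>qs. F (fst p \<otimes> x) (snd p \<otimes> y))" if "set qs \<subseteq> set ps" for qs
      using that
    proof (induction qs)
      case (Cons q qs)
      then show ?case using ps x
        by (auto intro!: continuous_map_add cont_translate cont_slice[OF F])
    qed simp
    then show ?thesis unfolding H_def divide_inverse by (intro continuous_map_real_mult) auto
  qed
  have contMH: "cont (\<lambda>x. haar_mean G (H x))"
  proof -
    have "cont (\<lambda>x. \<Sum>p\<leftarrow>qs. haar_mean G (F (fst p \<otimes> x)))" if "set qs \<subseteq> set ps" for qs
      using that
    proof (induction qs)
      case (Cons q qs)
      then show ?case using ps
        by (auto intro!: continuous_map_add cont_translate[OF MF])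
    qed simp
    then have "cont (\<lambda>x. (\<Sum>p\<leftarrow>ps. haar_mean G (F (fst p \<otimes> x))) / real (length ps))"
      unfolding divide_inverse by (intro continuous_map_real_mult) auto
    then show ?thesis by (rule continuous_map_eq) (simp add: inner)
  qed
  have "\<bar>haar_mean G (H x) - c\<bar> \<le> d" if "x \<in> carrier G" for x
    using approx[OF that] by (intro haar_mean_approx[OF contH[OF that]]) (simp add: H_def)
  then show ?thesis
    using haar_mean_approx[OF contMH] eq by simp
qed

text \<open>Both iterated means are approximated by the same finite average on \<open>G \<times> G\<close>.\<close>

lemma haar_mean_swap:
  assumes F: "continuous_map (prod_topology T T) euclideanreal (\<lambda>(x, y). F x y)"
  shows "haar_mean G (\<lambda>x. haar_mean G (\<lambda>y. F x y)) = haar_mean G (\<lambda>y. haar_mean G (\<lambda>x. F x y))"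
proof (rule eq_if_arbitrarily_close[where K = 2])
  fix d :: real assume "d > 0"
  interpret S: compact_group "G \<times>\<times> G" "prod_topology T T" by (rule compact_group_square)
  obtain ps c where ps: "ps \<in> translators (G \<times>\<times> G)"
    "\<And>p. p \<in> carrier (G \<times>\<times> G) \<Longrightarrow> \<bar>lavg (G \<times>\<times> G) ps (\<lambda>(x, y). F x y) p - c\<bar> \<le> d"
    using S.lavg_almost_constant[OF F \<open>d > 0\<close>] by blast
  have ps': "ps \<noteq> []" "set ps \<subseteq> carrier G \<times> carrier G"
    using ps(1) by (auto simp: translators_def)
  have approx: "\<bar>(\<Sum>p\<leftarrow>ps. F (fst p \<otimes> x) (snd p \<otimes> y)) / real (length ps) - c\<bar> \<le> d"
    if "x \<in> carrier G" "y \<in> carrier G" for x y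
    using ps(2)[of "(x, y)"] that by (simp add: lavg_def case_prod_unfold mult_DirProd')
  have "continuous_map (prod_topology T T) (prod_topology T T) (\<lambda>p. (snd p, fst p))"
    by (intro continuous_map_pairedI continuous_map_fst continuous_map_snd)
  from continuous_map_compose[OF this F]
  have F': "continuous_map (prod_topology T T) euclideanreal (\<lambda>(x, y). F y x)"
    by (simp add: o_def case_prod_unfold)
  have "\<bar>haar_mean G (\<lambda>x. haar_mean G (F x)) - c\<bar> \<le> d"
    by (rule iterated_haar_mean_approx[OF F ps' approx])
  moreover have "\<bar>haar_mean G (\<lambda>y. haar_mean G (\<lambda>x. F x y)) - c\<bar> \<le> d"
    using ps' approx by (intro iterated_haar_mean_approx[OF F', of "map prod.swap ps"]) (auto simp: o_def)
  ultimately show "\<bar>haar_mean G (\<lambda>x. haar_mean G (\<lambda>y. F x y)) - haar_mean G (\<lambda>y. haar_mean G (\<lambda>x. F x y))\<bar> \<le> 2 * d"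
    by linarith
qed

end

section \<open>The convolution algebra\<close>

lemma continuous_map_euclidean_iff_tendsto:
  "continuous_map X euclidean f \<longleftrightarrow> (\<forall>x\<in>topspace X. (f \<longlongrightarrow> f x) (atin X x))"
  by (simp add: continuous_map_atin)

lemma continuous_map_complex_iff:
  "continuous_map X euclidean f \<longleftrightarrow>
     continuous_map X euclideanreal (\<lambda>x. Re (f x)) \<and> continuous_map X euclideanreal (\<lambda>x. Im (f x))"
  by (auto simp: continuous_map_euclidean_iff_tendsto tendsto_complex_iff)

lemma continuous_map_complex_mult:
  fixes f g :: "'a \<Rightarrow> complex"
  shows "continuous_map X euclidean f \<Longrightarrow> continuous_map X euclidean g \<Longrightarrow>
    continuous_map X euclidean (\<lambda>x. f x * g x)"
  by (auto simp: continuous_map_euclidean_iff_tendsto intro: tendsto_mult)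

lemma continuous_map_cnj:
  "continuous_map X euclidean f \<Longrightarrow> continuous_map X euclidean (\<lambda>x. cnj (f x))"
  by (auto simp: continuous_map_euclidean_iff_tendsto intro: tendsto_cnj)

definition haar_int :: "('a, 'b) monoid_scheme \<Rightarrow> ('a \<Rightarrow> complex) \<Rightarrow> complex" where
  "haar_int G f = Complex (haar_mean G (\<lambda>x. Re (f x))) (haar_mean G (\<lambda>x. Im (f x)))"

text \<open>Functions vanish off the carrier, so that identities in the convolution algebra are
  equations between functions.\<close>

definition cfun :: "('a, 'b) monoid_scheme \<Rightarrow> 'a topology \<Rightarrow> ('a \<Rightarrow> complex) set" where
  "cfun G T = {f. continuous_map T euclidean f \<and> (\<forall>x. x \<notin> carrier G \<longrightarrow> f x = 0)}"

definition conv :: "('a, 'b) monoid_scheme \<Rightarrow> ('a \<Rightarrow> complex) \<Rightarrow> ('a \<Rightarrow> complex) \<Rightarrow> 'a \<Rightarrow> complex" where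
  "conv G f g x = (if x \<in> carrier G then haar_int G (\<lambda>z. f z * g (inv\<^bsub>G\<^esub> z \<otimes>\<^bsub>G\<^esub> x)) else 0)"

definition star :: "('a, 'b) monoid_scheme \<Rightarrow> ('a \<Rightarrow> complex) \<Rightarrow> 'a \<Rightarrow> complex" where
  "star G f x = (if x \<in> carrier G then cnj (f (inv\<^bsub>G\<^esub> x)) else 0)"

text \<open>This is L_a; the inverse turns a |-> L_a into a left action.\<close>

definition transl :: "('a, 'b) monoid_scheme \<Rightarrow> 'a \<Rightarrow> ('a \<Rightarrow> complex) \<Rightarrow> 'a \<Rightarrow> complex" where
  "transl G a f x = (if x \<in> carrier G then f (inv\<^bsub>G\<^esub> a \<otimes>\<^bsub>G\<^esub> x) else 0)"

definition inner_prod :: "('a, 'b) monoid_scheme \<Rightarrow> ('a \<Rightarrow> complex) \<Rightarrow> ('a \<Rightarrow> complex) \<Rightarrow> complex" where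
  "inner_prod G f g = haar_int G (\<lambda>z. f z * cnj (g z))"

text \<open>The squared L2 norm, kept real for use in estimates; \<open>inner_self\<close> links it
  to the complex inner product.\<close>

definition sqnorm :: "('a, 'b) monoid_scheme \<Rightarrow> ('a \<Rightarrow> complex) \<Rightarrow> real" where
  "sqnorm G f = haar_mean G (\<lambda>z. (cmod (f z))\<^sup>2)"

context compact_group begin

abbreviation "ccont f \<equiv> continuous_map T euclidean (f :: 'a \<Rightarrow> complex)"
abbreviation convolution (infixl "\<star>" 70) where "f \<star> g \<equiv> conv G f g"
abbreviation "\<C> \<equiv> cfun G T"
abbreviation inner_G ("\<langle>_, _\<rangle>") where "\<langle>f, g\<rangle> \<equiv> inner_prod G f g"

lemma ccont_ReIm: "ccont f \<Longrightarrow> cont (\<lambda>x. Re (f x))" "ccont f \<Longrightarrow> cont (\<lambda>x. Im (f x))"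
  by (simp_all add: continuous_map_complex_iff)

lemma ccont_translate: "ccont f \<Longrightarrow> a \<in> carrier G \<Longrightarrow> ccont (\<lambda>x. f (a \<otimes> x))"
  using cont_translate[of "\<lambda>x. Re (f x)" a] cont_translate[of "\<lambda>x. Im (f x)" a]
  by (simp add: continuous_map_complex_iff)

lemma ccont_inv: "ccont f \<Longrightarrow> ccont (\<lambda>x. f (inv x))"
  using cont_inv[of "\<lambda>x. Re (f x)"] cont_inv[of "\<lambda>x. Im (f x)"]
  by (simp add: continuous_map_complex_iff)

lemma haar_int_cong: "(\<And>x. x \<in> carrier G \<Longrightarrow> f x = g x) \<Longrightarrow> haar_int G f = haar_int G g"
  unfolding haar_int_def by (intro arg_cong2[where f = Complex] haar_mean_cong) auto

lemma haar_int_add: "ccont f \<Longrightarrow> ccont g \<Longrightarrow> haar_int G (\<lambda>x. f x + g x) = haar_int G f + haar_int G g"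
  by (simp add: haar_int_def haar_mean_add ccont_ReIm complex_eq_iff)

lemma haar_int_scale:
  assumes "ccont f" shows "haar_int G (\<lambda>x. c * f x) = c * haar_int G f"
proof -
  have "haar_mean G (\<lambda>x. Re c * Re (f x) + (- Im c) * Im (f x)) = Re c * haar_mean G (\<lambda>x. Re (f x)) + (- Im c) * haar_mean G (\<lambda>x. Im (f x))"
       "haar_mean G (\<lambda>x. Re c * Im (f x) + Im c * Re (f x)) = Re c * haar_mean G (\<lambda>x. Im (f x)) + Im c * haar_mean G (\<lambda>x. Re (f x))"
    using ccont_ReIm[OF assms]
    by (subst haar_mean_add; simp add: haar_mean_scale continuous_map_real_mult
         haar_mean_scale[of _ "- Im c", simplified])+
  then show ?thesis
    by (simp add: haar_int_def complex_eq_iff)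
qed

lemma haar_int_cnj:
  assumes "ccont f" shows "haar_int G (\<lambda>x. cnj (f x)) = cnj (haar_int G f)"
  using haar_mean_scale[of "\<lambda>x. Im (f x)" "-1"] ccont_ReIm[OF assms]
  by (simp add: haar_int_def complex_eq_iff)

lemma haar_int_translate: "ccont f \<Longrightarrow> a \<in> carrier G \<Longrightarrow> haar_int G (\<lambda>x. f (a \<otimes> x)) = haar_int G f"
  using haar_mean_translate[of "\<lambda>x. Re (f x)" a] haar_mean_translate[of "\<lambda>x. Im (f x)" a]
  by (simp add: haar_int_def ccont_ReIm)

lemma haar_int_inv: "ccont f \<Longrightarrow> haar_int G (\<lambda>x. f (inv x)) = haar_int G f"
  using haar_mean_inv[of "\<lambda>x. Re (f x)"] haar_mean_inv[of "\<lambda>x. Im (f x)"]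
  by (simp add: haar_int_def ccont_ReIm)

lemma haar_int_of_real: "haar_int G (\<lambda>x. complex_of_real (f x)) = of_real (haar_mean G f)"
  by (simp add: haar_int_def complex_eq_iff)

lemma haar_int_swap:
  fixes F :: "'a \<Rightarrow> 'a \<Rightarrow> complex"
  assumes "continuous_map (prod_topology T T) euclidean (\<lambda>(x, y). F x y)"
  shows "haar_int G (\<lambda>x. haar_int G (\<lambda>y. F x y)) = haar_int G (\<lambda>y. haar_int G (\<lambda>x. F x y))"
proof -
  have "continuous_map (prod_topology T T) euclideanreal (\<lambda>(x, y). Re (F x y))"
       "continuous_map (prod_topology T T) euclideanreal (\<lambda>(x, y). Im (F x y))"
    using assms by (simp_all add: continuous_map_complex_iff case_prod_unfold)
  from this[THEN haar_mean_swap] show ?thesis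
    by (simp add: haar_int_def)
qed

lemma ccont_haar_int:
  fixes F :: "'c \<Rightarrow> 'a \<Rightarrow> complex"
  assumes "continuous_map (prod_topology X T) euclidean (\<lambda>(x, y). F x y)"
  shows "continuous_map X euclidean (\<lambda>x. haar_int G (F x))"
proof -
  have "continuous_map (prod_topology X T) euclideanreal (\<lambda>(x, y). Re (F x y))"
       "continuous_map (prod_topology X T) euclideanreal (\<lambda>(x, y). Im (F x y))"
    using assms by (simp_all add: continuous_map_complex_iff case_prod_unfold)
  from this[THEN continuous_map_haar_mean] show ?thesis
    by (simp add: haar_int_def continuous_map_complex_iff)
qed

lemma cfunD: "f \<in> \<C> \<Longrightarrow> ccont f" "f \<in> \<C> \<Longrightarrow> x \<notin> carrier G \<Longrightarrow> f x = 0"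
  by (auto simp: cfun_def)

lemma cfun_add: "f \<in> \<C> \<Longrightarrow> g \<in> \<C> \<Longrightarrow> (\<lambda>x. f x + g x) \<in> \<C>"
  by (auto simp: cfun_def intro: continuous_map_add)

lemma cfun_diff: "f \<in> \<C> \<Longrightarrow> g \<in> \<C> \<Longrightarrow> (\<lambda>x. f x - g x) \<in> \<C>"
  by (auto simp: cfun_def intro: continuous_map_diff)

lemma cfun_scale: "f \<in> \<C> \<Longrightarrow> (\<lambda>x. c * f x) \<in> \<C>"
  by (auto simp: cfun_def intro!: continuous_map_complex_mult)

lemma cfun_sum: "(\<And>i. i \<in> I \<Longrightarrow> f i \<in> \<C>) \<Longrightarrow> (\<lambda>x. \<Sum>i\<in>I. f i x) \<in> \<C>"
proof (induction I rule: infinite_finite_induct)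
  case (insert i I)
  then show ?case using cfun_add[of "f i" "\<lambda>x. \<Sum>i\<in>I. f i x"] by simp
qed (auto simp: cfun_def)

lemma cfun_restrict:
  assumes "ccont f" shows "(\<lambda>x. if x \<in> carrier G then f x else 0) \<in> \<C>"
  unfolding cfun_def using continuous_map_eq[OF assms, of "\<lambda>x. if x \<in> carrier G then f x else 0"] by simp

lemma cfun_star: "f \<in> \<C> \<Longrightarrow> star G f \<in> \<C>"
  unfolding star_def[abs_def] by (intro cfun_restrict continuous_map_cnj ccont_inv cfunD)

lemma cfun_transl: "f \<in> \<C> \<Longrightarrow> a \<in> carrier G \<Longrightarrow> transl G a f \<in> \<C>"
  unfolding transl_def[abs_def] by (intro cfun_restrict ccont_translate cfunD inv_closed)

section \<open>Convolution as an associative product with involution\<close>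

lemma continuous_map_conv_kernel:
  assumes "ccont f" "ccont g"
  shows "continuous_map (prod_topology T T) euclidean (\<lambda>(x, z). f z * g (inv z \<otimes> x))"
proof -
  have "continuous_map (prod_topology T T) T (\<lambda>p. inv (snd p) \<otimes> fst p)"
    by (intro continuous_map_mult continuous_map_inv continuous_map_fst continuous_map_snd)
  from continuous_map_compose[OF this assms(2)] continuous_map_compose[OF continuous_map_snd assms(1)]
  show ?thesis
    unfolding case_prod_unfold o_def by (intro continuous_map_complex_mult)
qed

lemma cfun_conv: "f \<in> \<C> \<Longrightarrow> g \<in> \<C> \<Longrightarrow> f \<star> g \<in> \<C>"
  unfolding conv_def[abs_def]
  by (intro cfun_restrict ccont_haar_int continuous_map_conv_kernel cfunD)

lemmas cfun_intros = cfun_add cfun_diff cfun_scale cfun_sum cfun_star cfun_transl cfun_conv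

lemma ccont_conv_section:
  assumes "ccont f" "ccont g" "x \<in> carrier G"
  shows "ccont (\<lambda>z. f z * g (inv z \<otimes> x))"
proof -
  have "continuous_map T T (\<lambda>z. inv z \<otimes> x)"
    using assms(3) by (intro continuous_map_mult continuous_map_inv) auto
  from continuous_map_compose[OF this assms(2)] show ?thesis
    using assms(1) by (intro continuous_map_complex_mult) (simp_all add: o_def)
qed

lemma conv_add_left: "f \<in> \<C> \<Longrightarrow> g \<in> \<C> \<Longrightarrow> h \<in> \<C> \<Longrightarrow> (\<lambda>x. f x + g x) \<star> h = (\<lambda>x. (f \<star> h) x + (g \<star> h) x)"
  using haar_int_add[OF ccont_conv_section ccont_conv_section]
  by (auto simp: conv_def fun_eq_iff distrib_right cfunD)

lemma conv_add_right: "f \<in> \<C> \<Longrightarrow> g \<in> \<C> \<Longrightarrow> h \<in> \<C> \<Longrightarrow> h \<star> (\<lambda>x. f x + g x) = (\<lambda>x. (h \<star> f) x + (h \<star> g) x)"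
  using haar_int_add[OF ccont_conv_section ccont_conv_section]
  by (auto simp: conv_def fun_eq_iff distrib_left cfunD)

lemma conv_scale_left: "f \<in> \<C> \<Longrightarrow> h \<in> \<C> \<Longrightarrow> (\<lambda>x. c * f x) \<star> h = (\<lambda>x. c * (f \<star> h) x)"
  using haar_int_scale[OF ccont_conv_section]
  by (auto simp: conv_def fun_eq_iff mult.assoc cfunD)

lemma conv_scale_right: "f \<in> \<C> \<Longrightarrow> h \<in> \<C> \<Longrightarrow> h \<star> (\<lambda>x. c * f x) = (\<lambda>x. c * (h \<star> f) x)"
  using haar_int_scale[OF ccont_conv_section]
  by (auto simp: conv_def fun_eq_iff mult.left_commute cfunD)

lemma conv_diff_left: "f \<in> \<C> \<Longrightarrow> g \<in> \<C> \<Longrightarrow> h \<in> \<C> \<Longrightarrow> (\<lambda>x. f x - g x) \<star> h = (\<lambda>x. (f \<star> h) x - (g \<star> h) x)"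
  using conv_add_left[of f "\<lambda>x. (-1) * g x" h] conv_scale_left[of g h "-1"] cfun_scale[of g "-1"] by simp

lemma conv_diff_right: "f \<in> \<C> \<Longrightarrow> g \<in> \<C> \<Longrightarrow> h \<in> \<C> \<Longrightarrow> h \<star> (\<lambda>x. f x - g x) = (\<lambda>x. (h \<star> f) x - (h \<star> g) x)"
  using conv_add_right[of f "\<lambda>x. (-1) * g x" h] conv_scale_right[of g h "-1"] cfun_scale[of g "-1"] by simp

text \<open>Substitute z -> a z in the integral. Since translation touches the left factor only, the
  space of all u with u * q = u is translation-invariant.\<close>

lemma transl_conv:
  assumes "f \<in> \<C>" "g \<in> \<C>" and a: "a \<in> carrier G"
  shows "transl G a (f \<star> g) = transl G a f \<star> g"
proof
  fix x
  show "transl G a (f \<star> g) x = (transl G a f \<star> g) x"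
  proof (cases "x \<in> carrier G")
    case x: True
    have *: "ccont (\<lambda>z. f z * g (inv z \<otimes> (inv a \<otimes> x)))"
      using assms x by (intro ccont_conv_section cfunD) auto
    have "haar_int G (\<lambda>z. transl G a f z * g (inv z \<otimes> x)) =
          haar_int G (\<lambda>z. f (inv a \<otimes> z) * g (inv (inv a \<otimes> z) \<otimes> (inv a \<otimes> x)))"
      using a x by (intro haar_int_cong) (auto simp: transl_def inv_mult_group m_assoc[symmetric], simp add: m_assoc)
    also have "\<dots> = haar_int G (\<lambda>z. f z * g (inv z \<otimes> (inv a \<otimes> x)))"
      using a by (intro haar_int_translate[OF *, of "inv a"]) auto
    finally show ?thesis using x a by (simp add: transl_def conv_def)
  qed (simp add: transl_def conv_def)
qed

text \<open>Fubini exchanges the integrals over z and w; left invariance then allows z to be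
  replaced by w z in the inner one.\<close>

lemma conv_assoc:
  assumes f: "f \<in> \<C>" and g: "g \<in> \<C>" and h: "h \<in> \<C>"
  shows "(f \<star> g) \<star> h = f \<star> (g \<star> h)"
proof
  fix x
  show "((f \<star> g) \<star> h) x = (f \<star> (g \<star> h)) x"
  proof (cases "x \<in> carrier G")
    case x: True
    have fgh: "ccont f" "ccont g" "ccont h" using f g h by (auto intro: cfunD)
    let ?F = "\<lambda>z w. f w * g (inv w \<otimes> z) * h (inv z \<otimes> x)"
    have "continuous_map (prod_topology T T) T (\<lambda>p. inv (fst p) \<otimes> x)"
      using x by (intro continuous_map_mult continuous_map_inv continuous_map_fst continuous_map_cst)
    from continuous_map_compose[OF this fgh(3)] continuous_map_conv_kernel[OF fgh(1,2)]
    have F: "continuous_map (prod_topology T T) euclidean (\<lambda>(z, w). ?F z w)"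
      by (simp add: case_prod_unfold o_def continuous_map_complex_mult)
    have "((f \<star> g) \<star> h) x = haar_int G (\<lambda>z. haar_int G (\<lambda>w. ?F z w))"
    proof -
      have "(f \<star> g) z * h (inv z \<otimes> x) = haar_int G (\<lambda>w. ?F z w)" if z: "z \<in> carrier G" for z
        using haar_int_scale[OF ccont_conv_section[OF fgh(1,2) z], of "h (inv z \<otimes> x)"] z
        by (simp add: conv_def mult.commute)
      then show ?thesis using x by (simp add: conv_def[of G _ h] cong: haar_int_cong) 
    qed
    also have "\<dots> = haar_int G (\<lambda>w. haar_int G (\<lambda>z. ?F z w))"
      by (rule haar_int_swap[OF F])
    also have "\<dots> = haar_int G (\<lambda>w. f w * (g \<star> h) (inv w \<otimes> x))"
    proof (rule haar_int_cong)
      fix w assume w: "w \<in> carrier G"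
      have c: "ccont (\<lambda>z. g z * h (inv z \<otimes> (inv w \<otimes> x)))"
        using w x by (intro ccont_conv_section fgh) auto
      have "haar_int G (\<lambda>z. ?F z w) = haar_int G (\<lambda>z. f w * (g (inv w \<otimes> z) * h (inv (inv w \<otimes> z) \<otimes> (inv w \<otimes> x))))"
        using w x by (intro haar_int_cong)
          (auto simp: inv_mult_group m_assoc[symmetric] mult.assoc, simp add: m_assoc)
      also have "\<dots> = f w * haar_int G (\<lambda>z. g (inv w \<otimes> z) * h (inv (inv w \<otimes> z) \<otimes> (inv w \<otimes> x)))"
        using w by (intro haar_int_scale ccont_translate[OF c]) auto
      also have "haar_int G (\<lambda>z. g (inv w \<otimes> z) * h (inv (inv w \<otimes> z) \<otimes> (inv w \<otimes> x))) =
          haar_int G (\<lambda>z. g z * h (inv z \<otimes> (inv w \<otimes> x)))"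
        using w by (intro haar_int_translate[OF c]) auto
      finally show "haar_int G (\<lambda>z. ?F z w) = f w * (g \<star> h) (inv w \<otimes> x)"
        using w x by (simp add: conv_def)
    qed
    finally show ?thesis using x by (simp add: conv_def[of G f])
  qed (simp add: conv_def)
qed

text \<open>The translation z -> x z matches the two integrands.\<close>

lemma star_conv:
  assumes f: "f \<in> \<C>" and g: "g \<in> \<C>"
  shows "star G (f \<star> g) = star G g \<star> star G f"
proof
  fix x
  show "star G (f \<star> g) x = (star G g \<star> star G f) x"
  proof (cases "x \<in> carrier G")
    case x: True
    have fg: "ccont f" "ccont g" using f g by (auto intro: cfunD)
    have c: "ccont (\<lambda>z. f z * g (inv z \<otimes> inv x))"
      using x by (intro ccont_conv_section fg) auto
    have c': "ccont (\<lambda>z. star G g z * star G f (inv z \<otimes> x))"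
      using x f g by (intro ccont_conv_section cfunD[OF cfun_star]) auto
    have "star G (f \<star> g) x = haar_int G (\<lambda>z. cnj (f z * g (inv z \<otimes> inv x)))"
      using x by (simp only: haar_int_cnj[OF c] star_def conv_def inv_closed if_True)
    also have "\<dots> = haar_int G (\<lambda>z. star G g (x \<otimes> z) * star G f (inv (x \<otimes> z) \<otimes> x))"
    proof (rule haar_int_cong)
      fix z assume z: "z \<in> carrier G"
      have "inv (inv (x \<otimes> z) \<otimes> x) = z"
        using x z by (simp add: inv_mult_group m_assoc)
      then show "cnj (f z * g (inv z \<otimes> inv x)) = star G g (x \<otimes> z) * star G f (inv (x \<otimes> z) \<otimes> x)"
        using x z by (simp add: star_def inv_mult_group)
    qed
    also have "\<dots> = haar_int G (\<lambda>z. star G g z * star G f (inv z \<otimes> x))"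
      by (rule haar_int_translate[OF c' x])
    finally show ?thesis using x by (simp add: conv_def)
  qed (simp add: star_def conv_def)
qed

lemma star_star [simp]: "f \<in> \<C> \<Longrightarrow> star G (star G f) = f"
  by (auto simp: star_def fun_eq_iff cfun_def)

lemma star_add: "star G (\<lambda>x. f x + g x) = (\<lambda>x. star G f x + star G g x)"
  by (auto simp: star_def fun_eq_iff)

lemma star_diff: "star G (\<lambda>x. f x - g x) = (\<lambda>x. star G f x - star G g x)"
  by (auto simp: star_def fun_eq_iff)

lemma star_scale: "star G (\<lambda>x. c * f x) = (\<lambda>x. cnj c * star G f x)"
  by (auto simp: star_def fun_eq_iff)

lemma transl_transl: "a \<in> carrier G \<Longrightarrow> b \<in> carrier G \<Longrightarrow> transl G a (transl G b f) = transl G (a \<otimes> b) f"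
  by (auto simp: transl_def fun_eq_iff inv_mult_group m_assoc)

lemma transl_one: "f \<in> \<C> \<Longrightarrow> transl G \<one> f = f"
  by (auto simp: transl_def fun_eq_iff cfun_def)

section \<open>Inner product and L2 bounds for convolutions\<close>

lemma inner_conv: "f \<in> \<C> \<Longrightarrow> g \<in> \<C> \<Longrightarrow> \<langle>f, g\<rangle> = (f \<star> star G g) \<one>"
  unfolding inner_prod_def conv_def by (simp, rule haar_int_cong) (simp add: star_def)

text \<open>Values of convolutions are matrix coefficients of left translation. This gives both the
  uniform bound by Cauchy-Schwarz and, later, the continuity of the representation.\<close>

lemma conv_eq_inner:
  assumes "f \<in> \<C>" "g \<in> \<C>" "x \<in> carrier G"
  shows "(f \<star> g) x = \<langle>f, transl G x (star G g)\<rangle>"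
  unfolding inner_prod_def conv_def using assms(3)
  by (simp, intro haar_int_cong) (simp add: transl_def star_def inv_mult_group)

lemma ccont_inner: "f \<in> \<C> \<Longrightarrow> g \<in> \<C> \<Longrightarrow> ccont (\<lambda>z. f z * cnj (g z))"
  by (intro continuous_map_complex_mult continuous_map_cnj cfunD)

lemma inner_transl:
  assumes "f \<in> \<C>" "g \<in> \<C>" "a \<in> carrier G"
  shows "\<langle>transl G a f, transl G a g\<rangle> = \<langle>f, g\<rangle>"
proof -
  have "\<langle>transl G a f, transl G a g\<rangle> = haar_int G (\<lambda>z. f (inv a \<otimes> z) * cnj (g (inv a \<otimes> z)))"
    unfolding inner_prod_def by (rule haar_int_cong) (simp add: transl_def)
  also have "\<dots> = \<langle>f, g\<rangle>"
    unfolding inner_prod_def using assms by (intro haar_int_translate[OF ccont_inner]) auto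
  finally show ?thesis .
qed

lemma inner_add_left: "f \<in> \<C> \<Longrightarrow> g \<in> \<C> \<Longrightarrow> h \<in> \<C> \<Longrightarrow> \<langle>\<lambda>x. f x + g x, h\<rangle> = \<langle>f, h\<rangle> + \<langle>g, h\<rangle>"
  by (simp add: inner_prod_def distrib_right haar_int_add ccont_inner)

lemma inner_scale_left: "f \<in> \<C> \<Longrightarrow> h \<in> \<C> \<Longrightarrow> \<langle>\<lambda>x. c * f x, h\<rangle> = c * \<langle>f, h\<rangle>"
  by (simp add: inner_prod_def mult.assoc haar_int_scale ccont_inner)

lemma inner_cnj: "f \<in> \<C> \<Longrightarrow> h \<in> \<C> \<Longrightarrow> \<langle>h, f\<rangle> = cnj \<langle>f, h\<rangle>"
  using haar_int_cnj[OF ccont_inner[of f h]] by (simp add: inner_prod_def mult.commute)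

lemma inner_diff_left: "f \<in> \<C> \<Longrightarrow> g \<in> \<C> \<Longrightarrow> h \<in> \<C> \<Longrightarrow> \<langle>\<lambda>x. f x - g x, h\<rangle> = \<langle>f, h\<rangle> - \<langle>g, h\<rangle>"
  using inner_add_left[of f "\<lambda>x. (-1) * g x" h] inner_scale_left[of g h "-1"] cfun_scale[of g "-1"] by simp

lemma inner_diff_right: "f \<in> \<C> \<Longrightarrow> g \<in> \<C> \<Longrightarrow> h \<in> \<C> \<Longrightarrow> \<langle>h, \<lambda>x. f x - g x\<rangle> = \<langle>h, f\<rangle> - \<langle>h, g\<rangle>"
  using inner_cnj[of "\<lambda>x. f x - g x" h] inner_cnj[of f h] inner_cnj[of g h]
  by (simp add: inner_diff_left cfun_diff)

lemma inner_scale_right: "f \<in> \<C> \<Longrightarrow> h \<in> \<C> \<Longrightarrow> \<langle>h, \<lambda>x. c * f x\<rangle> = cnj c * \<langle>h, f\<rangle>"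
  using inner_cnj[of "\<lambda>x. c * f x" h] inner_cnj[of f h]
  by (simp add: inner_scale_left cfun_scale)

lemma inner_self: "f \<in> \<C> \<Longrightarrow> \<langle>f, f\<rangle> = of_real (sqnorm G f)"
  using haar_int_of_real[of "\<lambda>z. (cmod (f z))\<^sup>2"]
  by (simp add: inner_prod_def sqnorm_def complex_norm_square[symmetric])

lemma cont_norm: "f \<in> \<C> \<Longrightarrow> cont (\<lambda>z. (cmod (f z))\<^sup>2)"
  unfolding power2_eq_square by (intro continuous_map_real_mult continuous_map_norm cfunD)

lemma sqnorm_nonneg: "f \<in> \<C> \<Longrightarrow> 0 \<le> sqnorm G f"
  unfolding sqnorm_def by (intro haar_mean_nonneg cont_norm) auto

lemma sqnorm_pos:
  assumes "f \<in> \<C>" "f x \<noteq> 0" shows "0 < sqnorm G f"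
proof -
  have "x \<in> carrier G" using assms by (auto dest: cfunD(2))
  then show ?thesis
    unfolding sqnorm_def using assms by (intro haar_mean_pos[where ?x0.0 = x] cont_norm) auto
qed

lemma sqnorm_le:
  assumes f: "f \<in> \<C>" and B: "\<And>x. x \<in> carrier G \<Longrightarrow> cmod (f x) \<le> B"
  shows "sqnorm G f \<le> B\<^sup>2"
  unfolding sqnorm_def
  using haar_mean_mono[OF cont_norm[OF f], of "\<lambda>x. B\<^sup>2"] power_mono[OF B] by simp

lemma sqnorm_diff: 
  assumes "f \<in> \<C>" "g \<in> \<C>"
  shows "sqnorm G (\<lambda>x. f x - g x) = sqnorm G f - 2 * Re \<langle>f, g\<rangle> + sqnorm G g"
proof -
  have "complex_of_real (sqnorm G (\<lambda>x. f x - g x)) = of_real (sqnorm G f) - (\<langle>f, g\<rangle> + cnj \<langle>f, g\<rangle>) + of_real (sqnorm G g)"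
    using assms by (simp add: inner_self[symmetric] inner_diff_left inner_diff_right cfun_diff inner_cnj[of f g])
  also have "\<dots> = of_real (sqnorm G f - 2 * Re \<langle>f, g\<rangle> + sqnorm G g)"
    by (simp add: complex_eq_iff)
  finally show ?thesis by (simp only: of_real_eq_iff)
qed

lemma sqnorm_star: "f \<in> \<C> \<Longrightarrow> sqnorm G (star G f) = sqnorm G f"
  using haar_mean_inv[OF cont_norm[of f]] unfolding sqnorm_def
  by (subst haar_mean_cong[where g = "\<lambda>x. (cmod (f (inv x)))\<^sup>2"]) (auto simp: star_def)

lemma sqnorm_transl: "f \<in> \<C> \<Longrightarrow> a \<in> carrier G \<Longrightarrow> sqnorm G (transl G a f) = sqnorm G f"
  using inner_transl[of f f a] inner_self[of f] inner_self[of "transl G a f"] by (simp add: cfun_transl)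

lemma sqnorm_scale: "f \<in> \<C> \<Longrightarrow> sqnorm G (\<lambda>x. c * f x) = (cmod c)\<^sup>2 * sqnorm G f"
  unfolding sqnorm_def norm_mult power_mult_distrib by (intro haar_mean_scale cont_norm)

lemma Cauchy_Schwarz:
  assumes f: "f \<in> \<C>" and g: "g \<in> \<C>"
  shows "(cmod \<langle>f, g\<rangle>)\<^sup>2 \<le> sqnorm G f * sqnorm G g"
proof (cases "sqnorm G g = 0")
  case True
  then have "g x = 0" for x using sqnorm_pos[OF g, of x] by force
  then have "\<langle>f, g\<rangle> = 0" by (simp add: inner_prod_def haar_int_def complex_eq_iff)
  then show ?thesis using True by simp
next
  case False
  then have pos: "sqnorm G g > 0" using sqnorm_nonneg[OF g] by simp
  define c where "c = \<langle>f, g\<rangle> / of_real (sqnorm G g)"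
  have "0 \<le> sqnorm G (\<lambda>x. f x - c * g x)" using f g by (intro sqnorm_nonneg cfun_intros)
  also have "\<dots> = sqnorm G f - 2 * Re (cnj c * \<langle>f, g\<rangle>) + (cmod c)\<^sup>2 * sqnorm G g"
    using f g by (simp add: sqnorm_diff cfun_scale inner_scale_right sqnorm_scale)
  also have "Re (cnj c * \<langle>f, g\<rangle>) = (cmod \<langle>f, g\<rangle>)\<^sup>2 / sqnorm G g"
    by (simp add: c_def cmod_power2) (simp add: power2_eq_square add_divide_distrib)
  also have "(cmod c)\<^sup>2 * sqnorm G g = (cmod \<langle>f, g\<rangle>)\<^sup>2 / sqnorm G g"
    using pos by (simp add: c_def norm_divide power_divide power2_eq_square)
  finally show ?thesis using pos by (simp add: field_simps)
qed

text \<open>By \<open>conv_eq_inner\<close> this is Cauchy-Schwarz, because translation and star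
  preserve \<open>sqnorm\<close>. The bound does not depend on x, which is how L2 estimates become
  uniform ones.\<close>

lemma conv_bound:
  assumes "f \<in> \<C>" "g \<in> \<C>"
  shows "(cmod ((f \<star> g) x))\<^sup>2 \<le> sqnorm G f * sqnorm G g"
proof (cases "x \<in> carrier G")
  case True
  then show ?thesis
    using Cauchy_Schwarz[of f "transl G x (star G g)"] assms
    by (simp add: conv_eq_inner cfun_intros sqnorm_transl sqnorm_star)
qed (use assms in \<open>simp add: conv_def sqnorm_nonneg\<close>)

lemma sqnorm_conv_le:
  assumes "f \<in> \<C>" "g \<in> \<C>"
  shows "sqnorm G (f \<star> g) \<le> sqnorm G f * sqnorm G g"
proof -
  have nn: "0 \<le> sqnorm G f * sqnorm G g" using assms by (intro mult_nonneg_nonneg sqnorm_nonneg)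
  have "sqnorm G (f \<star> g) \<le> (sqrt (sqnorm G f * sqnorm G g))\<^sup>2"
    using assms conv_bound[OF assms] by (intro sqnorm_le cfun_conv real_le_rsqrt)
  then show ?thesis using nn by simp
qed

text \<open>Substitute z -> x z^-1, using invariance under inversion and translation; commutativity
  identifies x z^-1 with z^-1 x.\<close>

lemma conv_commute:
  assumes "comm_group G" "f \<in> \<C>" "g \<in> \<C>"
  shows "f \<star> g = g \<star> f"
proof
  interpret comm_group G by (rule assms)
  fix x
  show "(f \<star> g) x = (g \<star> f) x"
  proof (cases "x \<in> carrier G")
    case x: True
    have c: "ccont (\<lambda>z. f z * g (inv z \<otimes> x))"
      using x assms by (intro ccont_conv_section cfunD)
    have "haar_int G (\<lambda>z. g z * f (inv z \<otimes> x)) = haar_int G (\<lambda>z. f (x \<otimes> inv z) * g (inv (x \<otimes> inv z) \<otimes> x))"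
    proof (rule haar_int_cong)
      fix z assume z: "z \<in> carrier G"
      have "inv (x \<otimes> inv z) \<otimes> x = z"
        using x z by (simp add: inv_mult_group m_assoc)
      then show "g z * f (inv z \<otimes> x) = f (x \<otimes> inv z) * g (inv (x \<otimes> inv z) \<otimes> x)"
        using x z by (simp add: m_comm mult.commute)
    qed
    also have "\<dots> = haar_int G (\<lambda>z. f (x \<otimes> z) * g (inv (x \<otimes> z) \<otimes> x))"
      by (rule haar_int_inv[OF ccont_translate[OF c x]])
    also have "\<dots> = haar_int G (\<lambda>z. f z * g (inv z \<otimes> x))"
      by (rule haar_int_translate[OF c x])
    finally show ?thesis using x by (simp add: conv_def)
  qed (simp add: conv_def)
qed

end

section \<open>Limits of normalised convolution powers\<close>

text \<open>Log-convexity makes the ratios t (n + 1) / t n increase and submultiplicativity bounds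
  them by t 0; l is their limit. The normalised sequence c decreases and c (n + N + 1) / c n tends
  to 1 for fixed N, while submultiplicativity bounds this quotient by c N, so c N \<ge> 1. The
  exponent n + 1 fits the index shift: t n will belong to the (n+1)-st power.\<close>

lemma submultiplicative_log_convex_limit:
  fixes t :: "nat \<Rightarrow> real"
  assumes t0: "t 0 > 0" and t1: "t 1 > 0"
    and log_convex: "\<And>n. (t (n + 1))\<^sup>2 \<le> t n * t (n + 2)"
    and submult: "\<And>m n. t (m + n + 1) \<le> t m * t n"
  obtains l d where "l > 0" "d \<ge> 1" "(\<lambda>n. t n / l ^ (n + 1)) \<longlonglongrightarrow> d" "\<And>n. t n / l ^ (n + 1) \<ge> 1"
proof -
  have pos: "t n > 0" for n
  proof -
    have "t n > 0 \<and> t (n + 1) > 0"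
    proof (induction n)
      case (Suc n)
      then have "0 < t n * t (n + 2)" using log_convex[of n] by (intro less_le_trans[OF _ log_convex]) simp
      then show ?case using Suc by (simp add: zero_less_mult_iff)
    qed (use t0 t1 in auto)
    then show ?thesis by simp
  qed
  define r where "r n = t (n + 1) / t n" for n
  have r_pos: "r n > 0" for n using pos by (simp add: r_def)
  have "r n \<le> r (Suc n)" for n
    using log_convex[of n] pos[of n] pos[of "n + 1"] by (simp add: r_def field_simps power2_eq_square)
  then have inc: "incseq r" by (rule incseq_SucI)
  moreover have "r n \<le> t 0" for n
    using submult[of n 0] pos[of n] by (simp add: r_def field_simps)
  ultimately obtain l where l: "r \<longlonglongrightarrow> l" "\<And>n. r n \<le> l"
    using incseq_convergent[of r "t 0"] by auto
  have l_pos: "l > 0" using l(2)[of 0] r_pos[of 0] by linarith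
  define c where "c n = t n / l ^ (n + 1)" for n
  have c_pos: "c n > 0" for n using pos l_pos by (simp add: c_def)
  have c_ratio: "c (Suc n) / c n = r n / l" for n
    using pos[of n] l_pos by (simp add: c_def r_def)
  have "c (Suc n) \<le> c n" for n
  proof -
    have "c (Suc n) / c n \<le> 1" using l(2)[of n] l_pos by (simp add: c_ratio)
    then show ?thesis using c_pos[of n] by simp
  qed
  then have "decseq c" by (rule decseq_SucI)
  then obtain d where d: "c \<longlonglongrightarrow> d"
    using decseq_convergent[of c 0] c_pos by (metis less_imp_le)
  have c_submult: "c (m + n + 1) \<le> c m * c n" for m n
  proof -
    have "c (m + n + 1) \<le> (t m * t n) / l ^ (m + n + 2)"
      using submult[of m n] l_pos by (simp add: c_def divide_right_mono)
    also have "\<dots> = c m * c n" by (simp add: c_def power_add)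
    finally show ?thesis .
  qed
  have "(\<lambda>n. r n / l) \<longlonglongrightarrow> l / l" using l l_pos by (intro tendsto_intros) auto
  then have ratio: "(\<lambda>n. c (Suc n) / c n) \<longlonglongrightarrow> 1" using l_pos by (simp add: c_ratio)
  have ratio_k: "(\<lambda>n. c (n + k) / c n) \<longlonglongrightarrow> 1" for k
  proof (induction k)
    case 0
    have "c n / c n = 1" for n using c_pos[of n] by simp
    then show ?case by simp
  next
    case (Suc k)
    have "(\<lambda>n. c (Suc (n + k)) / c (n + k)) \<longlonglongrightarrow> 1"
      using LIMSEQ_ignore_initial_segment[OF ratio, of k] by simp
    from tendsto_mult[OF this Suc] have "(\<lambda>n. c (Suc (n + k)) / c (n + k) * (c (n + k) / c n)) \<longlonglongrightarrow> 1" by simp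
    moreover have "c (Suc (n + k)) / c (n + k) * (c (n + k) / c n) = c (n + Suc k) / c n" for n
      using c_pos[of "n + k"] by simp
    ultimately show ?case by (simp only:)
  qed
  have c_ge: "c N \<ge> 1" for N
  proof (rule LIMSEQ_le_const2[OF ratio_k[of "N + 1"]], intro exI allI impI)
    fix n
    show "c (n + (N + 1)) / c n \<le> c N"
      using c_submult[of n N] c_pos[of n] by (simp add: divide_le_eq mult.commute)
  qed
  have "d \<ge> 1" using LIMSEQ_le_const[OF d] c_ge by blast
  then show thesis
    using that[OF l_pos _ _ _] d c_ge unfolding c_def by blast
qed

text \<open>Index n stands for the (n+1)-st convolution power. The algebra has no unit in general,
  so the powers start at h; this causes the \<open>+ 1\<close> in index sums.\<close>

definition cpow :: "('a, 'b) monoid_scheme \<Rightarrow> ('a \<Rightarrow> complex) \<Rightarrow> nat \<Rightarrow> 'a \<Rightarrow> complex" where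
  "cpow G h n = ((\<lambda>f. conv G f h) ^^ n) h"

context compact_group begin

lemma cpow_0 [simp]: "cpow G h 0 = h"
  and cpow_Suc: "cpow G h (Suc n) = cpow G h n \<star> h"
  by (simp_all add: cpow_def)

lemma cpow_in: "h \<in> \<C> \<Longrightarrow> cpow G h n \<in> \<C>"
  by (induction n) (auto simp: cpow_Suc intro: cfun_conv)

lemma cpow_conv_cpow: "h \<in> \<C> \<Longrightarrow> cpow G h m \<star> cpow G h n = cpow G h (m + n + 1)"
  by (induction n) (simp_all add: cpow_Suc conv_assoc[symmetric] cpow_in)

lemma star_cpow:
  assumes "h \<in> \<C>" "star G h = h"
  shows "star G (cpow G h n) = cpow G h n"
proof (induction n)
  case (Suc n)
  then show ?case
    using assms cpow_conv_cpow[of h 0 n] by (simp add: cpow_Suc star_conv cpow_in)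
qed (use assms in simp)

text \<open>By \<open>conv_bound\<close> an L2-small error in one factor is a small error at every
  point of the convolution.\<close>

lemma conv_tendsto_right:
  assumes "\<And>n. f n \<in> \<C>" "q \<in> \<C>" "p \<in> \<C>" "(\<lambda>n. sqnorm G (\<lambda>x. f n x - q x)) \<longlonglongrightarrow> 0"
  shows "(\<lambda>n. (p \<star> f n) x) \<longlonglongrightarrow> (p \<star> q) x"
proof -
  have "(\<lambda>n. sqrt (sqnorm G p * sqnorm G (\<lambda>x. f n x - q x))) \<longlonglongrightarrow> sqrt (sqnorm G p * 0)"
    by (intro tendsto_intros assms)
  then have "(\<lambda>n. sqrt (sqnorm G p * sqnorm G (\<lambda>x. f n x - q x))) \<longlonglongrightarrow> 0" by simp
  moreover have "norm ((p \<star> f n) x - (p \<star> q) x) \<le> sqrt (sqnorm G p * sqnorm G (\<lambda>x. f n x - q x))" for n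
    using conv_bound[of p "\<lambda>x. f n x - q x" x] assms
    by (simp add: conv_diff_right cfun_diff real_le_rsqrt)
  ultimately have "(\<lambda>n. (p \<star> f n) x - (p \<star> q) x) \<longlonglongrightarrow> 0"
    by (rule Lim_null_comparison[OF always_eventually, OF allI, rotated])
  then show ?thesis by (simp add: LIM_zero_iff)
qed

lemma uniformly_Cauchy_limit:
  assumes f: "\<And>n. f n \<in> \<C>"
    and Cauchy: "\<And>e. e > 0 \<Longrightarrow> \<exists>N. \<forall>m\<ge>N. \<forall>n\<ge>N. \<forall>x. cmod (f m x - f n x) < e"
  obtains q where "q \<in> \<C>" "uniform_limit UNIV f q sequentially"
    "(\<lambda>n. sqnorm G (\<lambda>x. f n x - q x)) \<longlonglongrightarrow> 0"
proof -
  have "uniformly_Cauchy_on UNIV f"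
    using Cauchy unfolding uniformly_Cauchy_on_def dist_norm by meson
  then have "uniformly_convergent_on UNIV f"
    by (rule Cauchy_uniformly_convergent)
  then obtain q where q: "uniform_limit UNIV f q sequentially"
    by (auto simp: uniformly_convergent_on_def)
  have pointwise: "(\<lambda>n. f n x) \<longlonglongrightarrow> q x" for x
    by (rule tendsto_uniform_limitI[OF q]) simp
  have "(q \<longlongrightarrow> q x) (atin T x)" if "x \<in> topspace T" for x
  \<comment> \<open>At an isolated point the punctured filter is trivial, and the exchange of limits
    requires a nontrivial one.\<close>
  proof (cases "atin T x = bot")
    case False
    have "\<forall>\<^sub>F n in sequentially. (f n \<longlongrightarrow> f n x) (atin T x)"
      using cfunD(1)[OF f] that by (simp add: continuous_map_euclidean_iff_tendsto)
    then show ?thesis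
      by (rule swap_uniform_limit'[OF _ pointwise q]) (use False in auto)
  qed simp
  then have "ccont q" by (simp add: continuous_map_euclidean_iff_tendsto)
  moreover have "q x = 0" if "x \<notin> carrier G" for x
    using pointwise[of x] cfunD(2)[OF f that] LIMSEQ_unique[OF _ tendsto_const] by auto
  ultimately have qC: "q \<in> \<C>" by (simp add: cfun_def)
  have "(\<lambda>n. sqnorm G (\<lambda>x. f n x - q x)) \<longlonglongrightarrow> 0"
  proof (rule LIMSEQ_I)
    fix e :: real assume "e > 0"
    then have e: "sqrt (e / 2) > 0" by simp
    obtain N where N: "\<forall>n\<ge>N. \<forall>x. dist (f n x) (q x) < sqrt (e / 2)"
      using uniform_limitD[OF q e] by (auto simp: eventually_sequentially)
    have "norm (sqnorm G (\<lambda>x. f n x - q x) - 0) < e" if "n \<ge> N" for n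
    proof -
      have fq: "(\<lambda>x. f n x - q x) \<in> \<C>" by (intro cfun_diff f qC)
      have "sqnorm G (\<lambda>x. f n x - q x) \<le> (sqrt (e / 2))\<^sup>2"
        using N that by (intro sqnorm_le[OF fq]) (auto simp: dist_norm intro: less_imp_le)
      then show ?thesis using \<open>e > 0\<close> sqnorm_nonneg[OF fq] by simp
    qed
    then show "\<exists>N. \<forall>n\<ge>N. norm (sqnorm G (\<lambda>x. f n x - q x) - 0) < e" by blast
  qed
  then show thesis using that qC q by blast
qed

text \<open>The normalised powers \<open>h\<^sup>2\<^sup>n / l\<^sup>n\<close> converge to the projection onto the top eigenspace
  of convolution by \<open>h\<^sup>2\<close>. Their mutual distances are expressed through the traces
  \<open>h\<^sup>2\<^sup>n(1)\<close>, which are log-convex and submultiplicative; no compactness of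
  operators is needed.\<close>

lemma spectral_idempotent:
  assumes h: "h \<in> \<C>" and sa: "star G h = h" and nz: "h x0 \<noteq> 0"
  obtains q l where "q \<in> \<C>" "star G q = q" "q \<star> q = q" "q \<one> \<noteq> 0" "l > 0"
    "(h \<star> h) \<star> q = (\<lambda>x. complex_of_real l * q x)"
    "\<And>e. e > 0 \<Longrightarrow> \<exists>n c. \<forall>x. cmod (q x - c * cpow G h n x) < e"
proof -
  let ?P = "cpow G h"
  note PC = cpow_in[OF h]
  define t where "t n = sqnorm G (?P n)" for n
  have ip: "\<langle>?P m, ?P n\<rangle> = ?P (m + n + 1) \<one>" for m n
    by (simp only: inner_conv PC star_cpow[OF h sa] cpow_conv_cpow[OF h])
  have trace: "?P (2 * n + 1) \<one> = of_real (t n)" for n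
    using ip[of n n] inner_self[OF PC[of n]] by (simp add: t_def mult_2)
  have t_nonneg: "t n \<ge> 0" for n by (simp add: t_def sqnorm_nonneg PC)
  have t0: "t 0 > 0" using sqnorm_pos[OF h nz] by (simp add: t_def)
  \<comment> \<open>The value of h * h at 1 is the squared norm of h, so h * h is not the zero
    function.\<close>
  have "?P 1 \<one> \<noteq> 0" using trace[of 0] t0 by simp
  then have t1: "t 1 > 0" using sqnorm_pos[OF PC] by (simp add: t_def)
  \<comment> \<open>Cauchy-Schwarz for the powers with indices n and n + 2: their inner product is
    the trace that equals t (n + 1).\<close>
  have log_convex: "(t (n + 1))\<^sup>2 \<le> t n * t (n + 2)" for n
    using Cauchy_Schwarz[OF PC PC, of n "n + 2"] trace[of "n + 1"] ip[of n "n + 2"]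
    by (simp add: t_def[symmetric] mult_2)
  have submult: "t (m + n + 1) \<le> t m * t n" for m n
    using sqnorm_conv_le[OF PC PC, of m n] by (simp add: t_def cpow_conv_cpow[OF h])
  obtain l d where l: "l > 0" "d \<ge> 1" "(\<lambda>n. t n / l ^ (n + 1)) \<longlonglongrightarrow> d" "\<And>n. t n / l ^ (n + 1) \<ge> 1"
    using submultiplicative_log_convex_limit[OF t0 t1 log_convex submult] by blast
  define c where "c n = t n / l ^ (n + 1)" for n
  define a where "a n = complex_of_real (1 / l ^ (n + 1))" for n
  have a_mult: "a m * a n = a (m + n + 1)" for m n by (simp add: a_def power_add)
  have a_cnj: "cnj (a n) = a n" for n by (simp add: a_def)
  have a_Suc: "a (Suc n) = complex_of_real (1 / l) * a n" "complex_of_real l * a (Suc n) = a n" for n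
    using l(1) by (simp_all add: a_def)
  \<comment> \<open>This is the power h^(2n+2) divided by l^(n+1). Even powers are taken because
    their values at 1 are squared norms.\<close>
  define e where "e n = (\<lambda>x. a n * ?P (2 * n + 1) x)" for n
  have eC: "e n \<in> \<C>" for n unfolding e_def by (intro cfun_scale PC)
  have e_one: "e n \<one> = of_real (c n)" for n by (simp only: e_def a_def trace c_def of_real_mult[symmetric]) simp
  have e_star: "star G (e n) = e n" for n by (simp only: e_def star_scale star_cpow[OF h sa] a_cnj)
  have e_conv: "e m \<star> e n = e (m + n + 1)" for m n
  proof -
    have "e m \<star> e n = (\<lambda>x. a m * (a n * ?P (2 * m + 1 + (2 * n + 1) + 1) x))"
      by (simp only: e_def conv_scale_left conv_scale_right PC cfun_scale cpow_conv_cpow[OF h])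
    also have "2 * m + 1 + (2 * n + 1) + 1 = 2 * (m + n + 1) + 1" by simp
    finally show ?thesis by (simp only: e_def mult.assoc[symmetric] a_mult)
  qed
  have e_inner: "\<langle>e m, e n\<rangle> = of_real (c (m + n + 1))" for m n
    using inner_conv[OF eC eC, of m n] by (simp add: e_star e_conv e_one)
  have e_sqnorm: "sqnorm G (e n) = c (n + n + 1)" for n
    using inner_self[OF eC[of n]] by (simp add: e_inner)
  have e_dist: "sqnorm G (\<lambda>x. e m x - e n x) = c (m + m + 1) - 2 * c (m + n + 1) + c (n + n + 1)" for m n
    by (simp add: sqnorm_diff[OF eC eC] e_sqnorm e_inner)
  \<comment> \<open>The extra convolution with h * h is what turns the L2 estimate of
    \<open>e_dist\<close> into a uniform one below.\<close>
  have e_step: "e (Suc n) = (\<lambda>x. complex_of_real (1 / l) * (e n \<star> ?P 1) x)" for n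
  proof -
    have "e n \<star> ?P 1 = (\<lambda>x. a n * ?P (2 * n + 1 + 1 + 1) x)"
      by (simp only: e_def conv_scale_left PC cpow_conv_cpow[OF h])
    also have "2 * n + 1 + 1 + 1 = 2 * Suc n + 1" by simp
    finally show ?thesis by (simp only: e_def a_Suc(1) mult.assoc)
  qed
  have e_conv_h: "?P 1 \<star> e n = (\<lambda>x. complex_of_real l * e (Suc n) x)" for n
  proof -
    have "?P 1 \<star> e n = (\<lambda>x. a n * ?P (1 + (2 * n + 1) + 1) x)"
      by (simp only: e_def conv_scale_right PC cpow_conv_cpow[OF h])
    also have "1 + (2 * n + 1) + 1 = 2 * Suc n + 1" by simp
    finally show ?thesis by (simp only: e_def a_Suc(2) mult.assoc[symmetric])
  qed
  have "\<exists>N. \<forall>m\<ge>N. \<forall>n\<ge>N. \<forall>x. cmod (e m x - e n x) < \<epsilon>" if \<epsilon>: "\<epsilon> > 0" for \<epsilon>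
  proof -
    \<comment> \<open>If the three traces in \<open>e_dist\<close> are within \<delta> of d, the
      squared L2 distance is below 4 \<delta>; the final bound is 4 \<delta> B = \<epsilon>^2 / 2.
      The summand 1 keeps B positive.\<close>
    define B where "B = sqnorm G (?P 1) / l\<^sup>2 + 1"
    have B: "B > 0" by (simp add: B_def add_nonneg_pos sqnorm_nonneg PC)
    define \<delta> where "\<delta> = \<epsilon>\<^sup>2 / (8 * B)"
    have \<delta>: "\<delta> > 0" using B \<epsilon> by (simp add: \<delta>_def)
    obtain N where N: "\<And>n. n \<ge> N \<Longrightarrow> \<bar>c n - d\<bar> < \<delta>"
      using LIMSEQ_D[OF l(3) \<delta>] unfolding c_def by auto
    have "cmod (e m x - e n x) < \<epsilon>" if mn: "m \<ge> Suc N" "n \<ge> Suc N" for m n x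
    proof -
      obtain m' n' where mn': "m = Suc m'" "n = Suc n'" "m' \<ge> N" "n' \<ge> N"
        using mn by (metis Suc_le_D Suc_le_mono)
      let ?D = "\<lambda>x. e m' x - e n' x"
      have D: "?D \<in> \<C>" by (intro cfun_diff eC)
      have "sqnorm G ?D < 4 * \<delta>"
        using N[of "m' + m' + 1"] N[of "m' + n' + 1"] N[of "n' + n' + 1"] mn' unfolding e_dist by linarith
      have "e m x - e n x = complex_of_real (1 / l) * (?D \<star> ?P 1) x"
        by (simp add: mn' e_step conv_diff_left eC PC algebra_simps)
      then have "(cmod (e m x - e n x))\<^sup>2 = (1 / l)\<^sup>2 * (cmod ((?D \<star> ?P 1) x))\<^sup>2"
        using l(1) by (simp add: norm_mult power_mult_distrib norm_divide power_divide)
      also have "\<dots> \<le> (1 / l)\<^sup>2 * (sqnorm G ?D * sqnorm G (?P 1))"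
        by (intro mult_left_mono conv_bound D PC) auto
      also have "\<dots> = sqnorm G ?D * (sqnorm G (?P 1) / l\<^sup>2)"
        by (simp add: power_divide)
      also have "\<dots> \<le> (4 * \<delta>) * B"
        using \<open>sqnorm G ?D < 4 * \<delta>\<close> \<delta> by (intro mult_mono) (auto simp: B_def sqnorm_nonneg PC)
      also have "\<dots> < \<epsilon>\<^sup>2" using B \<epsilon> by (simp add: \<delta>_def)
      finally show ?thesis using \<epsilon> by (simp add: power_less_imp_less_base)
    qed
    then show ?thesis by blast
  qed
  then obtain q where q: "q \<in> \<C>" "uniform_limit UNIV e q sequentially"
    "(\<lambda>n. sqnorm G (\<lambda>x. e n x - q x)) \<longlonglongrightarrow> 0"
    using uniformly_Cauchy_limit[of e] eC by blast
  have pointwise: "(\<lambda>n. e n x) \<longlonglongrightarrow> q x" for x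
    by (rule tendsto_uniform_limitI[OF q(2)]) simp
  have "star G q x = q x" for x
  proof (cases "x \<in> carrier G")
    case True
    have "(\<lambda>n. cnj (e n (inv x))) \<longlonglongrightarrow> cnj (q (inv x))"
      by (intro tendsto_intros pointwise)
    moreover have "cnj (e n (inv x)) = e n x" for n
      using fun_cong[OF e_star[of n], of x] True by (simp add: star_def)
    ultimately show ?thesis using LIMSEQ_unique[OF pointwise[of x]] True by (simp add: star_def)
  qed (use q in \<open>simp add: star_def cfunD\<close>)
  then have q_star: "star G q = q" by blast
  \<comment> \<open>For fixed m the products e m * e n = e (m + n + 1) form a shifted copy of the
    sequence, so they tend to q as well as to e m * q.\<close>
  have "(e m \<star> q) x = q x" for m x
  proof (rule LIMSEQ_unique)
    show "(\<lambda>n. (e m \<star> e n) x) \<longlonglongrightarrow> (e m \<star> q) x" by (rule conv_tendsto_right[OF eC q(1) eC q(3)])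
    show "(\<lambda>n. (e m \<star> e n) x) \<longlonglongrightarrow> q x"
      using LIMSEQ_ignore_initial_segment[OF pointwise[of x], of "m + 1"] by (simp add: e_conv add_ac)
  qed
  then have eq: "e m \<star> q = q" for m by blast
  have "q \<star> e m = q" for m
    using star_conv[OF eC[of m] q(1)] by (simp add: eq q_star e_star)
  then have "(q \<star> q) x = q x" for x
    using conv_tendsto_right[OF eC q(1) q(1) q(3), of x] LIMSEQ_unique[OF _ tendsto_const] by auto
  then have q_idem: "q \<star> q = q" by blast
  have "q \<one> = of_real d"
  proof (rule LIMSEQ_unique[OF pointwise])
    show "(\<lambda>n. e n \<one>) \<longlonglongrightarrow> of_real d"
      unfolding e_one c_def by (intro tendsto_of_real l(3))
  qed
  then have q_one: "q \<one> \<noteq> 0" using l(2) by auto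
  have "(?P 1 \<star> q) x = complex_of_real l * q x" for x
  proof (rule LIMSEQ_unique)
    show "(\<lambda>n. (?P 1 \<star> e n) x) \<longlonglongrightarrow> (?P 1 \<star> q) x" by (rule conv_tendsto_right[OF eC q(1) PC q(3)])
    show "(\<lambda>n. (?P 1 \<star> e n) x) \<longlonglongrightarrow> complex_of_real l * q x"
      unfolding e_conv_h by (intro tendsto_intros LIMSEQ_Suc pointwise)
  qed
  then have eigen: "(h \<star> h) \<star> q = (\<lambda>x. complex_of_real l * q x)"
    by (simp add: cpow_Suc fun_eq_iff)
  have approx: "\<exists>n c. \<forall>x. cmod (q x - c * ?P n x) < \<epsilon>" if \<epsilon>: "\<epsilon> > 0" for \<epsilon>
  proof -
    obtain n where "\<forall>x. dist (e n x) (q x) < \<epsilon>"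
      using uniform_limitD[OF q(2) \<epsilon>] by (auto simp: eventually_sequentially)
    then have "\<forall>x. cmod (q x - a n * ?P (2 * n + 1) x) < \<epsilon>"
      unfolding e_def by (simp add: dist_commute dist_norm)
    then show ?thesis by blast
  qed
  show thesis by (rule that[OF q(1) q_star q_idem q_one l(1) eigen approx])
qed

end

section \<open>Characters of compact abelian groups\<close>

context compact_group begin

text \<open>The spectral idempotent is known only as a uniform limit of scaled convolution powers.
  This lemma and the next carry orthogonality and the identity p * f = f over from the powers to the
  limit.\<close>

lemma inner_zero_of_approx:
  assumes "q \<in> \<C>" "u \<in> \<C>" "\<And>n. f n \<in> \<C>" "\<And>n. \<langle>f n, u\<rangle> = 0"
    and approx: "\<And>e. e > 0 \<Longrightarrow> \<exists>n c. \<forall>x. cmod (q x - c * f n x) < e"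
  shows "\<langle>q, u\<rangle> = 0"
proof -
  have "cmod \<langle>q, u\<rangle> = 0"
  proof (rule eq_if_arbitrarily_close[where K = "sqrt (sqnorm G u)"])
    fix e :: real assume e: "e > 0"
    obtain n c where nc: "\<forall>x. cmod (q x - c * f n x) < e" using approx[OF e] by blast
    let ?d = "\<lambda>x. q x - c * f n x"
    have d: "?d \<in> \<C>" using assms by (intro cfun_intros)
    have "\<langle>q, u\<rangle> = \<langle>?d, u\<rangle>"
      using assms by (simp add: inner_diff_left inner_scale_left cfun_scale)
    then have "(cmod \<langle>q, u\<rangle>)\<^sup>2 \<le> sqnorm G ?d * sqnorm G u"
      using Cauchy_Schwarz[OF d assms(2)] by simp
    also have "\<dots> \<le> e\<^sup>2 * sqnorm G u"
      using nc by (intro mult_right_mono sqnorm_le[OF d] sqnorm_nonneg assms) (auto intro: less_imp_le)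
    also have "\<dots> = (sqrt (sqnorm G u) * e)\<^sup>2"
      by (simp add: power_mult_distrib sqnorm_nonneg assms)
    finally have "cmod \<langle>q, u\<rangle> \<le> sqrt (sqnorm G u) * e"
      by (rule power2_le_imp_le) (use e assms in \<open>simp add: sqnorm_nonneg\<close>)
    then show "\<bar>cmod \<langle>q, u\<rangle> - 0\<bar> \<le> sqrt (sqnorm G u) * e" by simp
  qed
  then show ?thesis by simp
qed

lemma conv_fixes_of_approx:
  assumes "q \<in> \<C>" "p \<in> \<C>" "\<And>n. f n \<in> \<C>" "\<And>n. p \<star> f n = f n"
    and approx: "\<And>e. e > 0 \<Longrightarrow> \<exists>n c. \<forall>x. cmod (q x - c * f n x) < e"
  shows "p \<star> q = q"
proof
  fix x
  have "cmod ((p \<star> q) x - q x) = 0"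
  proof (rule eq_if_arbitrarily_close[where K = "sqrt (sqnorm G p) + 1"])
    fix e :: real assume e: "e > 0"
    obtain n c where nc: "\<forall>x. cmod (q x - c * f n x) < e" using approx[OF e] by blast
    let ?d = "\<lambda>x. q x - c * f n x"
    have d: "?d \<in> \<C>" using assms by (intro cfun_intros)
    have "(cmod ((p \<star> ?d) x))\<^sup>2 \<le> sqnorm G p * sqnorm G ?d"
      by (rule conv_bound[OF assms(2) d])
    also have "\<dots> \<le> sqnorm G p * e\<^sup>2"
      using nc by (intro mult_left_mono sqnorm_le[OF d] sqnorm_nonneg assms) (auto intro: less_imp_le)
    also have "\<dots> = (sqrt (sqnorm G p) * e)\<^sup>2"
      by (simp add: power_mult_distrib sqnorm_nonneg assms)
    finally have "cmod ((p \<star> ?d) x) \<le> sqrt (sqnorm G p) * e"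
      by (rule power2_le_imp_le) (use e assms in \<open>simp add: sqnorm_nonneg\<close>)
    moreover have "(p \<star> q) x - q x = (p \<star> ?d) x - ?d x"
      using assms by (simp add: conv_diff_right conv_scale_right cfun_scale)
    then have "cmod ((p \<star> q) x - q x) \<le> cmod ((p \<star> ?d) x) + cmod (?d x)"
      by (simp only: norm_triangle_ineq4)
    ultimately show "\<bar>cmod ((p \<star> q) x - q x) - 0\<bar> \<le> (sqrt (sqnorm G p) + 1) * e"
      using nc[rule_format, of x] by (simp add: distrib_right)
  qed
  then show "(p \<star> q) x = q x" by simp
qed

text \<open>All powers of h keep the form L_x w - w, since left translation commutes with
  convolution from the right. Such functions are orthogonal to every u fixed by L_x, because <L_x w,
  u> = <L_x w, L_x u> = <w, u>.\<close>

lemma separating_idempotent: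
  assumes x: "x \<in> carrier G" "x \<noteq> \<one>"
  obtains q where "q \<in> \<C>" "star G q = q" "q \<star> q = q" "q \<one> \<noteq> 0"
    "\<And>u. u \<in> \<C> \<Longrightarrow> transl G x u = u \<Longrightarrow> \<langle>q, u\<rangle> = 0"
proof -
  have "normal_space T"
    using compact Hausdorff compact_Hausdorff_or_regular_imp_normal_space by blast
  moreover have "closedin T {\<one>}" "closedin T {x}"
    using x Hausdorff by (simp_all add: closedin_Hausdorff_singleton)
  moreover have "disjnt {\<one>} {x}" using x by simp
  ultimately obtain \<phi> :: "'a \<Rightarrow> real" where \<phi>: "cont \<phi>" "\<phi> ` {\<one>} \<subseteq> {0}" "\<phi> ` {x} \<subseteq> {1}"
    by (rule Urysohn_lemma_alt)
  define k where "k = (\<lambda>y. if y \<in> carrier G then complex_of_real (\<phi> y) else 0)"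
  have k: "k \<in> \<C>"
    unfolding k_def using \<phi>(1) by (intro cfun_restrict) (simp add: continuous_map_complex_iff)
  define g where "g = (\<lambda>y. transl G x k y - k y)"
  have g: "g \<in> \<C>" unfolding g_def using k x by (intro cfun_intros)
  have gx: "g x \<noteq> 0" using \<phi> x by (simp add: g_def k_def transl_def)
  define h where "h = g \<star> star G g"
  have h: "h \<in> \<C>" unfolding h_def using g by (intro cfun_intros)
  have h_star: "star G h = h" using g by (simp add: h_def star_conv cfun_star)
  have h_one: "h \<one> \<noteq> 0"
  proof -
    have "h \<one> = of_real (sqnorm G g)" using inner_conv[OF g g] inner_self[OF g] by (simp add: h_def)
    then show ?thesis using sqnorm_pos[OF g gx] by simp
  qed
  have "\<exists>w\<in>\<C>. cpow G h n = (\<lambda>y. transl G x w y - w y)" for n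
  proof (induction n)
    case 0
    have "h = (\<lambda>y. transl G x (k \<star> star G g) y - (k \<star> star G g) y)"
      using g k x by (simp add: h_def transl_conv conv_diff_left[symmetric] cfun_intros) (simp add: g_def)
    then show ?case using g k by (auto intro: cfun_intros)
  next
    case (Suc n)
    then obtain w where w: "w \<in> \<C>" "cpow G h n = (\<lambda>y. transl G x w y - w y)" by blast
    have "cpow G h (Suc n) = (\<lambda>y. transl G x (w \<star> h) y - (w \<star> h) y)"
      using w h x by (simp add: cpow_Suc transl_conv conv_diff_left cfun_intros)
    then show ?case using w h by (auto intro: cfun_intros)
  qed
  then obtain w where w: "\<And>n. w n \<in> \<C>" "\<And>n. cpow G h n = (\<lambda>y. transl G x (w n) y - w n y)"
    by metis
  have orth: "\<langle>cpow G h n, u\<rangle> = 0" if u: "u \<in> \<C>" "transl G x u = u" for n u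
    using inner_transl[OF w(1)[of n] u(1) x(1)] w u x
    by (simp add: inner_diff_left cfun_transl)
  obtain q l where q: "q \<in> \<C>" "star G q = q" "q \<star> q = q" "q \<one> \<noteq> 0"
    "\<And>e. e > 0 \<Longrightarrow> \<exists>n c. \<forall>x. cmod (q x - c * cpow G h n x) < e"
    using spectral_idempotent[OF h h_star h_one] by metis
  have "\<langle>q, u\<rangle> = 0" if u: "u \<in> \<C>" "transl G x u = u" for u
    by (rule inner_zero_of_approx[OF q(1) u(1) cpow_in[OF h] orth[OF u] q(5)])
  then show thesis by (rule that[OF q(1-4)])
qed

section \<open>Traces of idempotents and minimal idempotents\<close>

lemma idempotent_sqnorm:
  assumes "p \<in> \<C>" "star G p = p" "p \<star> p = p"
  shows "p \<one> = of_real (sqnorm G p)"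
  using inner_conv[of p p] inner_self[of p] assms by simp

text \<open>From p = p * p the number s = \<open>sqnorm G p\<close> satisfies s \<le> s^2. This gap
  above 0 stands in for the integrality of dimensions.\<close>

lemma idempotent_sqnorm_ge_1:
  assumes "p \<in> \<C>" "p \<star> p = p" "p y \<noteq> 0"
  shows "sqnorm G p \<ge> 1"
  using sqnorm_conv_le[of p p] sqnorm_pos[of p y] assms by simp

text \<open>Traces add under p = q + (p - q), and a nonzero part p - q contributes at least 1. So an
  idempotent whose trace is less than the infimum plus 1 has no proper part q.\<close>

lemma minimal_idempotent:
  assumes comm: "comm_group G" and p0: "p0 \<in> \<C>" "star G p0 = p0" "p0 \<star> p0 = p0" "p0 \<one> \<noteq> 0"
  obtains p where "p \<in> \<C>" "star G p = p" "p \<star> p = p" "p \<one> \<noteq> 0" "p0 \<star> p = p"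
    "\<And>q. q \<in> \<C> \<Longrightarrow> star G q = q \<Longrightarrow> q \<star> q = q \<Longrightarrow> q \<one> \<noteq> 0 \<Longrightarrow> p \<star> q = q \<Longrightarrow> q = p"
proof -
  define S where "S = {p\<in>\<C>. star G p = p \<and> p \<star> p = p \<and> p0 \<star> p = p \<and> p \<one> \<noteq> 0}"
  have "p0 \<in> S" using p0 by (simp add: S_def)
  define \<mu> where "\<mu> = Inf (sqnorm G ` S)"
  have bdd: "bdd_below (sqnorm G ` S)"
    by (rule bdd_belowI[of _ 0]) (auto simp: S_def sqnorm_nonneg)
  have mu_le: "\<mu> \<le> sqnorm G q" if "q \<in> S" for q
    unfolding \<mu>_def using that bdd by (intro cInf_lower) auto
  have "\<exists>y\<in>sqnorm G ` S. y < \<mu> + 1"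
    using \<open>p0 \<in> S\<close> cInf_lessD[of "sqnorm G ` S" "\<mu> + 1"] by (auto simp: \<mu>_def)
  then obtain p where p: "p \<in> S" "sqnorm G p < \<mu> + 1" by auto
  note p' = p(1)[unfolded S_def, simplified]
  have "q = p" if q: "q \<in> \<C>" "star G q = q" "q \<star> q = q" "q \<one> \<noteq> 0" "p \<star> q = q" for q
  proof (rule ccontr)
    assume "q \<noteq> p"
    then obtain y where y: "q y \<noteq> p y" by blast
    define r where "r = (\<lambda>x. p x - q x)"
    have r: "r \<in> \<C>" unfolding r_def using p' q by (intro cfun_intros) auto
    have r_star: "star G r = r" using p' q by (simp add: r_def star_diff)
    \<comment> \<open>Commutativity turns p * q = q into q * p = q, and both identities are needed
      for p - q to be idempotent.\<close>
    have qp: "q \<star> p = q" using conv_commute[OF comm, of q p] p' q by simp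
    have r_idem: "r \<star> r = r"
      using p' q qp by (simp add: r_def conv_diff_left conv_diff_right cfun_diff)
    have r_ge: "sqnorm G r \<ge> 1" using y by (intro idempotent_sqnorm_ge_1[OF r r_idem, of y]) (simp add: r_def)
    have "p0 \<star> q = q" using conv_assoc[of p0 p q] p0 p' q by simp
    then have "q \<in> S" using q by (simp add: S_def)
    have one: "p \<one> = of_real (sqnorm G p)" "q \<one> = of_real (sqnorm G q)" "r \<one> = of_real (sqnorm G r)"
      using p' q by (intro idempotent_sqnorm r r_star r_idem; simp)+
    have "p \<one> = q \<one> + r \<one>" by (simp add: r_def)
    then have "complex_of_real (sqnorm G p) = of_real (sqnorm G q) + of_real (sqnorm G r)"
      by (simp only: one)
    then have "sqnorm G p = sqnorm G q + sqnorm G r"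
      by (simp only: of_real_add[symmetric] of_real_eq_iff)
    then show False using mu_le[OF \<open>q \<in> S\<close>] r_ge p(2) by simp
  qed
  then show thesis using that[of p] p' by blast
qed

text \<open>The spectral idempotent of f lies below p and hence equals p, so f * f is a multiple of
  p. The same holds for f + p, and subtracting the two squares isolates 2 f.\<close>

lemma minimal_idempotent_eigen:
  assumes comm: "comm_group G"
    and p: "p \<in> \<C>" "star G p = p" "p \<star> p = p"
    and minimal: "\<And>q. q \<in> \<C> \<Longrightarrow> star G q = q \<Longrightarrow> q \<star> q = q \<Longrightarrow> q \<one> \<noteq> 0 \<Longrightarrow> p \<star> q = q \<Longrightarrow> q = p"
    and f: "f \<in> \<C>" "star G f = f" "p \<star> f = f"
  obtains c where "f = (\<lambda>x. c * p x)"
proof -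
  have square: "\<exists>c. f \<star> f = (\<lambda>x. c * p x)" if f: "f \<in> \<C>" "star G f = f" "p \<star> f = f" for f
  proof (cases "\<exists>x. f x \<noteq> 0")
    case True
    then obtain x where x: "f x \<noteq> 0" by blast
    obtain q l where q: "q \<in> \<C>" "star G q = q" "q \<star> q = q" "q \<one> \<noteq> 0"
      "(f \<star> f) \<star> q = (\<lambda>x. complex_of_real l * q x)"
      "\<And>e. e > 0 \<Longrightarrow> \<exists>n c. \<forall>x. cmod (q x - c * cpow G f n x) < e"
      using spectral_idempotent[OF f(1,2) x] by metis
    have "p \<star> cpow G f n = cpow G f n" for n
      by (induction n) (simp_all add: cpow_Suc conv_assoc[symmetric] p f cpow_in)
    then have "p \<star> q = q"
      using conv_fixes_of_approx[OF q(1) p(1) cpow_in[OF f(1)] _ q(6)] by blast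
    then have "q = p" using minimal q by blast
    moreover have "(f \<star> f) \<star> p = f \<star> f"
      using conv_commute[OF comm, of p "f \<star> f"] conv_assoc[of p f f] p f by (simp add: cfun_conv)
    ultimately show ?thesis using q(5) by auto
  next
    case False
    then have "f = (\<lambda>x. 0)" by auto
    then have "f \<star> f = (\<lambda>x. 0 * p x)" by (auto simp: conv_def haar_int_def complex_eq_iff)
    then show ?thesis by blast
  qed
  let ?g = "\<lambda>x. f x + p x"
  obtain c1 where c1: "f \<star> f = (\<lambda>x. c1 * p x)" using square[OF f] by blast
  have "?g \<in> \<C>" "star G ?g = ?g" "p \<star> ?g = ?g"
    using p f by (simp_all add: cfun_add star_add conv_add_right)
  then obtain c2 where c2: "?g \<star> ?g = (\<lambda>x. c2 * p x)" using square by blast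
  have "f \<star> p = f" using conv_commute[OF comm, of f p] p f by simp
  then have square_g: "?g \<star> ?g = (\<lambda>x. (f \<star> f) x + f x + (f x + p x))"
    using p f by (simp add: conv_add_left conv_add_right cfun_add)
  have "c2 * p x = c1 * p x + f x + (f x + p x)" for x
    using fun_cong[OF c2, of x] fun_cong[OF square_g, of x] fun_cong[OF c1, of x] by (simp only:)
  then have "2 * f x = (c2 - c1 - 1) * p x" for x
    by (simp add: algebra_simps)
  then have "f = (\<lambda>x. ((c2 - c1 - 1) / 2) * p x)"
    by (simp add: fun_eq_iff field_simps)
  then show thesis using that by blast
qed

theorem compact_abelian_character:
  assumes comm: "comm_group G" and x: "x \<in> carrier G" "x \<noteq> \<one>"
  obtains \<psi> where "ccont \<psi>" "\<And>a b. a \<in> carrier G \<Longrightarrow> b \<in> carrier G \<Longrightarrow> \<psi> (a \<otimes> b) = \<psi> a * \<psi> b"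
    "\<And>a. a \<in> carrier G \<Longrightarrow> cmod (\<psi> a) = 1" "\<psi> x \<noteq> 1"
proof -
  interpret comm_group G by (rule comm)
  obtain p0 where p0: "p0 \<in> \<C>" "star G p0 = p0" "p0 \<star> p0 = p0" "p0 \<one> \<noteq> 0"
    "\<And>u. u \<in> \<C> \<Longrightarrow> transl G x u = u \<Longrightarrow> \<langle>p0, u\<rangle> = 0"
    using separating_idempotent[OF x] by blast
  obtain p where p: "p \<in> \<C>" "star G p = p" "p \<star> p = p" "p \<one> \<noteq> 0" "p0 \<star> p = p"
    and minimal: "\<And>q. q \<in> \<C> \<Longrightarrow> star G q = q \<Longrightarrow> q \<star> q = q \<Longrightarrow> q \<one> \<noteq> 0 \<Longrightarrow> p \<star> q = q \<Longrightarrow> q = p"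
    using minimal_idempotent[OF comm p0(1-4)] by metis
  \<comment> \<open>Evaluating the intended relation L_a p = \<psi> a p at 1 forces this
    formula.\<close>
  define \<psi> where "\<psi> a = p (inv a) / p \<one>" for a
  have eigen: "transl G a p y = \<psi> a * p y" if a: "a \<in> carrier G" for a y
  proof -
    let ?v = "transl G a p"
    have v: "?v \<in> \<C>" using a p by (intro cfun_intros)
    have pv: "p \<star> ?v = ?v"
      using conv_commute[OF comm p(1) v] transl_conv[OF p(1) p(1) a] p(3) by simp
    have psv: "p \<star> star G ?v = star G ?v"
      using star_conv[OF p(1) v] conv_commute[OF comm p(1) cfun_star[OF v]] pv p(2) by simp
    \<comment> \<open>\<open>minimal_idempotent_eigen\<close> concerns self-adjoint functions, so
      the translate v is split as 2 v = f1 - \<i> f2 with f1 and f2 self-adjoint.\<close>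
    define f1 where "f1 = (\<lambda>y. ?v y + star G ?v y)"
    define f2 where "f2 = (\<lambda>y. \<i> * (?v y - star G ?v y))"
    have f1: "f1 \<in> \<C>" "star G f1 = f1" "p \<star> f1 = f1"
      using v pv psv p by (simp_all add: f1_def cfun_intros star_add conv_add_right add.commute)
    have f2: "f2 \<in> \<C>" "star G f2 = f2" "p \<star> f2 = f2"
      unfolding f2_def using v pv psv p
      by (simp_all add: cfun_intros star_scale star_diff conv_scale_right conv_diff_right algebra_simps)
    obtain c1 where c1: "f1 = (\<lambda>y. c1 * p y)" by (rule minimal_idempotent_eigen[OF comm p(1-3) minimal f1])
    obtain c2 where c2: "f2 = (\<lambda>y. c2 * p y)" by (rule minimal_idempotent_eigen[OF comm p(1-3) minimal f2])
    have "2 * ?v y = f1 y - \<i> * f2 y" for y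
      by (simp add: f1_def f2_def algebra_simps)
    then have v_eq: "?v y = ((c1 - \<i> * c2) / 2) * p y" for y
      by (simp add: c1 c2 field_simps)
    have "p (inv a) = ((c1 - \<i> * c2) / 2) * p \<one>"
      using v_eq[of \<one>] a by (simp add: transl_def)
    then have "\<psi> a = (c1 - \<i> * c2) / 2" using p(4) by (simp add: \<psi>_def)
    then show ?thesis by (simp only: v_eq)
  qed
  show thesis
  proof (rule that[of \<psi>])
    have "ccont (\<lambda>a. p (inv a) * (1 / p \<one>))"
      by (rule continuous_map_complex_mult[OF ccont_inv[OF cfunD(1)[OF p(1)]]]) simp
    then show "ccont \<psi>" by (simp add: \<psi>_def[abs_def])
    show "\<psi> (a \<otimes> b) = \<psi> a * \<psi> b" if ab: "a \<in> carrier G" "b \<in> carrier G" for a b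
    proof -
      have "p (inv (a \<otimes> b)) = transl G b p (inv a)"
        using ab by (simp add: transl_def inv_mult_group)
      also have "\<dots> = \<psi> b * p (inv a)" by (rule eigen[OF ab(2)])
      finally show ?thesis by (simp add: \<psi>_def)
    qed
    show "cmod (\<psi> a) = 1" if a: "a \<in> carrier G" for a
    proof -
      have "transl G a p = (\<lambda>y. \<psi> a * p y)" using eigen[OF a] by blast
      then have "sqnorm G p = (cmod (\<psi> a))\<^sup>2 * sqnorm G p"
        using sqnorm_transl[OF p(1) a] sqnorm_scale[OF p(1), of "\<psi> a"] by simp
      then show ?thesis using sqnorm_pos[OF p(1,4)] norm_ge_zero[of "\<psi> a"] by (auto simp: power2_eq_1_iff)
    qed
    \<comment> \<open>Otherwise p would be fixed by L_x and therefore orthogonal to p0, whereas <p0,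
      p> = (p0 * p) 1 = p 1.\<close>
    show "\<psi> x \<noteq> 1"
    proof
      assume "\<psi> x = 1"
      then have "transl G x p = p" using eigen[OF x(1)] by auto
      then have "\<langle>p0, p\<rangle> = 0" using p0(5) p(1) by blast
      then show False using inner_conv[OF p0(1) p(1)] p by simp
    qed
  qed
qed

end

section \<open>Representations of compact groups\<close>

lemma continuous_map_GL_topology:
  assumes "\<And>x. x \<in> topspace T \<Longrightarrow> \<rho> x \<in> carrier (GL n)"
    and "\<And>i j. i < n \<Longrightarrow> j < n \<Longrightarrow> continuous_map T euclidean (\<lambda>x. \<rho> x $$ (i, j))"
  shows "continuous_map T (GL_topology n) \<rho>"
  unfolding GL_topology_def
  by (intro continuous_map_pullback')
     (use assms in \<open>auto simp: continuous_map_componentwise o_def extensional_def restrict_def\<close>)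

text \<open>Invertibility of \<rho> g is supplied by \<rho> at the inverse of g, so it does not
  appear among the conditions.\<close>

lemma (in top_group) ordinary_repI:
  assumes "n > 0"
    and carrier: "\<And>g. g \<in> carrier G \<Longrightarrow> \<rho> g \<in> carrier_mat n n"
    and mult: "\<And>g h. g \<in> carrier G \<Longrightarrow> h \<in> carrier G \<Longrightarrow> \<rho> (g \<otimes> h) = \<rho> g * \<rho> h"
    and one: "\<rho> \<one> = 1\<^sub>m n"
    and cont: "\<And>i j. i < n \<Longrightarrow> j < n \<Longrightarrow> continuous_map T euclidean (\<lambda>x. \<rho> x $$ (i, j))"
  shows "ordinary_rep G T n \<rho>"
proof -
  have GL: "\<rho> g \<in> carrier (GL n)" if g: "g \<in> carrier G" for g
  proof -
    have "\<rho> (inv g) * \<rho> g = 1\<^sub>m n" "\<rho> g * \<rho> (inv g) = 1\<^sub>m n"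
      using g mult[of "inv g" g] mult[of g "inv g"] one by auto
    then show ?thesis
      using carrier[OF g] carrier[OF inv_closed[OF g]]
      by (auto simp: GL_def units_of_def Units_def ring_mat_simps)
  qed
  then show ?thesis
    unfolding ordinary_rep_def using assms
    by (auto intro!: homI continuous_map_GL_topology simp: GL_def units_of_mult ring_mat_simps)
qed

section \<open>The finite-dimensional space cut out by an idempotent\<close>

context compact_group begin

lemma inner_sum_left:
  assumes "\<And>i. i \<in> I \<Longrightarrow> f i \<in> \<C>" "h \<in> \<C>"
  shows "\<langle>\<lambda>x. \<Sum>i\<in>I. f i x, h\<rangle> = (\<Sum>i\<in>I. \<langle>f i, h\<rangle>)"
  using assms(1)
proof (induction I rule: infinite_finite_induct)
  case (insert i I)
  then show ?case
    using inner_add_left[of "f i" "\<lambda>x. \<Sum>i\<in>I. f i x" h] assms(2) cfun_sum[of I f] by simp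
qed (simp_all add: inner_prod_def haar_int_def complex_eq_iff)

lemma inner_sum_right:
  assumes "\<And>i. i \<in> I \<Longrightarrow> f i \<in> \<C>" "h \<in> \<C>"
  shows "\<langle>h, \<lambda>x. \<Sum>i\<in>I. f i x\<rangle> = (\<Sum>i\<in>I. \<langle>h, f i\<rangle>)"
proof -
  have "\<langle>h, \<lambda>x. \<Sum>i\<in>I. f i x\<rangle> = cnj (\<Sum>i\<in>I. \<langle>f i, h\<rangle>)"
    using assms by (simp add: inner_cnj[of "\<lambda>x. \<Sum>i\<in>I. f i x" h] inner_sum_left cfun_sum)
  also have "\<dots> = (\<Sum>i\<in>I. \<langle>h, f i\<rangle>)"
    unfolding cnj_sum by (intro sum.cong refl inner_cnj[symmetric] assms)
  finally show ?thesis .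
qed

definition orthonormal :: "nat \<Rightarrow> (nat \<Rightarrow> 'a \<Rightarrow> complex) \<Rightarrow> bool" where
  "orthonormal n u \<longleftrightarrow> (\<forall>i<n. u i \<in> \<C>) \<and> (\<forall>i<n. \<forall>j<n. \<langle>u i, u j\<rangle> = (if i = j then 1 else 0))"

definition projection :: "nat \<Rightarrow> (nat \<Rightarrow> 'a \<Rightarrow> complex) \<Rightarrow> ('a \<Rightarrow> complex) \<Rightarrow> 'a \<Rightarrow> complex" where
  "projection n u v = (\<lambda>x. \<Sum>i<n. \<langle>v, u i\<rangle> * u i x)"

lemma projection_in: "orthonormal n u \<Longrightarrow> projection n u v \<in> \<C>"
  unfolding projection_def by (intro cfun_sum cfun_scale) (auto simp: orthonormal_def)

lemma inner_projection:
  assumes u: "orthonormal n u" and j: "j < n"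
  shows "\<langle>projection n u v, u j\<rangle> = \<langle>v, u j\<rangle>"
proof -
  have "\<langle>projection n u v, u j\<rangle> = (\<Sum>i<n. \<langle>v, u i\<rangle> * \<langle>u i, u j\<rangle>)"
    unfolding projection_def using u j
    by (subst inner_sum_left) (auto simp: orthonormal_def inner_scale_left cfun_scale)
  also have "\<dots> = (\<Sum>i<n. if i = j then \<langle>v, u i\<rangle> else 0)"
    using u j by (intro sum.cong) (auto simp: orthonormal_def)
  finally show ?thesis using j by simp
qed

lemma Bessel_inequality:
  assumes u: "orthonormal n u" and v: "v \<in> \<C>"
  shows "(\<Sum>i<n. (cmod \<langle>v, u i\<rangle>)\<^sup>2) \<le> sqnorm G v"
proof -
  let ?s = "projection n u v"
  have s: "?s \<in> \<C>" by (rule projection_in[OF u])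
  have "\<langle>w, ?s\<rangle> = (\<Sum>i<n. cnj \<langle>v, u i\<rangle> * \<langle>w, u i\<rangle>)" if w: "w \<in> \<C>" for w
    unfolding projection_def using u w
    by (subst inner_sum_right) (auto simp: orthonormal_def inner_scale_right cfun_scale)
  moreover have "(\<Sum>i<n. cnj \<langle>v, u i\<rangle> * \<langle>v, u i\<rangle>) = of_real (\<Sum>i<n. (cmod \<langle>v, u i\<rangle>)\<^sup>2)"
    unfolding of_real_sum by (intro sum.cong refl) (simp add: complex_norm_square mult.commute del: of_real_power)
  ultimately have vs: "\<langle>v, ?s\<rangle> = of_real (\<Sum>i<n. (cmod \<langle>v, u i\<rangle>)\<^sup>2)"
    and ss: "\<langle>?s, ?s\<rangle> = of_real (\<Sum>i<n. (cmod \<langle>v, u i\<rangle>)\<^sup>2)"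
    using v s inner_projection[OF u] by simp_all
  have "sqnorm G ?s = (\<Sum>i<n. (cmod \<langle>v, u i\<rangle>)\<^sup>2)"
    using ss inner_self[OF s] by (simp only: of_real_eq_iff)
  moreover have "0 \<le> sqnorm G (\<lambda>x. v x - ?s x)"
    by (intro sqnorm_nonneg cfun_diff v s)
  ultimately show ?thesis
    unfolding sqnorm_diff[OF v s] vs by simp
qed

text \<open>Since u i = u i * q, the value u i y is, up to conjugation, the coefficient of L_y q
  along u i. Bessel bounds the sum of their squares by \<open>sqnorm G q\<close> at every y, and
  integrating over y counts the n functions.\<close>

lemma orthonormal_bound:
  assumes q: "q \<in> \<C>" "star G q = q" and u: "orthonormal n u" and uq: "\<And>i. i < n \<Longrightarrow> u i \<star> q = u i"
  shows "real n \<le> sqnorm G q"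
proof -
  have uC: "u i \<in> \<C>" if "i < n" for i using u that by (simp add: orthonormal_def)
  have pointwise: "(\<Sum>i<n. (cmod (u i y))\<^sup>2) \<le> sqnorm G q" if y: "y \<in> carrier G" for y
  proof -
    have yq: "transl G y q \<in> \<C>" using q y by (intro cfun_transl)
    have "cmod (u i y) = cmod \<langle>transl G y q, u i\<rangle>" if i: "i < n" for i
      using conv_eq_inner[OF uC[OF i] q(1) y] inner_cnj[OF uC[OF i] yq] uq[OF i] q(2) by simp
    then have "(\<Sum>i<n. (cmod (u i y))\<^sup>2) = (\<Sum>i<n. (cmod \<langle>transl G y q, u i\<rangle>)\<^sup>2)" by simp
    also have "\<dots> \<le> sqnorm G (transl G y q)" by (rule Bessel_inequality[OF u yq])
    finally show ?thesis using sqnorm_transl[OF q(1) y] by simp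
  qed
  have mean_sum: "cont (\<lambda>y. \<Sum>i<k. (cmod (u i y))\<^sup>2) \<and>
      haar_mean G (\<lambda>y. \<Sum>i<k. (cmod (u i y))\<^sup>2) = (\<Sum>i<k. sqnorm G (u i))" if "k \<le> n" for k
    using that
  proof (induction k)
    case (Suc k)
    then show ?case
      using haar_mean_add[of "\<lambda>y. \<Sum>i<k. (cmod (u i y))\<^sup>2" "\<lambda>y. (cmod (u k y))\<^sup>2"] cont_norm[OF uC[of k]]
      by (auto simp: sqnorm_def intro: continuous_map_add)
  qed simp
  have "sqnorm G (u i) = 1" if i: "i < n" for i
  proof -
    have "complex_of_real (sqnorm G (u i)) = of_real 1"
      using inner_self[OF uC[OF i]] u i by (simp add: orthonormal_def)
    then show ?thesis by (simp only: of_real_eq_iff)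
  qed
  then have "real n = haar_mean G (\<lambda>y. \<Sum>i<n. (cmod (u i y))\<^sup>2)"
    using mean_sum[of n] by simp
  also have "\<dots> \<le> haar_mean G (\<lambda>y. sqnorm G q)"
    using mean_sum[of n] pointwise by (intro haar_mean_mono) auto
  finally show ?thesis by simp
qed

text \<open>The bound above gives a longest orthonormal system in the space. If some v differed from
  its projection, the normalised remainder would lengthen the system.\<close>

lemma orthonormal_basis:
  assumes q: "q \<in> \<C>" "star G q = q"
  obtains n u where "orthonormal n u" "\<And>i. i < n \<Longrightarrow> u i \<star> q = u i"
    "\<And>v. v \<in> \<C> \<Longrightarrow> v \<star> q = v \<Longrightarrow> v = projection n u v"
proof -
  define P where "P n \<longleftrightarrow> (\<exists>u. orthonormal n u \<and> (\<forall>i<n. u i \<star> q = u i))" for n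
  have "P 0" by (simp add: P_def orthonormal_def)
  have bound: "n \<le> nat \<lfloor>sqnorm G q\<rfloor>" if "P n" for n
    using that orthonormal_bound[OF q] by (auto simp: P_def le_nat_floor)
  define n where "n = (GREATEST n. P n)"
  have "P n" unfolding n_def using \<open>P 0\<close> bound by (rule GreatestI_nat)
  have not_P: "\<not> P (Suc n)"
    using Greatest_le_nat[of P "Suc n", OF _ bound] by (auto simp: n_def)
  obtain u where u: "orthonormal n u" "\<And>i. i < n \<Longrightarrow> u i \<star> q = u i"
    using \<open>P n\<close> by (auto simp: P_def)
  have uC: "u i \<in> \<C>" if "i < n" for i using u(1) that by (simp add: orthonormal_def)
  have proj_q: "projection n u v \<star> q = projection n u v" for v
  proof -
    have "(\<lambda>x. \<Sum>i<k. \<langle>v, u i\<rangle> * u i x) \<star> q = (\<lambda>x. \<Sum>i<k. \<langle>v, u i\<rangle> * u i x)" if "k \<le> n" for k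
      using that
    proof (induction k)
      case 0
      then show ?case by (auto simp: conv_def haar_int_def complex_eq_iff)
    next
      case (Suc k)
      have "(\<lambda>x. \<Sum>i<k. \<langle>v, u i\<rangle> * u i x) \<in> \<C>" "(\<lambda>x. \<langle>v, u k\<rangle> * u k x) \<in> \<C>"
        using Suc.prems uC by (auto intro!: cfun_sum cfun_scale)
      then show ?case
        using Suc uC[of k] u(2)[of k] q by (simp add: conv_add_left conv_scale_left)
    qed
    then show ?thesis by (simp add: projection_def)
  qed
  have "v = projection n u v" if v: "v \<in> \<C>" "v \<star> q = v" for v
  proof (rule ccontr)
    assume "v \<noteq> projection n u v"
    then obtain y where y: "v y \<noteq> projection n u v y" by blast
    define r where "r = (\<lambda>x. v x - projection n u v x)"
    have r: "r \<in> \<C>" unfolding r_def by (intro cfun_diff v projection_in u)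
    have r_q: "r \<star> q = r"
      unfolding r_def using v q u(1) by (simp add: conv_diff_left projection_in proj_q)
    have r_u: "\<langle>r, u i\<rangle> = 0" if "i < n" for i
      unfolding r_def using that v u(1) uC by (simp add: inner_diff_left projection_in inner_projection)
    have pos: "sqnorm G r > 0" using y by (intro sqnorm_pos[OF r, of y]) (simp add: r_def)
    define w where "w = (\<lambda>x. complex_of_real (1 / sqrt (sqnorm G r)) * r x)"
    have w: "w \<in> \<C>" unfolding w_def by (intro cfun_scale r)
    have "sqnorm G w = 1"
      unfolding w_def sqnorm_scale[OF r] using pos by (simp add: norm_divide power_divide)
    then have ww: "\<langle>w, w\<rangle> = 1" using inner_self[OF w] by simp
    have wu: "\<langle>w, u i\<rangle> = 0" if "i < n" for i
      unfolding w_def inner_scale_left[OF r uC[OF that]] using r_u[OF that] by simp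
    then have uw: "\<langle>u i, w\<rangle> = 0" if "i < n" for i
      using inner_cnj[OF w uC[OF that]] that by simp
    have "orthonormal (Suc n) (u(n := w))"
      using u(1) w ww wu uw by (auto simp: orthonormal_def less_Suc_eq)
    moreover have "w \<star> q = w" unfolding w_def conv_scale_left[OF r q(1)] r_q ..
    ultimately have "P (Suc n)" using u(2) by (auto simp: P_def less_Suc_eq intro!: exI[of _ "u(n := w)"])
    then show False using not_P by blast
  qed
  then show thesis using that[OF u] by blast
qed

lemma transl_sum: "transl G g (\<lambda>x. \<Sum>i\<in>I. c i * u i x) = (\<lambda>x. \<Sum>i\<in>I. c i * transl G g (u i) x)"
  by (auto simp: transl_def fun_eq_iff)

text \<open>The idempotent q belongs to the space on which G acts. Hence the dimension is positive,
  and if x acted trivially, q would be fixed by L_x and so orthogonal to itself.\<close>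

theorem compact_separating_rep:
  assumes x: "x \<in> carrier G" "x \<noteq> \<one>"
  obtains n \<rho> where "ordinary_rep G T n \<rho>" "\<rho> x \<noteq> 1\<^sub>m n"
proof -
  obtain q where q: "q \<in> \<C>" "star G q = q" "q \<star> q = q" "q \<one> \<noteq> 0"
    "\<And>u. u \<in> \<C> \<Longrightarrow> transl G x u = u \<Longrightarrow> \<langle>q, u\<rangle> = 0"
    using separating_idempotent[OF x] by blast
  obtain n u where u: "orthonormal n u" "\<And>i. i < n \<Longrightarrow> u i \<star> q = u i"
    and basis: "\<And>v. v \<in> \<C> \<Longrightarrow> v \<star> q = v \<Longrightarrow> v = projection n u v"
    using orthonormal_basis[OF q(1,2)] by metis
  have uC: "u i \<in> \<C>" if "i < n" for i using u(1) that by (simp add: orthonormal_def)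
  \<comment> \<open>Translates stay in the space because L_g (u * q) = (L_g u) * q.\<close>
  have expand: "transl G g (u j) = (\<lambda>x. \<Sum>k<n. \<langle>transl G g (u j), u k\<rangle> * u k x)"
    if "g \<in> carrier G" "j < n" for g j
    using basis[of "transl G g (u j)"] that uC q u(2)
    by (simp add: cfun_transl transl_conv[symmetric] projection_def)
  define \<rho> where "\<rho> g = mat n n (\<lambda>(i, j). \<langle>transl G g (u j), u i\<rangle>)" for g
  have "ordinary_rep G T n \<rho>"
  proof (rule ordinary_repI)
    show "n > 0"
    proof (rule ccontr)
      assume "\<not> n > 0"
      then have "q = (\<lambda>x. 0)" using basis[OF q(1,3)] by (simp add: projection_def)
      then show False using q(4) by simp
    qed
    show "\<rho> g \<in> carrier_mat n n" for g by (simp add: \<rho>_def)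
    show "\<rho> \<one> = 1\<^sub>m n"
      using u(1) by (intro eq_matI) (auto simp: \<rho>_def transl_one orthonormal_def)
    show "\<rho> (g \<otimes> h) = \<rho> g * \<rho> h" if g: "g \<in> carrier G" and h: "h \<in> carrier G" for g h
    proof (rule eq_matI)
      fix i j assume "i < dim_row (\<rho> g * \<rho> h)" "j < dim_col (\<rho> g * \<rho> h)"
      then have ij: "i < n" "j < n" by (auto simp: \<rho>_def)
      have "\<langle>transl G (g \<otimes> h) (u j), u i\<rangle> = \<langle>transl G g (transl G h (u j)), u i\<rangle>"
        using g h by (simp add: transl_transl)
      also have "transl G g (transl G h (u j)) = (\<lambda>x. \<Sum>k<n. \<langle>transl G h (u j), u k\<rangle> * transl G g (u k) x)"
        by (subst expand[OF h ij(2)]) (rule transl_sum)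
      also have "\<langle>\<dots>, u i\<rangle> = (\<Sum>k<n. \<langle>transl G h (u j), u k\<rangle> * \<langle>transl G g (u k), u i\<rangle>)"
        using g uC ij by (subst inner_sum_left) (auto simp: inner_scale_left cfun_scale cfun_transl)
      finally show "\<rho> (g \<otimes> h) $$ (i, j) = (\<rho> g * \<rho> h) $$ (i, j)"
        using ij by (simp add: \<rho>_def scalar_prod_def atLeast0LessThan mult.commute)
    qed (auto simp: \<rho>_def)
    show "continuous_map T euclidean (\<lambda>g. \<rho> g $$ (i, j))" if ij: "i < n" "j < n" for i j
    proof -
      \<comment> \<open>By \<open>conv_eq_inner\<close> the entry at (i, j) is the conjugate of the
        convolution of u i with the star of u j.\<close>
      have "ccont (\<lambda>g. cnj ((u i \<star> star G (u j)) g))"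
        using ij uC by (intro continuous_map_cnj cfunD cfun_intros) auto
      then show ?thesis
      proof (rule continuous_map_eq)
        fix g assume "g \<in> topspace T"
        then have g: "g \<in> carrier G" by simp
        show "cnj ((u i \<star> star G (u j)) g) = \<rho> g $$ (i, j)"
          using g ij uC conv_eq_inner[OF uC[OF ij(1)] cfun_star[OF uC[OF ij(2)]] g]
            inner_cnj[OF uC[OF ij(1)] cfun_transl[OF uC[OF ij(2)] g]]
          by (simp add: \<rho>_def)
      qed
    qed
  qed
  moreover have "\<rho> x \<noteq> 1\<^sub>m n"
  proof
    assume *: "\<rho> x = 1\<^sub>m n"
    have "transl G x (u j) = u j" if j: "j < n" for j
    proof -
      have "\<langle>transl G x (u j), u k\<rangle> = (if k = j then 1 else 0)" if k: "k < n" for k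
        using arg_cong[OF *, of "\<lambda>A. A $$ (k, j)"] j k by (simp add: \<rho>_def)
      then have "(\<Sum>k<n. \<langle>transl G x (u j), u k\<rangle> * u k y) = (\<Sum>k<n. if k = j then u k y else 0)" for y
        by (intro sum.cong) auto
      then show ?thesis using j by (subst expand[OF x(1) j]) simp
    qed
    then have "transl G x (projection n u q) = projection n u q"
      unfolding projection_def transl_sum by auto
    then have "\<langle>q, q\<rangle> = 0" using q(5)[OF q(1)] basis[OF q(1,3)] by simp
    then show False using inner_conv[OF q(1,1)] q by simp
  qed
  ultimately show thesis using that by blast
qed

end

section \<open>Extension of homomorphisms\<close>

text \<open>Subgroups that meet S at most in 1 are closed under unions of nonempty chains, so Zorn's
  lemma applies.\<close>

lemma (in group) maximal_subgroup_avoiding: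
  assumes R: "subgroup R G" "R \<inter> S \<subseteq> {\<one>}"
  obtains D where "subgroup D G" "R \<subseteq> D" "D \<inter> S \<subseteq> {\<one>}"
    "\<forall>D'. subgroup D' G \<and> D \<subseteq> D' \<and> D' \<inter> S \<subseteq> {\<one>} \<longrightarrow> D' = D"
proof -
  let ?A = "{D. subgroup D G \<and> R \<subseteq> D \<and> D \<inter> S \<subseteq> {\<one>}}"
  have "\<exists>M\<in>?A. \<forall>X\<in>?A. M \<subseteq> X \<longrightarrow> X = M"
  proof (rule subset_Zorn_nonempty)
    show "?A \<noteq> {}" using R by blast
    fix \<C> assume ne: "\<C> \<noteq> {}" and chain: "subset.chain ?A \<C>"
    then have sub: "\<And>D. D \<in> \<C> \<Longrightarrow> subgroup D G \<and> R \<subseteq> D \<and> D \<inter> S \<subseteq> {\<one>}"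
      and cmp: "\<And>D E. D \<in> \<C> \<Longrightarrow> E \<in> \<C> \<Longrightarrow> D \<subseteq> E \<or> E \<subseteq> D"
      by (auto simp: subset_chain_def)
    have "subgroup (\<Union>\<C>) G"
    proof (rule subgroupI)
      show "\<Union>\<C> \<subseteq> carrier G" using sub subgroup.subset by blast
      obtain D where "D \<in> \<C>" using ne by blast
      then show "\<Union>\<C> \<noteq> {}" using sub subgroup.one_closed by blast
      show "inv a \<in> \<Union>\<C>" if "a \<in> \<Union>\<C>" for a
      proof -
        obtain D where "D \<in> \<C>" "a \<in> D" using \<open>a \<in> \<Union>\<C>\<close> by blast
        then show ?thesis using sub subgroup.m_inv_closed[of D G a] by blast
      qed
      show "a \<otimes> b \<in> \<Union>\<C>" if ab: "a \<in> \<Union>\<C>" "b \<in> \<Union>\<C>" for a b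
      proof -
        obtain D E where DE: "D \<in> \<C>" "E \<in> \<C>" "a \<in> D" "b \<in> E" using ab by blast
        then obtain F where "F \<in> \<C>" "a \<in> F" "b \<in> F" using cmp[OF DE(1,2)] by blast
        then show ?thesis using sub subgroup.m_closed[of F G a b] by blast
      qed
    qed
    then show "\<Union>\<C> \<in> ?A" using ne sub by blast
  qed
  then obtain D where D: "D \<in> ?A" and max: "\<forall>X\<in>?A. D \<subseteq> X \<longrightarrow> X = D" by (rule bexE)
  have "D' = D" if "subgroup D' G" "D \<subseteq> D'" "D' \<inter> S \<subseteq> {\<one>}" for D'
  proof -
    have "D' \<in> ?A" using that D by auto
    then show ?thesis using max that(2) by blast
  qed
  then show thesis using that[of D] D by simp
qed

lemma (in comm_group) subgroup_adjoin:
  assumes D: "subgroup D G" and y: "y \<in> carrier G"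
  shows "subgroup {d \<otimes> y [^] (k::int) |d k. d \<in> D} G"
proof -
  interpret D: subgroup D G by (rule D)
  define D' where "D' = {d \<otimes> y [^] (k::int) |d k. d \<in> D}"
  have "subgroup D' G"
  proof (rule subgroupI)
    show "D' \<subseteq> carrier G" using y D.subset by (auto simp: D'_def)
    show "D' \<noteq> {}" unfolding D'_def using D.one_closed by blast
    show "inv a \<in> D'" if "a \<in> D'" for a
    proof -
      obtain d and k :: int where dk: "a = d \<otimes> y [^] k" "d \<in> D" using \<open>a \<in> D'\<close> by (auto simp: D'_def)
      then have "inv a = inv d \<otimes> y [^] (- k)"
        using y by (simp add: inv_mult int_pow_neg)
      then show ?thesis using dk unfolding D'_def by blast
    qed
    show "a \<otimes> b \<in> D'" if ab: "a \<in> D'" "b \<in> D'" for a b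
    proof -
      obtain d and k :: int where dk: "a = d \<otimes> y [^] k" "d \<in> D" using ab by (auto simp: D'_def)
      obtain e and l :: int where el: "b = e \<otimes> y [^] l" "e \<in> D" using ab by (auto simp: D'_def)
      have "a \<otimes> b = (d \<otimes> e) \<otimes> y [^] (k + l)"
        using dk el y by (simp add: int_pow_mult m_ac)
      then show ?thesis using dk el unfolding D'_def by blast
    qed
  qed
  then show ?thesis by (simp only: D'_def)
qed

text \<open>Adjoining y enlarges D, so the larger subgroup must meet S outside 1. This form of
  maximality serves twice: for graphs in a product and for subgroups avoiding a compact set.\<close>

lemma (in comm_group) maximal_subgroup_avoiding_power:
  assumes R: "subgroup R G" "R \<inter> S \<subseteq> {\<one>}"
  obtains D where "subgroup D G" "R \<subseteq> D" "D \<inter> S \<subseteq> {\<one>}"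
    "\<forall>y\<in>carrier G - D. \<exists>d\<in>D. \<exists>k::int. d \<otimes> y [^] k \<in> S - {\<one>}"
proof -
  obtain D where D: "subgroup D G" "R \<subseteq> D" "D \<inter> S \<subseteq> {\<one>}"
    and max: "\<forall>D'. subgroup D' G \<and> D \<subseteq> D' \<and> D' \<inter> S \<subseteq> {\<one>} \<longrightarrow> D' = D"
    by (rule maximal_subgroup_avoiding[OF R])
  interpret D: subgroup D G by (rule D(1))
  have power: "\<exists>d\<in>D. \<exists>k::int. d \<otimes> y [^] k \<in> S - {\<one>}" if y: "y \<in> carrier G" "y \<notin> D" for y
  proof -
    define D' where "D' = {d \<otimes> y [^] (k::int) |d k. d \<in> D}"
    have "subgroup D' G"
      unfolding D'_def by (rule subgroup_adjoin[OF D(1) y(1)])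
    moreover have "D \<subseteq> D'"
    proof
      fix d assume "d \<in> D"
      then have "d = d \<otimes> y [^] (0::int)" by simp
      then show "d \<in> D'" using \<open>d \<in> D\<close> unfolding D'_def by blast
    qed
    moreover have "y \<in> D'"
    proof -
      have "y = \<one> \<otimes> y [^] (1::int)" using y by simp
      then show ?thesis unfolding D'_def using D.one_closed by blast
    qed
    ultimately have "\<not> D' \<inter> S \<subseteq> {\<one>}" using max y(2) by blast
    then show ?thesis by (auto simp: D'_def)
  qed
  show thesis by (rule that[OF D]) (use power in simp)
qed

lemma int_pow_DirProd:
  assumes "group G" "group H" "x \<in> carrier G" "y \<in> carrier H"
  shows "(x, y) [^]\<^bsub>G \<times>\<times> H\<^esub> (k :: int) = (x [^]\<^bsub>G\<^esub> k, y [^]\<^bsub>H\<^esub> k)"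
proof -
  interpret G: group G by fact
  interpret H: group H by fact
  interpret P: group "G \<times>\<times> H" by (rule DirProd_group[OF assms(1,2)])
  have nat_pow: "(x, y) [^]\<^bsub>G \<times>\<times> H\<^esub> n = (x [^]\<^bsub>G\<^esub> n, y [^]\<^bsub>H\<^esub> n)" for n :: nat
    by (induction n) auto
  show ?thesis
    unfolding int_pow_def2 nat_pow
    using inv_DirProd[OF assms(1,2) G.nat_pow_closed H.nat_pow_closed] assms(3,4) by simp
qed

text \<open>Baer's argument: apply the maximality lemma to graphs of partial homomorphisms,
  i.e. subgroups of \<open>G \<times> A\<close> meeting \<open>1 \<times> A\<close> trivially.\<close>

lemma (in comm_group) extend_hom_to_divisible:
  assumes A: "comm_group A"
    and divisible: "\<And>v m. v \<in> carrier A \<Longrightarrow> m > 0 \<Longrightarrow> \<exists>w\<in>carrier A. w [^]\<^bsub>A\<^esub> (m :: nat) = v"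
    and H: "subgroup H G" and \<psi>: "\<psi> \<in> hom (G\<lparr>carrier := H\<rparr>) A"
  obtains \<phi> where "\<phi> \<in> hom G A" "\<And>h. h \<in> H \<Longrightarrow> \<phi> h = \<psi> h"
proof -
  interpret A: comm_group A by (rule A)
  interpret H: subgroup H G by (rule H)
  let ?P = "G \<times>\<times> A"
  interpret P: group ?P by (rule DirProd_group[OF group_axioms A.group_axioms])
  interpret P: comm_group ?P
    by (rule P.group_comm_groupI) (auto simp: m_comm A.m_comm)
  have \<psi>_in: "\<psi> h \<in> carrier A" if "h \<in> H" for h using \<psi> that by (auto simp: hom_def)
  have \<psi>_mult: "\<psi> (h \<otimes> h') = \<psi> h \<otimes>\<^bsub>A\<^esub> \<psi> h'" if "h \<in> H" "h' \<in> H" for h h'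
    using \<psi> that by (auto simp: hom_def)
  have \<psi>_one: "\<psi> \<one> = \<one>\<^bsub>A\<^esub>"
    using \<psi>_mult[of \<one> \<one>] \<psi>_in[of \<one>] by (simp add: A.l_cancel_one')
  have \<psi>_inv: "\<psi> (inv h) = inv\<^bsub>A\<^esub> \<psi> h" if "h \<in> H" for h
    using \<psi>_mult[of "inv h" h] \<psi>_in \<psi>_one that H.subset by (intro A.inv_equality[symmetric]) auto
  define R where "R = (\<lambda>h. (h, \<psi> h)) ` H"
  have "subgroup R ?P"
  proof (rule P.subgroupI)
    show "R \<subseteq> carrier ?P" using \<psi>_in H.subset by (auto simp: R_def)
    show "R \<noteq> {}" unfolding R_def using H.one_closed by blast
    show "inv\<^bsub>?P\<^esub> a \<in> R" if "a \<in> R" for a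
    proof -
      obtain h where h: "h \<in> H" "a = (h, \<psi> h)" using \<open>a \<in> R\<close> by (auto simp: R_def)
      have "h \<in> carrier G" using h H.subset by blast
      then have "inv\<^bsub>?P\<^esub> a = (inv h, \<psi> (inv h))"
        using h inv_DirProd[OF group_axioms A.group_axioms _ \<psi>_in] \<psi>_inv by simp
      then show ?thesis unfolding R_def using h(1) by blast
    qed
    show "a \<otimes>\<^bsub>?P\<^esub> b \<in> R" if "a \<in> R" "b \<in> R" for a b
    proof -
      obtain h h' where h: "h \<in> H" "a = (h, \<psi> h)" "h' \<in> H" "b = (h', \<psi> h')"
        using \<open>a \<in> R\<close> \<open>b \<in> R\<close> by (auto simp: R_def)
      then have "a \<otimes>\<^bsub>?P\<^esub> b = (h \<otimes> h', \<psi> (h \<otimes> h'))" using \<psi>_mult by simp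
      then show ?thesis unfolding R_def using h by blast
    qed
  qed
  moreover have "R \<inter> {\<one>} \<times> carrier A \<subseteq> {\<one>\<^bsub>?P\<^esub>}"
    using \<psi>_one by (auto simp: R_def)
  ultimately obtain D where D: "subgroup D ?P" "R \<subseteq> D" "D \<inter> {\<one>} \<times> carrier A \<subseteq> {\<one>\<^bsub>?P\<^esub>}"
    and max: "\<forall>p\<in>carrier ?P - D.
      \<exists>d\<in>D. \<exists>k::int. d \<otimes>\<^bsub>?P\<^esub> p [^]\<^bsub>?P\<^esub> k \<in> {\<one>} \<times> carrier A - {\<one>\<^bsub>?P\<^esub>}"
    by (rule P.maximal_subgroup_avoiding_power)
  interpret D: subgroup D ?P by (rule D(1))
  have D_in: "a \<in> carrier G" "w \<in> carrier A" if "(a, w) \<in> D" for a w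
    using D.subset that by auto
  have D_mult: "(a \<otimes> b, v \<otimes>\<^bsub>A\<^esub> w) \<in> D" if "(a, v) \<in> D" "(b, w) \<in> D" for a b v w
    using D.m_closed[OF that] by simp
  have D_inv: "(inv a, inv\<^bsub>A\<^esub> v) \<in> D" if "(a, v) \<in> D" for a v
    using D.m_inv_closed[OF that] D_in[OF that] by (simp add: inv_DirProd group_axioms A.group_axioms)
  have D_pow: "(a [^] k, v [^]\<^bsub>A\<^esub> k) \<in> D" if "(a, v) \<in> D" for a v and k :: int
    using P.subgroup_int_pow_closed[OF D(1) that, of k] D_in[OF that]
    by (simp add: int_pow_DirProd group_axioms A.group_axioms)
  have D_one: "v = \<one>\<^bsub>A\<^esub>" if "(\<one>, v) \<in> D" for v
    using D(3) that D_in by auto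
  have D_fun: "v = w" if "(a, v) \<in> D" "(a, w) \<in> D" for a v w
  proof -
    have "(a \<otimes> inv a, v \<otimes>\<^bsub>A\<^esub> inv\<^bsub>A\<^esub> w) \<in> D" using D_mult[OF that(1) D_inv[OF that(2)]] .
    then have "v \<otimes>\<^bsub>A\<^esub> inv\<^bsub>A\<^esub> w = \<one>\<^bsub>A\<^esub>" using D_one D_in[OF that(1)] by simp
    then have "v \<otimes>\<^bsub>A\<^esub> inv\<^bsub>A\<^esub> w \<otimes>\<^bsub>A\<^esub> w = w" using D_in[OF that(2)] by simp
    then show ?thesis using D_in[OF that(1)] D_in[OF that(2)] by (simp add: A.m_assoc)
  qed
  have total: "\<exists>w. (y, w) \<in> D" if y: "y \<in> carrier G" for y
  proof (rule ccontr)
    assume no: "\<nexists>w. (y, w) \<in> D"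
    \<comment> \<open>E k says that y^k lies in the domain of the partial homomorphism with graph
      D.\<close>
    define E where "E k \<longleftrightarrow> (\<exists>w. (y [^] k, w) \<in> D)" for k :: int
    have E_uminus: "E (- k)" if "E k" for k
      using that D_inv y unfolding E_def by (metis int_pow_neg)
    have E_from: "E k" if "(d, s) \<in> D" "d \<otimes> y [^] k = \<one>" for d s k
    proof -
      have "inv (y [^] k) = d" using that(2) D_in[OF that(1)] y by (intro inv_equality) auto
      then have "y [^] k = inv d" using y by auto
      then show ?thesis using D_inv[OF that(1)] by (auto simp: E_def)
    qed
    \<comment> \<open>Maximality against (y, 1) shows that some nonzero power of y lies in the
      domain: exponent 0 would give d = 1 and therefore s = 1.\<close>
    obtain d s k where dsk: "(d, s) \<in> D" "d \<otimes> y [^] (k::int) = \<one>" "s \<noteq> \<one>\<^bsub>A\<^esub>"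
    proof -
      have "(y, \<one>\<^bsub>A\<^esub>) \<notin> D" using no by blast
      then show thesis
        using max[rule_format, of "(y, \<one>\<^bsub>A\<^esub>)"] y that D_in
        by (auto simp: int_pow_DirProd group_axioms A.group_axioms)
    qed
    have "k \<noteq> 0"
    proof
      assume "k = 0"
      then show False using dsk D_in[OF dsk(1)] D_one by auto
    qed
    have "E k" using E_from dsk by blast
    then have "E (int (nat \<bar>k\<bar>))" using E_uminus[of k] by (cases "k \<ge> 0") auto
    moreover have "nat \<bar>k\<bar> > 0" using \<open>k \<noteq> 0\<close> by simp
    ultimately have ex: "\<exists>n>0. E (int n)" by blast
    \<comment> \<open>The exponents with E form a subgroup of the integers, and m is its positive
      generator.\<close>
    define m where "m = (LEAST n. n > 0 \<and> E (int n))"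
    have m: "m > 0" "E (int m)" using LeastI_ex[OF ex] by (auto simp: m_def)
    have m_least: "m \<le> n" if "n > 0" "E (int n)" for n
      unfolding m_def using that by (intro Least_le) simp
    obtain v where v: "(y [^] int m, v) \<in> D" using m by (auto simp: E_def)
    have dvd: "int m dvd k" if "E k" for k
    proof -
      have "E (k mod int m)"
      proof -
        obtain u where "(y [^] k, u) \<in> D" using \<open>E k\<close> by (auto simp: E_def)
        from D_mult[OF this D_pow[OF v, of "- (k div int m)"]]
        have "(y [^] (k + int m * - (k div int m)), u \<otimes>\<^bsub>A\<^esub> v [^]\<^bsub>A\<^esub> (- (k div int m))) \<in> D"
          using y by (simp only: int_pow_mult int_pow_pow)
        moreover have "k + int m * - (k div int m) = k mod int m"
          by (simp add: minus_mult_div_eq_mod)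
        ultimately show ?thesis unfolding E_def by metis
      qed
      moreover have "0 \<le> k mod int m" "k mod int m < int m" using m by auto
      ultimately have "k mod int m = 0"
        using m_least[of "nat (k mod int m)"] by (cases "k mod int m = 0") auto
      then show ?thesis by auto
    qed
    \<comment> \<open>An m-th root of v is a value at y that agrees with the value v at y^m. By
      maximality (y, w) still yields a nontrivial element over 1, but its exponent k' is a multiple
      of m, so that element already lies in D.\<close>
    obtain w where w: "w \<in> carrier A" "w [^]\<^bsub>A\<^esub> m = v" using divisible[OF D_in(2)[OF v] m(1)] by blast
    have "(y, w) \<notin> D" using no by blast
    then obtain d' s' k' where *: "(d', s') \<in> D" "d' \<otimes> y [^] (k'::int) = \<one>" "s' \<otimes>\<^bsub>A\<^esub> w [^]\<^bsub>A\<^esub> k' \<noteq> \<one>\<^bsub>A\<^esub>"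
      using max[rule_format, of "(y, w)"] y w D_in
      by (auto simp: int_pow_DirProd group_axioms A.group_axioms)
    obtain j where j: "k' = int m * j" using dvd[OF E_from[OF *(1,2)]] by (auto simp: dvd_def)
    have "(d' \<otimes> (y [^] int m) [^] j, s' \<otimes>\<^bsub>A\<^esub> v [^]\<^bsub>A\<^esub> j) \<in> D"
      by (rule D_mult[OF *(1) D_pow[OF v]])
    then have "(\<one>, s' \<otimes>\<^bsub>A\<^esub> v [^]\<^bsub>A\<^esub> j) \<in> D"
      using *(2) y by (simp add: int_pow_pow j)
    moreover have "v [^]\<^bsub>A\<^esub> j = w [^]\<^bsub>A\<^esub> k'"
      using w by (simp add: j A.int_pow_pow[symmetric] int_pow_int)
    ultimately show False using D_one *(3) by simp
  qed
  define \<phi> where "\<phi> y = (SOME w. (y, w) \<in> D)" for y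
  have \<phi>: "(y, \<phi> y) \<in> D" if "y \<in> carrier G" for y
    unfolding \<phi>_def using total[OF that] by (rule someI_ex)
  show thesis
  proof (rule that[of \<phi>])
    show "\<phi> \<in> hom G A"
    proof (rule homI)
      show "\<phi> y \<in> carrier A" if "y \<in> carrier G" for y using D_in \<phi>[OF that] by blast
      show "\<phi> (y \<otimes> z) = \<phi> y \<otimes>\<^bsub>A\<^esub> \<phi> z" if "y \<in> carrier G" "z \<in> carrier G" for y z
        using D_fun[OF \<phi> D_mult[OF \<phi> \<phi>]] that by simp
    qed
    show "\<phi> h = \<psi> h" if "h \<in> H" for h
      using D_fun[OF \<phi>, of h "\<psi> h"] that D(2) H.subset by (auto simp: R_def)
  qed
qed

section \<open>The circle as a divisible target\<close>

definition circle_group :: "complex monoid" where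
  "circle_group = \<lparr>carrier = {z. cmod z = 1}, monoid.mult = (*), one = 1\<rparr>"

lemma circle_group_simps [simp]:
  "carrier circle_group = {z. cmod z = 1}" "x \<otimes>\<^bsub>circle_group\<^esub> y = x * y" "\<one>\<^bsub>circle_group\<^esub> = 1"
  by (simp_all add: circle_group_def)

lemma comm_group_circle_group: "comm_group circle_group"
proof (rule comm_groupI)
  fix x assume "x \<in> carrier circle_group"
  then show "\<exists>y\<in>carrier circle_group. y \<otimes>\<^bsub>circle_group\<^esub> x = \<one>\<^bsub>circle_group\<^esub>"
    by (intro bexI[of _ "inverse x"]) (auto simp: norm_inverse intro!: left_inverse)
qed (auto simp: norm_mult)

lemma circle_group_divisible:
  assumes "v \<in> carrier circle_group" "m > 0"
  shows "\<exists>w\<in>carrier circle_group. w [^]\<^bsub>circle_group\<^esub> (m :: nat) = v"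
proof
  have pow: "x [^]\<^bsub>circle_group\<^esub> (n :: nat) = x ^ n" for x n
    by (induction n) (simp_all add: mult.commute)
  have "cis (Arg v / real m) ^ m = cis (Arg v)"
    using assms by (simp add: Complex.DeMoivre)
  also have "\<dots> = v" using assms cis_Arg[of v] by (cases "v = 0") (auto simp: sgn_div_norm)
  finally show "cis (Arg v / real m) [^]\<^bsub>circle_group\<^esub> m = v" by (simp add: pow)
qed simp

section \<open>Quotients and subgroups of topological groups\<close>

lemma (in group) rcos_eq_iff:
  assumes "subgroup N G" "x \<in> carrier G" "y \<in> carrier G"
  shows "N #> x = N #> y \<longleftrightarrow> x \<otimes> inv y \<in> N"
proof
  assume "N #> x = N #> y"
  then have "x \<in> N #> y" using rcos_self[OF assms(2,1)] by simp
  then obtain n where "n \<in> N" "x = n \<otimes> y" by (auto simp: r_coset_def)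
  then show "x \<otimes> inv y \<in> N"
    using assms subgroup.mem_carrier[OF assms(1)] by (simp add: m_assoc)
next
  assume "x \<otimes> inv y \<in> N"
  moreover have "x = (x \<otimes> inv y) \<otimes> y" using assms by (simp add: m_assoc)
  ultimately have "x \<in> N #> y" unfolding r_coset_def by blast
  then show "N #> x = N #> y" using repr_independence assms by metis
qed

context top_group begin

lemma openin_pair_nbhd:
  assumes "openin (prod_topology X Y) M" "(x, y) \<in> M"
  obtains U V where "openin X U" "openin Y V" "x \<in> U" "y \<in> V" "U \<times> V \<subseteq> M"
  using assms unfolding openin_prod_topology_alt by metis

lemma nbhd_mult:
  assumes "openin T W" "x \<in> carrier G" "y \<in> carrier G" "x \<otimes> y \<in> W"
  obtains U V where "openin T U" "openin T V" "x \<in> U" "y \<in> V" "\<forall>a\<in>U. \<forall>b\<in>V. a \<otimes> b \<in> W"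
proof -
  have "openin (prod_topology T T) {p \<in> topspace (prod_topology T T). (\<lambda>(x, y). x \<otimes> y) p \<in> W}"
    by (rule openin_continuous_map_preimage[OF continuous_mult assms(1)])
  moreover have "(x, y) \<in> {p \<in> topspace (prod_topology T T). (\<lambda>(x, y). x \<otimes> y) p \<in> W}"
    using assms by simp
  ultimately obtain U V where UV: "openin T U" "openin T V" "x \<in> U" "y \<in> V"
    "U \<times> V \<subseteq> {p \<in> topspace (prod_topology T T). (\<lambda>(x, y). x \<otimes> y) p \<in> W}"
    by (rule openin_pair_nbhd)
  have "a \<otimes> b \<in> W" if "a \<in> U" "b \<in> V" for a b
    using subsetD[OF UV(5), of "(a, b)"] that by simp
  then show thesis using that[of U V] UV by simp
qed

lemma openin_inv: 
  assumes "openin T W" shows "openin T {x \<in> carrier G. inv x \<in> W}"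
  using openin_continuous_map_preimage[OF continuous_inv assms] by simp

lemma nbhd_one:
  assumes "openin T W" "\<one> \<in> W"
  obtains U where "openin T U" "\<one> \<in> U" "\<forall>a\<in>U. inv a \<in> U" "\<forall>a\<in>U. \<forall>b\<in>U. a \<otimes> b \<in> W"
proof -
  obtain U V where UV: "openin T U" "openin T V" "\<one> \<in> U" "\<one> \<in> V" "\<forall>a\<in>U. \<forall>b\<in>V. a \<otimes> b \<in> W"
    by (rule nbhd_mult[OF assms(1), of \<one> \<one>]) (use assms(2) in auto)
  define U' where "U' = (U \<inter> V) \<inter> {x \<in> carrier G. inv x \<in> U \<inter> V}"
  show thesis
  proof (rule that[of U'])
    show "openin T U'" unfolding U'_def using UV by (intro openin_Int openin_inv)
  qed (use UV in \<open>auto simp: U'_def\<close>)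
qed

lemma openin_subgroup:
  assumes H: "subgroup H G" and "openin T U" "\<one> \<in> U" "U \<subseteq> H"
  shows "openin T H"
proof (subst openin_subopen, intro ballI)
  interpret H: subgroup H G by (rule H)
  fix h assume h: "h \<in> H"
  have "h = h \<otimes> \<one>" using h H.mem_carrier by simp
  then have "h \<in> (\<lambda>x. h \<otimes> x) ` U" using assms(3) by blast
  then show "\<exists>V. openin T V \<and> h \<in> V \<and> V \<subseteq> H"
    using openin_translate[OF assms(2), of h] h H.mem_carrier assms(4)
    by (intro exI[of _ "(\<lambda>x. h \<otimes> x) ` U"]) auto
qed

lemma closedin_open_subgroup:
  assumes H: "subgroup H G" "openin T H"
  shows "closedin T H"
proof -
  interpret H: subgroup H G by (rule H)
  have "carrier G - H = (\<Union>g\<in>carrier G - H. (\<lambda>x. g \<otimes> x) ` H)"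
  proof (intro equalityI subsetI)
    fix g assume g: "g \<in> carrier G - H"
    then have "g = g \<otimes> \<one>" by simp
    then show "g \<in> (\<Union>g\<in>carrier G - H. (\<lambda>x. g \<otimes> x) ` H)" using g H.one_closed by blast
  next
    fix y assume "y \<in> (\<Union>g\<in>carrier G - H. (\<lambda>x. g \<otimes> x) ` H)"
    then obtain g h where gh: "g \<in> carrier G" "g \<notin> H" "h \<in> H" "y = g \<otimes> h" by blast
    have "g = y \<otimes> inv h" using gh H.mem_carrier by (simp add: m_assoc)
    then have "y \<notin> H" using gh H.m_closed H.m_inv_closed by metis
    then show "y \<in> carrier G - H" using gh H.mem_carrier by simp
  qed
  moreover have "openin T (\<Union>g\<in>carrier G - H. (\<lambda>x. g \<otimes> x) ` H)"
    by (intro openin_Union) (auto intro: openin_translate[OF H(2)])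
  ultimately have "openin T (carrier G - H)" by (simp only:)
  then show ?thesis using H.subset by (simp add: closedin_def)
qed

lemma compactin_translate:
  assumes "compactin T C" "a \<in> carrier G"
  shows "compactin T ((\<lambda>x. a \<otimes> x) ` C)"
  using image_compactin[OF assms(1) continuous_map_translate[OF assms(2)]] .

lemma compactin_set_mult:
  assumes "compactin T A" "compactin T B"
  shows "compactin T (A <#> B)"
proof -
  have "compactin T ((\<lambda>(x, y). x \<otimes> y) ` (A \<times> B))"
    using assms by (intro image_compactin[OF _ continuous_mult]) (auto simp: compactin_Times)
  moreover have "(\<lambda>(x, y). x \<otimes> y) ` (A \<times> B) = A <#> B"
    by (auto simp: set_mult_def)
  ultimately show ?thesis by simp
qed

lemma top_group_subgroup:
  assumes H: "subgroup H G"
  shows "top_group (G\<lparr>carrier := H\<rparr>) (subtopology T H)"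
proof (intro top_group.intro top_group_axioms.intro)
  interpret H: subgroup H G by (rule H)
  show grp: "group (G\<lparr>carrier := H\<rparr>)" by (rule subgroup_imp_group[OF H])
  have "continuous_map (prod_topology (subtopology T H) (subtopology T H)) (subtopology T H) (\<lambda>(x, y). x \<otimes> y)"
    unfolding prod_topology_subtopology subtopology_subtopology
    by (auto simp: continuous_map_in_subtopology prod_topology_subtopology intro: continuous_map_from_subtopology continuous_mult)
  moreover have "continuous_map (subtopology T H) (subtopology T H) (\<lambda>x. inv x)"
    by (auto simp: continuous_map_in_subtopology intro: continuous_map_from_subtopology continuous_inv)
  then have "continuous_map (subtopology T H) (subtopology T H) (\<lambda>x. inv\<^bsub>G\<lparr>carrier := H\<rparr>\<^esub> x)"
    by (rule continuous_map_eq) (auto simp: m_inv_consistent[OF H])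
  ultimately show "topological_group (G\<lparr>carrier := H\<rparr>) (subtopology T H)"
    unfolding topological_group_def using grp H.subset Hausdorff
    by (auto simp: Hausdorff_space_subtopology)
qed

section \<open>Coset spaces as topological groups\<close>

lemma quotient_map_cosets: "quotient_map T (coset_topology G T N) (\<lambda>x. N #> x)"
  by (rule quotient_map_coset_topology) simp

lemma topspace_coset_topology: "topspace (coset_topology G T N) = carrier (G Mod N)"
  using quotient_imp_surjective_map[OF quotient_map_cosets, of N] by (simp add: carrier_FactGroup)

text \<open>The saturation of V is the union of the translates n V, so the coset map is
  open.\<close>

lemma openin_image_cosets:
  assumes N: "subgroup N G" and V: "openin T V"
  shows "openin (coset_topology G T N) ((\<lambda>x. N #> x) ` V)"
proof -
  have Vc: "V \<subseteq> carrier G" using openin_subset[OF V] by simp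
  have "{x \<in> carrier G. N #> x \<in> (\<lambda>x. N #> x) ` V} = (\<Union>n\<in>N. (\<lambda>x. n \<otimes> x) ` V)"
  proof (intro equalityI subsetI)
    fix x assume "x \<in> {x \<in> carrier G. N #> x \<in> (\<lambda>x. N #> x) ` V}"
    then obtain v where v: "x \<in> carrier G" "v \<in> V" "N #> x = N #> v" by blast
    then have "x \<otimes> inv v \<in> N" using rcos_eq_iff[OF N] Vc by blast
    moreover have "x = (x \<otimes> inv v) \<otimes> v" using v Vc by (auto simp: m_assoc subset_iff)
    ultimately show "x \<in> (\<Union>n\<in>N. (\<lambda>x. n \<otimes> x) ` V)" using v(2) by blast
  next
    fix x assume "x \<in> (\<Union>n\<in>N. (\<lambda>x. n \<otimes> x) ` V)"
    then obtain n v where nv: "n \<in> N" "v \<in> V" "x = n \<otimes> v" by blast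
    then have c: "n \<in> carrier G" "v \<in> carrier G" using Vc subgroup.mem_carrier[OF N] by auto
    have "x \<otimes> inv v = n" using nv c by (simp add: m_assoc)
    then have "N #> x = N #> v" using rcos_eq_iff[OF N, of x v] nv c by simp
    then show "x \<in> {x \<in> carrier G. N #> x \<in> (\<lambda>x. N #> x) ` V}" using nv c by blast
  qed
  moreover have "openin T (\<Union>n\<in>N. (\<lambda>x. n \<otimes> x) ` V)"
    using subgroup.mem_carrier[OF N] by (intro openin_Union) (auto intro: openin_translate[OF V])
  ultimately show ?thesis
    using Vc by (auto simp: openin_coset_topology carrier_FactGroup)
qed

text \<open>Openness of the coset map carries neighbourhoods of representatives to the quotient.
  Continuity of multiplication follows directly; the Hausdorff property comes from the open
  complement of N, which contains x y^-1 for distinct cosets.\<close>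

lemma top_group_quotient:
  assumes N: "N \<lhd> G" "closedin T N"
  shows "top_group (G Mod N) (coset_topology G T N)"
proof (intro top_group.intro top_group_axioms.intro)
  interpret N: normal N G by (rule N(1))
  let ?Q = "coset_topology G T N"
  show grp: "group (G Mod N)" by (rule N.factorgroup_is_group)
  have sub: "subgroup N G" by (rule N.subgroup_axioms)
  have "continuous_map (prod_topology ?Q ?Q) ?Q (\<lambda>(X, Y). X <#> Y)"
    unfolding continuous_map_def
  proof (intro conjI allI impI)
    show "(\<lambda>(X, Y). X <#> Y) \<in> topspace (prod_topology ?Q ?Q) \<rightarrow> topspace ?Q"
      using group.is_monoid[OF grp, THEN monoid.m_closed] by (auto simp: topspace_coset_topology)
    fix W assume W: "openin ?Q W"
    show "openin (prod_topology ?Q ?Q) {p \<in> topspace (prod_topology ?Q ?Q). (\<lambda>(X, Y). X <#> Y) p \<in> W}"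
    proof (subst openin_prod_topology_alt, intro allI impI)
      fix X Y assume "(X, Y) \<in> {p \<in> topspace (prod_topology ?Q ?Q). (\<lambda>(X, Y). X <#> Y) p \<in> W}"
      then obtain x y where xy: "x \<in> carrier G" "y \<in> carrier G" "X = N #> x" "Y = N #> y" "X <#> Y \<in> W"
        by (auto simp: topspace_coset_topology carrier_FactGroup)
      have "openin T {z \<in> carrier G. N #> z \<in> W}"
        using W by (simp add: openin_coset_topology)
      moreover have "x \<otimes> y \<in> {z \<in> carrier G. N #> z \<in> W}"
        using xy by (simp add: N.rcos_sum)
      ultimately obtain U V where UV: "openin T U" "openin T V" "x \<in> U" "y \<in> V"
        "\<forall>a\<in>U. \<forall>b\<in>V. a \<otimes> b \<in> {z \<in> carrier G. N #> z \<in> W}"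
        by (rule nbhd_mult[OF _ xy(1,2)])
      have c: "U \<subseteq> carrier G" "V \<subseteq> carrier G" using UV openin_subset by fastforce+
      have "(\<lambda>x. N #> x) ` U \<times> (\<lambda>x. N #> x) ` V \<subseteq>
          {p \<in> topspace (prod_topology ?Q ?Q). (\<lambda>(X, Y). X <#> Y) p \<in> W}"
        using UV(5) c by (auto simp: topspace_coset_topology carrier_FactGroup N.rcos_sum subset_iff)
      then show "\<exists>U V. openin ?Q U \<and> openin ?Q V \<and> X \<in> U \<and> Y \<in> V \<and>
          U \<times> V \<subseteq> {p \<in> topspace (prod_topology ?Q ?Q). (\<lambda>(X, Y). X <#> Y) p \<in> W}"
        using openin_image_cosets[OF sub UV(1)] openin_image_cosets[OF sub UV(2)] UV(3,4) xy(3,4) by blast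
    qed
  qed
  moreover have "continuous_map ?Q ?Q (\<lambda>X. inv\<^bsub>G Mod N\<^esub> X)"
  proof (rule continuous_compose_quotient_map[OF quotient_map_cosets])
    have "continuous_map T ?Q (\<lambda>x. N #> (inv x))"
      using continuous_map_compose[OF continuous_inv quotient_imp_continuous_map[OF quotient_map_cosets]]
      by (simp add: o_def)
    then show "continuous_map T ?Q ((\<lambda>X. inv\<^bsub>G Mod N\<^esub> X) \<circ> (\<lambda>x. N #> x))"
      by (rule continuous_map_eq) (auto simp: N.inv_FactGroup carrier_FactGroup N.rcos_inv)
  qed
  moreover have "Hausdorff_space ?Q"
    unfolding Hausdorff_space_def
  proof (intro allI impI)
    fix X Y assume XY: "X \<in> topspace ?Q \<and> Y \<in> topspace ?Q \<and> X \<noteq> Y"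
    then obtain x y where xy: "x \<in> carrier G" "y \<in> carrier G" "X = N #> x" "Y = N #> y"
      by (auto simp: topspace_coset_topology carrier_FactGroup)
    have "openin T (carrier G - N)" using N(2) by (metis openin_diff openin_topspace topspace_eq)
    moreover have "x \<otimes> inv y \<in> carrier G - N" using XY xy rcos_eq_iff[OF sub xy(1,2)] by auto
    ultimately obtain U V where UV: "openin T U" "openin T V" "x \<in> U" "inv y \<in> V"
      "\<forall>a\<in>U. \<forall>b\<in>V. a \<otimes> b \<in> carrier G - N"
      by (rule nbhd_mult[OF _ xy(1) inv_closed[OF xy(2)]])
    define V' where "V' = {z \<in> carrier G. inv z \<in> V}"
    have V': "openin T V'" "y \<in> V'" unfolding V'_def using UV openin_inv xy by auto
    have Uc: "U \<subseteq> carrier G" using openin_subset[OF UV(1)] by simp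
    have "disjnt ((\<lambda>x. N #> x) ` U) ((\<lambda>x. N #> x) ` V')"
    proof -
      have "N #> a \<noteq> N #> b" if "a \<in> U" "b \<in> V'" for a b
        using rcos_eq_iff[OF sub, of a b] UV(5)[rule_format, of a "inv b"] that Uc by (auto simp: V'_def)
      then show ?thesis by (auto simp: disjnt_def)
    qed
    then show "\<exists>U V. openin ?Q U \<and> openin ?Q V \<and> X \<in> U \<and> Y \<in> V \<and> disjnt U V"
      using openin_image_cosets[OF sub UV(1)] openin_image_cosets[OF sub V'(1)] UV(3) V'(2) xy(3,4) by blast
  qed
  ultimately show "topological_group (G Mod N) ?Q"
    unfolding topological_group_def using grp by (simp add: topspace_coset_topology)
qed

end

section \<open>Compact open subgroups\<close>

context top_group begin

text \<open>Infinitely many powers lie in K, which finitely many translates a U cover. Two exponents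
  more than N apart share a translate, and the quotient of these powers lies in U^-1 U, hence in
  W.\<close>

lemma power_near_one:
  assumes K: "compactin T K" and y: "y \<in> carrier G" and rec: "\<forall>N::nat. \<exists>m\<ge>N. y [^] m \<in> K"
    and W: "openin T W" "\<one> \<in> W"
  obtains n :: nat where "n > N" "y [^] n \<in> W"
proof -
  obtain U where U: "openin T U" "\<one> \<in> U" "\<forall>a\<in>U. inv a \<in> U" "\<forall>a\<in>U. \<forall>b\<in>U. a \<otimes> b \<in> W"
    by (rule nbhd_one[OF W])
  have Uc: "U \<subseteq> carrier G" using openin_subset[OF U(1)] by simp
  have Kc: "K \<subseteq> carrier G" using compactin_subset_topspace[OF K] by simp
  have "\<forall>c\<in>K. \<exists>a\<in>K. inv a \<otimes> c \<in> U"
  proof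
    fix c assume "c \<in> K"
    moreover have "inv c \<otimes> c = \<one>" using \<open>c \<in> K\<close> Kc by auto
    ultimately show "\<exists>a\<in>K. inv a \<otimes> c \<in> U" using U(2) by (intro bexI[of _ c]) simp_all
  qed
  then obtain F where F: "finite F" "F \<subseteq> K" "\<forall>c\<in>K. \<exists>a\<in>F. inv a \<otimes> c \<in> U"
    by (rule compactin_translate_cover[OF K U(1) Kc])
  let ?M = "{m::nat. y [^] m \<in> K}"
  have "infinite ?M" unfolding infinite_nat_iff_unbounded_le using rec by auto
  moreover have "?M \<subseteq> (\<Union>a\<in>F. {m. inv a \<otimes> y [^] m \<in> U})" using F(3) by auto
  ultimately have "infinite (\<Union>a\<in>F. {m::nat. inv a \<otimes> y [^] m \<in> U})"
    using infinite_super by blast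
  then obtain a where a: "a \<in> F" "infinite {m::nat. inv a \<otimes> y [^] m \<in> U}"
    using finite_UN_I[OF F(1), of "\<lambda>a. {m::nat. inv a \<otimes> y [^] m \<in> U}"] by blast
  have ac: "a \<in> carrier G" using a F Kc by auto
  obtain m1 where m1: "inv a \<otimes> y [^] (m1::nat) \<in> U"
    using a(2) not_finite_existsD by auto
  obtain m2 where m2: "m2 \<ge> m1 + N + 1" "inv a \<otimes> y [^] (m2::nat) \<in> U"
    using a(2) unfolding infinite_nat_iff_unbounded_le by blast
  have "inv (inv a \<otimes> y [^] m1) \<otimes> (inv a \<otimes> y [^] m2) \<in> W" using U(3,4) m1 m2(2) by blast
  also have "inv (inv a \<otimes> y [^] m1) \<otimes> (inv a \<otimes> y [^] m2) = inv (y [^] m1) \<otimes> (a \<otimes> (inv a \<otimes> y [^] m2))"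
    using ac y by (simp add: inv_mult_group m_assoc)
  also have "\<dots> = inv (y [^] m1) \<otimes> y [^] m2"
    using ac y by (simp add: m_assoc[symmetric])
  also have "y [^] m2 = y [^] m1 \<otimes> y [^] (m2 - m1)"
    using y m2 by (simp add: nat_pow_mult)
  also have "inv (y [^] m1) \<otimes> (y [^] m1 \<otimes> y [^] (m2 - m1)) = y [^] (m2 - m1)"
    using y by (simp add: m_assoc[symmetric])
  finally show thesis using that[of "m2 - m1"] m2 by simp
qed

text \<open>Weil's lemma: compactness bounds the gaps between the returns of \<open>y [^] n\<close>, \<open>n > 0\<close>,
  to any translate of a neighbourhood of \<open>1\<close>.\<close>

lemma recurrent_power_relatively_compact:
  assumes lc: "locally_compact_space T" and K: "compactin T K" and y: "y \<in> carrier G"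
    and rec: "\<forall>N::nat. \<exists>m\<ge>N. y [^] m \<in> K"
  obtains C where "compactin T C" "\<forall>k::int. y [^] k \<in> C"
proof -
  obtain O1 K1 where O1: "openin T O1" "compactin T K1" "\<one> \<in> O1" "O1 \<subseteq> K1"
    using lc unfolding locally_compact_space_def by (metis one_closed topspace_eq)
  obtain U where U: "openin T U" "\<one> \<in> U" "\<forall>a\<in>U. inv a \<in> U" "\<forall>a\<in>U. \<forall>b\<in>U. a \<otimes> b \<in> O1"
    by (rule nbhd_one[OF O1(1,3)])
  have Uc: "U \<subseteq> carrier G" using openin_subset[OF U(1)] by simp
  obtain U2 where U2: "openin T U2" "\<one> \<in> U2" "\<forall>a\<in>U2. inv a \<in> U2" "\<forall>a\<in>U2. \<forall>b\<in>U2. a \<otimes> b \<in> U"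
    by (rule nbhd_one[OF U(1,2)])
  have U2c: "U2 \<subseteq> carrier G" using openin_subset[OF U2(1)] by simp
  have UK: "U \<subseteq> K1" using U(2,4) O1(4) Uc by (force simp: subset_iff)
  define A where "A = range (\<lambda>k::int. y [^] k)"
  have Ac: "A \<subseteq> carrier G" using y by (auto simp: A_def)
  define L where "L = T closure_of A \<inter> K1"
  have L: "compactin T L" unfolding L_def by (intro closed_Int_compactin O1 closedin_closure_of)
  have Lc: "L \<subseteq> carrier G" using compactin_subset_topspace[OF L] by simp
  \<comment> \<open>A point of the closure is first approximated by y^k with k of either sign.
    Multiplying by a power y^n near 1 with n > |k| makes the exponent positive.\<close>
  have approach: "\<exists>n::nat. n > 0 \<and> inv c \<otimes> y [^] n \<in> U" if c: "c \<in> T closure_of A" for c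
  proof -
    have cc: "c \<in> carrier G" using c closure_of_subset_topspace[of T A] by auto
    have "c \<in> (\<lambda>x. c \<otimes> x) ` U2" using U2(2) cc by (intro image_eqI[of _ _ \<one>]) auto
    then obtain k :: int where "y [^] k \<in> (\<lambda>x. c \<otimes> x) ` U2"
      using c openin_translate[OF U2(1) cc] unfolding in_closure_of A_def by blast
    then obtain u where u: "u \<in> U2" "y [^] k = c \<otimes> u" by blast
    obtain n :: nat where n: "n > nat \<bar>k\<bar>" "y [^] n \<in> U2"
      by (rule power_near_one[OF K y rec U2(1,2)])
    define m where "m = nat (k + int n)"
    have m: "int m = k + int n" "m > 0" using n by (auto simp: m_def)
    have "y [^] m = y [^] k \<otimes> y [^] n"
      using y m(1) by (metis int_pow_int int_pow_mult)
    then have "inv c \<otimes> y [^] m = u \<otimes> y [^] n"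
      using u cc y U2c by (simp add: m_assoc subset_iff) (simp add: m_assoc[symmetric])
    then show ?thesis using U2(4) u n m by auto
  qed
  have "\<forall>c\<in>L. \<exists>a\<in>(\<lambda>n::nat. y [^] n) ` {0<..}. inv a \<otimes> c \<in> U"
  proof
    fix c assume c: "c \<in> L"
    obtain n :: nat where n: "n > 0" "inv c \<otimes> y [^] n \<in> U" using approach[of c] c by (auto simp: L_def)
    have "inv (inv c \<otimes> y [^] n) \<in> U" using U(3) n by blast
    moreover have "inv (inv c \<otimes> y [^] n) = inv (y [^] n) \<otimes> c"
      using c Lc y by (auto simp: inv_mult_group)
    ultimately show "\<exists>a\<in>(\<lambda>n::nat. y [^] n) ` {0<..}. inv a \<otimes> c \<in> U" using n by auto
  qed
  then obtain F where F: "finite F" "F \<subseteq> (\<lambda>n::nat. y [^] n) ` {0<..}" "\<forall>c\<in>L. \<exists>a\<in>F. inv a \<otimes> c \<in> U"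
    by (rule compactin_translate_cover[OF L U(1), rotated]) (use y in auto)
  obtain I where I: "finite I" "I \<subseteq> {0<..}" "F = (\<lambda>n::nat. y [^] n) ` I"
    using finite_subset_image[OF F(1,2)] by blast
  \<comment> \<open>The 0 makes the set nonempty, so that \<open>Max\<close> is meaningful.\<close>
  define n0 where "n0 = Max (insert 0 I)"
  define C where "C = (\<Union>n\<in>{..n0}. (\<lambda>x. y [^] n \<otimes> x) ` K1)"
  have "compactin T C"
    unfolding C_def using y by (intro compactin_Union) (auto intro!: compactin_translate O1)
  moreover have "y [^] k \<in> C" for k :: int
  proof -
    let ?a = "y [^] k"
    have a: "?a \<in> carrier G" using y by simp
    have "?a \<in> T closure_of A" using closure_of_subset[of A T] Ac by (auto simp: A_def)
    then have ex: "\<exists>n::nat. inv ?a \<otimes> y [^] n \<in> U" using approach by blast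
    \<comment> \<open>At this first return y^(n-k) lies in U. Some i in I leads from there back to
      y^(n-i-k) in U, so n - i would be an earlier return unless n < i \<le> n0. Then y^k = y^n
      (y^(n-k))^-1 lies in y^n K1.\<close>
    define n where "n = (LEAST n::nat. inv ?a \<otimes> y [^] n \<in> U)"
    have n: "inv ?a \<otimes> y [^] n \<in> U" unfolding n_def by (rule LeastI_ex[OF ex])
    have "inv ?a \<otimes> y [^] n = y [^] (int n - k)"
    proof -
      have "y [^] (- k + int n) = y [^] (- k) \<otimes> y [^] (int n)" by (rule int_pow_mult[OF y])
      also have "y [^] (- k) = inv ?a" by (rule int_pow_neg[OF y])
      finally show ?thesis by (simp add: int_pow_int)
    qed
    then have "inv ?a \<otimes> y [^] n \<in> L"
      using n UK closure_of_subset[of A T] Ac by (auto simp: L_def A_def)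
    then obtain i where i: "i \<in> I" "inv (y [^] i) \<otimes> (inv ?a \<otimes> y [^] n) \<in> U" using F(3) I(3) by blast
    have "i > 0" using i I by auto
    have "i \<le> n0" unfolding n0_def using I(1) i by simp
    have "n < i"
    proof (rule ccontr)
      assume "\<not> n < i"
      have "y [^] (- int i + (int n - k)) = y [^] (- int i) \<otimes> y [^] (int n - k)" by (rule int_pow_mult[OF y])
      then have "inv (y [^] i) \<otimes> (inv ?a \<otimes> y [^] n) = y [^] (- int i + (int n - k))"
        using \<open>inv ?a \<otimes> y [^] n = y [^] (int n - k)\<close> y by (simp add: int_pow_neg_int)
      also have "- int i + (int n - k) = - k + int (n - i)" using \<open>\<not> n < i\<close> by simp
      also have "y [^] \<dots> = y [^] (- k) \<otimes> y [^] (int (n - i))" by (rule int_pow_mult[OF y])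
      also have "\<dots> = inv ?a \<otimes> y [^] (n - i)" using y by (simp add: int_pow_neg int_pow_int)
      finally have "inv ?a \<otimes> y [^] (n - i) \<in> U" using i(2) by simp
      then have "n \<le> n - i" unfolding n_def by (rule Least_le)
      then show False using \<open>i > 0\<close> \<open>\<not> n < i\<close> by simp
    qed
    have "inv (inv ?a \<otimes> y [^] n) \<in> K1" using n U(3) UK by blast
    moreover have "?a = y [^] n \<otimes> inv (inv ?a \<otimes> y [^] n)"
      using a y by (simp add: inv_mult_group m_assoc[symmetric])
    ultimately show ?thesis
      unfolding C_def using \<open>n < i\<close> \<open>i \<le> n0\<close> by (intro UN_I[of n]) auto
  qed
  ultimately show thesis using that by blast
qed

text \<open>Adjoining one more generator y multiplies the compact bound by a compact set that
  contains all powers of y.\<close>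

lemma finite_subset_compact_subgroup:
  assumes comm: "comm_group G"
    and cyclic: "\<And>y. y \<in> carrier G \<Longrightarrow> \<exists>C. compactin T C \<and> (\<forall>k::int. y [^] k \<in> C)"
    and F: "finite F" "F \<subseteq> carrier G"
  shows "\<exists>E C. subgroup E G \<and> F \<subseteq> E \<and> E \<subseteq> C \<and> compactin T C"
  using F
proof (induction F)
  case empty
  have "subgroup {\<one>} G" by (rule triv_subgroup)
  then show ?case by (intro exI[of _ "{\<one>}"]) auto
next
  case (insert y F)
  then obtain E C where EC: "subgroup E G" "F \<subseteq> E" "E \<subseteq> C" "compactin T C" by auto
  obtain C' where C': "compactin T C'" "\<forall>k::int. y [^] k \<in> C'" using cyclic insert.prems by blast
  define E' where "E' = {d \<otimes> y [^] (k::int) |d k. d \<in> E}"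
  have y: "y \<in> carrier G" using insert.prems by simp
  have "subgroup E' G" unfolding E'_def by (rule comm_group.subgroup_adjoin[OF comm EC(1) y])
  moreover have "insert y F \<subseteq> E'"
  proof
    fix z assume z: "z \<in> insert y F"
    show "z \<in> E'"
    proof (cases "z = y")
      case True
      then have "z = \<one> \<otimes> y [^] (1::int)" using y by simp
      then show ?thesis unfolding E'_def using subgroup.one_closed[OF EC(1)] by blast
    next
      case False
      then have "z \<in> E" using z EC by auto
      moreover from this have "z = z \<otimes> y [^] (0::int)" using subgroup.mem_carrier[OF EC(1)] by simp
      ultimately show ?thesis unfolding E'_def by blast
    qed
  qed
  moreover have "E' \<subseteq> C <#> C'"
    unfolding E'_def set_mult_def using EC(3) C'(2) by blast
  ultimately show ?case using compactin_set_mult[OF EC(4) C'(1)] by blast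
qed

text \<open>Finitely many translates f O1 with f in E cover W W, so W W E is contained in W E, and H
  = W E is a subgroup. It contains O1, so it is open, hence closed, hence compact as a subset of W
  C.\<close>

lemma compact_open_subgroup:
  assumes comm: "comm_group G"
    and cyclic: "\<And>y. y \<in> carrier G \<Longrightarrow> \<exists>C. compactin T C \<and> (\<forall>k::int. y [^] k \<in> C)"
    and W: "compactin T W" "\<forall>w\<in>W. inv w \<in> W" and O1: "openin T O1" "\<one> \<in> O1" "O1 \<subseteq> W"
  obtains H where "subgroup H G" "W \<subseteq> H" "openin T H" "compactin T H"
proof -
  interpret comm_group G by (rule comm)
  have Wc: "W \<subseteq> carrier G" using compactin_subset_topspace[OF W(1)] by simp
  have WW: "compactin T (W <#> W)" by (rule compactin_set_mult[OF W(1,1)])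
  have WWc: "W <#> W \<subseteq> carrier G" using compactin_subset_topspace[OF WW] by simp
  have "\<forall>c\<in>W <#> W. \<exists>a\<in>carrier G. inv a \<otimes> c \<in> O1"
  proof
    fix c assume "c \<in> W <#> W"
    then have "c \<in> carrier G" using WWc by blast
    then show "\<exists>a\<in>carrier G. inv a \<otimes> c \<in> O1" using O1(2) by (intro bexI[of _ c]) simp_all
  qed
  then obtain F where F: "finite F" "F \<subseteq> carrier G" "\<forall>c\<in>W <#> W. \<exists>a\<in>F. inv a \<otimes> c \<in> O1"
    by (rule compactin_translate_cover[OF WW O1(1) subset_refl])
  obtain E C where EC: "subgroup E G" "F \<subseteq> E" "E \<subseteq> C" "compactin T C"
    using finite_subset_compact_subgroup[OF comm cyclic F(1,2)] by blast
  note E_mem = subgroup.mem_carrier[OF EC(1)]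
  define H where "H = W <#> E"
  have H: "h \<in> H \<longleftrightarrow> (\<exists>w\<in>W. \<exists>e\<in>E. h = w \<otimes> e)" for h by (auto simp: H_def set_mult_def)
  have HC: "H \<subseteq> W <#> C" using EC by (auto simp: H_def set_mult_def)
  have "\<one> \<in> W" using O1 by blast
  have sub: "subgroup H G"
  proof (rule subgroupI)
    show "H \<subseteq> carrier G"
      unfolding H_def using Wc subgroup.subset[OF EC(1)] by (rule set_mult_closed)
    show "H \<noteq> {}" using H \<open>\<one> \<in> W\<close> subgroup.one_closed[OF EC(1)] by blast
    show "inv a \<in> H" if a: "a \<in> H" for a
    proof -
      obtain w e where we: "w \<in> W" "e \<in> E" "a = w \<otimes> e" using a H by blast
      have "inv a = inv w \<otimes> inv e" using we Wc E_mem by (auto simp: inv_mult subset_iff)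
      then show ?thesis using H W(2) we subgroup.m_inv_closed[OF EC(1)] by blast
    qed
    show "a \<otimes> b \<in> H" if ab: "a \<in> H" "b \<in> H" for a b
    proof -
      obtain w e where we: "w \<in> W" "e \<in> E" "a = w \<otimes> e" using ab H by blast
      obtain v d where vd: "v \<in> W" "d \<in> E" "b = v \<otimes> d" using ab H by blast
      have c: "w \<in> carrier G" "v \<in> carrier G" "e \<in> carrier G" "d \<in> carrier G"
        using we vd Wc E_mem by auto
      have "w \<otimes> v \<in> W <#> W" using we vd by (auto simp: set_mult_def)
      then obtain f where f: "f \<in> F" "inv f \<otimes> (w \<otimes> v) \<in> O1" using F(3) by blast
      have fc: "f \<in> carrier G" using f F by blast
      have "f \<otimes> (inv f \<otimes> (w \<otimes> v)) = w \<otimes> v" using fc c by (simp add: m_assoc[symmetric])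
      then have "a \<otimes> b = (inv f \<otimes> (w \<otimes> v)) \<otimes> (f \<otimes> (e \<otimes> d))"
        using we vd c fc by (simp add: m_ac)
      moreover have "f \<otimes> (e \<otimes> d) \<in> E"
        using EC(2) f we vd subgroup.m_closed[OF EC(1)] by blast
      ultimately show ?thesis using H f(2) O1(3) by blast
    qed
  qed
  have "W \<subseteq> H"
  proof
    fix w assume "w \<in> W"
    moreover from this have "w = w \<otimes> \<one>" using Wc by auto
    ultimately show "w \<in> H" using H subgroup.one_closed[OF EC(1)] by blast
  qed
  then have "openin T H" using O1 by (intro openin_subgroup[OF sub O1(1,2)]) blast
  moreover have "compactin T H"
    by (rule closed_compactin[OF compactin_set_mult[OF W(1) EC(4)] HC closedin_open_subgroup[OF sub \<open>openin T H\<close>]])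
  ultimately show thesis using that sub \<open>W \<subseteq> H\<close> by blast
qed

end

section \<open>Characters of locally compact abelian groups\<close>

definition character :: "('a, 'b) monoid_scheme \<Rightarrow> 'a topology \<Rightarrow> ('a \<Rightarrow> complex) \<Rightarrow> bool" where
  "character G T \<psi> \<longleftrightarrow> continuous_map T euclidean \<psi> \<and> \<psi> \<in> hom G circle_group"

lemma characterD:
  assumes "character G T \<psi>"
  shows "continuous_map T euclidean \<psi>" "\<psi> \<in> hom G circle_group"
    "a \<in> carrier G \<Longrightarrow> cmod (\<psi> a) = 1"
    "a \<in> carrier G \<Longrightarrow> b \<in> carrier G \<Longrightarrow> \<psi> (a \<otimes>\<^bsub>G\<^esub> b) = \<psi> a * \<psi> b"
  using assms by (auto simp: character_def hom_def)

context top_group begin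

lemma symmetric_compact_nbhd:
  assumes lc: "locally_compact_space T" and x: "x \<in> carrier G"
  obtains W U where "compactin T W" "\<forall>w\<in>W. inv w \<in> W" "openin T U" "\<one> \<in> U" "U \<subseteq> W" "x \<in> W"
proof -
  obtain U K where UK: "openin T U" "compactin T K" "\<one> \<in> U" "U \<subseteq> K"
    using lc unfolding locally_compact_space_def by (metis one_closed topspace_eq)
  have Kc: "K \<subseteq> carrier G" using compactin_subset_topspace[OF UK(2)] by simp
  define W where "W = insert x K \<union> (\<lambda>a. inv a) ` insert x K"
  have "compactin T (insert x K)"
    using compactin_Un[of T "{x}" K] UK(2) x by simp
  then have "compactin T W"
    unfolding W_def by (intro compactin_Un image_compactin[OF _ continuous_inv])
  moreover have "inv w \<in> W" if "w \<in> W" for w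
    using that Kc x by (auto simp: W_def subset_iff)
  ultimately show thesis
    using that[of W U] UK by (auto simp: W_def)
qed

text \<open>On the open coset g H the map is \<phi> g times a translate of \<psi>, so continuity on
  H spreads over G.\<close>

lemma continuous_extension_of_character:
  assumes H: "subgroup H G" "openin T H" and \<phi>: "\<phi> \<in> hom G circle_group"
    and \<psi>: "continuous_map (subtopology T H) euclidean \<psi>" and eq: "\<And>h. h \<in> H \<Longrightarrow> \<phi> h = \<psi> h"
  shows "character G T \<phi>"
proof -
  interpret H: subgroup H G by (rule H(1))
  have mult: "\<phi> (a \<otimes> b) = \<phi> a * \<phi> b" if "a \<in> carrier G" "b \<in> carrier G" for a b
    using \<phi> that by (auto simp: hom_def)
  have "continuous_map T euclidean \<phi>"
    unfolding continuous_map_def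
  proof (intro conjI allI impI)
    fix V :: "complex set" assume V: "openin euclidean V"
    show "openin T {g \<in> topspace T. \<phi> g \<in> V}"
    proof (subst openin_subopen, intro ballI)
      fix g assume g: "g \<in> {g \<in> topspace T. \<phi> g \<in> V}"
      define S where "S = {h \<in> topspace (subtopology T H). \<phi> g * \<psi> h \<in> V}"
      have "continuous_map (subtopology T H) euclidean (\<lambda>h. \<phi> g * \<psi> h)"
        using \<psi> by (intro continuous_map_complex_mult) auto
      then have "openin (subtopology T H) S"
        unfolding S_def using V by (rule openin_continuous_map_preimage)
      then have S: "openin T S" using openin_open_subtopology[OF H(2)] by blast
      have "\<phi> g * \<psi> h = \<phi> (g \<otimes> h)" if "h \<in> H" for h
        using mult[of g h] eq[OF that] g that by simp
      then have "g \<in> (\<lambda>h. g \<otimes> h) ` S" "(\<lambda>h. g \<otimes> h) ` S \<subseteq> {g \<in> topspace T. \<phi> g \<in> V}"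
        using g by (auto simp: S_def intro!: image_eqI[of _ _ \<one>])
      then show "\<exists>U. openin T U \<and> g \<in> U \<and> U \<subseteq> {g \<in> topspace T. \<phi> g \<in> V}"
        using openin_translate[OF S, of g] g by auto
    qed
  qed simp
  then show ?thesis using \<phi> by (simp add: character_def)
qed

text \<open>The compact open subgroup is built around a compact neighbourhood that already contains
  x, so that one of its characters can detect x.\<close>

lemma separating_character_if_cyclic_compact:
  assumes comm: "comm_group G" and lc: "locally_compact_space T"
    and cyclic: "\<And>y. y \<in> carrier G \<Longrightarrow> \<exists>C. compactin T C \<and> (\<forall>k::int. y [^] k \<in> C)"
    and x: "x \<in> carrier G" "x \<noteq> \<one>"
  obtains \<psi> where "character G T \<psi>" "\<psi> x \<noteq> 1"
proof -
  interpret comm_group G by (rule comm)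
  obtain W U where W: "compactin T W" "\<forall>w\<in>W. inv w \<in> W" "openin T U" "\<one> \<in> U" "U \<subseteq> W" "x \<in> W"
    by (rule symmetric_compact_nbhd[OF lc x(1)])
  obtain H where H: "subgroup H G" "W \<subseteq> H" "openin T H" "compactin T H"
    by (rule compact_open_subgroup[OF comm cyclic W(1-5)])
  let ?H = "G\<lparr>carrier := H\<rparr>"
  interpret H: compact_group ?H "subtopology T H"
    by (intro compact_group.intro compact_group_axioms.intro top_group_subgroup[OF H(1)]
        compact_space_subtopology[OF H(4)])
  have "comm_group ?H"
    by (rule H.group_comm_groupI) (use m_comm subgroup.mem_carrier[OF H(1)] in simp)
  obtain \<psi> where \<psi>: "continuous_map (subtopology T H) euclidean \<psi>"
    "\<And>a b. a \<in> H \<Longrightarrow> b \<in> H \<Longrightarrow> \<psi> (a \<otimes> b) = \<psi> a * \<psi> b" "\<And>a. a \<in> H \<Longrightarrow> cmod (\<psi> a) = 1" "\<psi> x \<noteq> 1"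
    using H.compact_abelian_character[OF \<open>comm_group ?H\<close>, of x] W(6) H(2) x by auto
  have "\<psi> \<in> hom ?H circle_group" using \<psi>(2,3) by (auto simp: hom_def)
  then obtain \<phi> where \<phi>: "\<phi> \<in> hom G circle_group" "\<And>h. h \<in> H \<Longrightarrow> \<phi> h = \<psi> h"
    using extend_hom_to_divisible[OF comm_group_circle_group circle_group_divisible H(1)] by blast
  show thesis
    using that[OF continuous_extension_of_character[OF H(1,3) \<phi>(1) \<psi>(1) \<phi>(2)]] \<phi>(2)[of x] \<psi>(4) W(6) H(2) by auto
qed

lemma pullback_character:
  assumes N: "N \<lhd> G" and \<psi>: "character (G Mod N) (coset_topology G T N) \<psi>"
  shows "character G T (\<lambda>x. \<psi> (N #> x))"
proof -
  interpret N: normal N G by (rule N)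
  have "continuous_map T euclidean (\<lambda>x. \<psi> (N #> x))"
    using continuous_map_compose[OF quotient_imp_continuous_map[OF quotient_map_cosets] characterD(1)[OF \<psi>]]
    by (simp add: o_def)
  moreover have "\<psi> (N #> (x \<otimes> y)) = \<psi> (N #> x) * \<psi> (N #> y)" if "x \<in> carrier G" "y \<in> carrier G" for x y
    using characterD(4)[OF \<psi>, of "N #> x" "N #> y"] that by (simp add: N.rcos_sum carrier_FactGroup)
  moreover have "cmod (\<psi> (N #> x)) = 1" if "x \<in> carrier G" for x
    using characterD(3)[OF \<psi>, of "N #> x"] that by (simp add: carrier_FactGroup)
  ultimately show ?thesis by (auto simp: character_def hom_def)
qed

lemma rcos_eq_self_iff:
  assumes "subgroup N G" "x \<in> carrier G"
  shows "N #> x = N \<longleftrightarrow> x \<in> N"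
  using coset_join1[OF _ assms(2,1)] coset_join2[OF assms(2,1)] by blast

text \<open>A small translate y V contains at most one point of D, because d^-1 e lies in V^-1 V,
  hence in U. Removing that point leaves a neighbourhood of y disjoint from D.\<close>

lemma closedin_uniformly_discrete_subgroup:
  assumes D: "subgroup D G" and U: "openin T U" "\<one> \<in> U" "D \<inter> U \<subseteq> {\<one>}"
  shows "closedin T D"
proof -
  interpret D: subgroup D G by (rule D)
  obtain V where V: "openin T V" "\<one> \<in> V" "\<forall>a\<in>V. inv a \<in> V" "\<forall>a\<in>V. \<forall>b\<in>V. a \<otimes> b \<in> U"
    by (rule nbhd_one[OF U(1,2)])
  have Vc: "V \<subseteq> carrier G" using openin_subset[OF V(1)] by simp
  have "openin T (carrier G - D)"
  proof (subst openin_subopen, intro ballI)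
    fix y assume y: "y \<in> carrier G - D"
    let ?Y = "(\<lambda>v. y \<otimes> v) ` V"
    have Y: "openin T ?Y" "y \<in> ?Y" using y V(1,2) by (auto intro!: openin_translate image_eqI[of _ _ \<one>])
    have unique: "d = e" if de: "d \<in> D \<inter> ?Y" "e \<in> D \<inter> ?Y" for d e
    proof -
      obtain v w where vw: "v \<in> V" "w \<in> V" "d = y \<otimes> v" "e = y \<otimes> w" using de by blast
      have c: "v \<in> carrier G" "w \<in> carrier G" "y \<in> carrier G" using vw Vc y by auto
      have "inv d \<otimes> e = inv v \<otimes> (inv y \<otimes> (y \<otimes> w))" using vw c by (simp add: inv_mult_group m_assoc)
      also have "inv y \<otimes> (y \<otimes> w) = w" using c by (simp add: m_assoc[symmetric])
      finally have "inv d \<otimes> e \<in> U" using V(3,4) vw by simp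
      moreover have "inv d \<otimes> e \<in> D" using de by simp
      ultimately have "inv d \<otimes> e = \<one>" using U(3) by blast
      then have "d \<otimes> (inv d \<otimes> e) = d" using de D.mem_carrier by simp
      then show ?thesis using de D.mem_carrier by (simp add: m_assoc[symmetric])
    qed
    \<comment> \<open>If y V misses D, the point 1 is removed instead; it differs from y because y
      is outside D.\<close>
    obtain d where d: "D \<inter> ?Y \<subseteq> {d}" "d \<in> carrier G" "d \<noteq> y"
    proof (cases "D \<inter> ?Y = {}")
      case True
      moreover have "\<one> \<noteq> y" using D.one_closed y by blast
      ultimately show thesis using that[of \<one>] by simp
    next
      case False
      then obtain d where d: "d \<in> D \<inter> ?Y" by blast
      show thesis
      proof (rule that[of d])
        show "D \<inter> ?Y \<subseteq> {d}" using unique[OF d] by (auto simp del: Int_iff)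
        show "d \<in> carrier G" using d D.mem_carrier by blast
        show "d \<noteq> y" using d y by blast
      qed
    qed
    have "openin T (?Y - {d})"
      using Y(1) d(2) closedin_Hausdorff_singleton[OF Hausdorff, of d] by (intro openin_diff) auto
    moreover have "?Y - {d} \<subseteq> carrier G - D" using d(1) openin_subset[OF Y(1)] by auto
    ultimately show "\<exists>V. openin T V \<and> y \<in> V \<and> V \<subseteq> carrier G - D"
      using Y(2) d(3) by blast
  qed
  then show ?thesis using D.subset by (simp add: closedin_def)
qed

lemma locally_compact_quotient:
  assumes lc: "locally_compact_space T" and N: "subgroup N G"
  shows "locally_compact_space (coset_topology G T N)"
  unfolding locally_compact_space_def
proof
  fix X assume "X \<in> topspace (coset_topology G T N)"
  then obtain x where x: "x \<in> carrier G" "X = N #> x"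
    by (auto simp: topspace_coset_topology carrier_FactGroup)
  obtain U K where UK: "openin T U" "compactin T K" "x \<in> U" "U \<subseteq> K"
    using lc x(1) unfolding locally_compact_space_def by (metis topspace_eq)
  have "openin (coset_topology G T N) ((\<lambda>x. N #> x) ` U)" by (rule openin_image_cosets[OF N UK(1)])
  moreover have "compactin (coset_topology G T N) ((\<lambda>x. N #> x) ` K)"
    by (rule image_compactin[OF UK(2) quotient_imp_continuous_map[OF quotient_map_cosets]])
  ultimately show "\<exists>U K. openin (coset_topology G T N) U \<and> compactin (coset_topology G T N) K \<and> X \<in> U \<and> U \<subseteq> K"
    using UK(3,4) x(2) by blast
qed

text \<open>Dividing by a subgroup \<open>D\<close> that is maximal with \<open>D \<inter> V\<^sup>2 = 1\<close>, for a compact neighbourhood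
  \<open>V\<close> of \<open>1\<close> containing \<open>x\<close>, removes all discrete infinite cyclic subgroups but keeps \<open>x\<close>.\<close>

theorem locally_compact_abelian_character:
  assumes comm: "comm_group G" and lc: "locally_compact_space T" and x: "x \<in> carrier G" "x \<noteq> \<one>"
  obtains \<psi> where "character G T \<psi>" "\<psi> x \<noteq> 1"
proof -
  interpret comm_group G by (rule comm)
  obtain V U where V: "compactin T V" "\<forall>w\<in>V. inv w \<in> V" "openin T U" "\<one> \<in> U" "U \<subseteq> V" "x \<in> V"
    by (rule symmetric_compact_nbhd[OF lc x(1)])
  have Vc: "V \<subseteq> carrier G" using compactin_subset_topspace[OF V(1)] by simp
  define S where "S = V <#> V"
  have S: "compactin T S" unfolding S_def by (rule compactin_set_mult[OF V(1,1)])
  have Sc: "S \<subseteq> carrier G" using compactin_subset_topspace[OF S] by simp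
  have VS: "V \<subseteq> S"
  proof
    fix v assume v: "v \<in> V"
    then have "v = v \<otimes> \<one>" using Vc by auto
    then show "v \<in> S" using v V(4,5) unfolding S_def set_mult_def by blast
  qed
  have S_inv: "inv s \<in> S" if s: "s \<in> S" for s
  proof -
    obtain v w where vw: "v \<in> V" "w \<in> V" "s = v \<otimes> w" using s by (auto simp: S_def set_mult_def)
    then have "inv s = inv v \<otimes> inv w" using Vc by (auto simp: inv_mult subset_iff)
    then show ?thesis using vw V(2) unfolding S_def set_mult_def by blast
  qed
  obtain D where D: "subgroup D G" "{\<one>} \<subseteq> D" "D \<inter> S \<subseteq> {\<one>}"
    "\<forall>y\<in>carrier G - D. \<exists>d\<in>D. \<exists>k::int. d \<otimes> y [^] k \<in> S - {\<one>}"
    by (rule maximal_subgroup_avoiding_power[OF triv_subgroup Int_lower1])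
  interpret D: normal D G by (rule subgroup_imp_normal[OF D(1)])
  have D_closed: "closedin T D"
    using D(3) V VS by (intro closedin_uniformly_discrete_subgroup[OF D(1) V(3,4)]) blast
  let ?Q = "G Mod D" and ?TQ = "coset_topology G T D"
  interpret Q: top_group ?Q ?TQ by (rule top_group_quotient[OF D.normal_axioms D_closed])
  have Q_comm: "comm_group ?Q" by (rule abelian_FactGroup[OF D(1)])
  have Q_lc: "locally_compact_space ?TQ" by (rule locally_compact_quotient[OF lc D(1)])
  have K: "compactin ?TQ ((\<lambda>x. D #> x) ` S)"
    by (rule image_compactin[OF S quotient_imp_continuous_map[OF quotient_map_cosets]])
  \<comment> \<open>Maximality is applied to y^(N+1) in place of y, so a nonzero exponent k yields a
    power of y with exponent at least N. Negative k are handled by the symmetry of S.\<close>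
  have return: "\<exists>d\<in>D. \<exists>m\<ge>N. d \<otimes> y [^] m \<in> S" if y: "y \<in> carrier G" for y and N :: nat
  proof (cases "y [^] Suc N \<in> D")
    case True
    \<comment> \<open>In this case the inverse of y^(N+1) serves as d, and the product is 1.\<close>
    then have "inv (y [^] Suc N) \<otimes> y [^] Suc N \<in> S"
      using y V(4,5) VS by auto
    then show ?thesis using True D.m_inv_closed by (meson Suc_n_not_le_n nat_le_linear)
  next
    case False
    let ?z = "y [^] Suc N"
    have z: "?z \<in> carrier G" using y by simp
    obtain d and k :: int where dk: "d \<in> D" "d \<otimes> ?z [^] k \<in> S - {\<one>}"
      using D(4) z False by blast
    have dc: "d \<in> carrier G" using dk(1) by simp
    have "k \<noteq> 0"
    proof
      assume "k = 0"
      then have "d \<in> S - {\<one>}" using dk(2) dc by simp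
      then show False using D(3) dk(1) by blast
    qed
    have pow: "?z [^] int i = y [^] (Suc N * i)" for i
      using y by (simp only: int_pow_int nat_pow_pow)
    show ?thesis
    proof (cases "k > 0")
      case True
      then have "k = int (nat k)" "nat k > 0" by auto
      then have "d \<otimes> y [^] (Suc N * nat k) \<in> S" using dk(2) pow by (metis DiffD1)
      moreover have "N \<le> Suc N * nat k" using \<open>nat k > 0\<close> by (cases "nat k") auto
      ultimately show ?thesis using dk(1) by blast
    next
      case False
      then have k: "- k = int (nat (- k))" "nat (- k) > 0" using \<open>k \<noteq> 0\<close> by auto
      have "inv (d \<otimes> ?z [^] k) = inv d \<otimes> ?z [^] (- k)"
        using dc z by (simp add: inv_mult int_pow_neg)
      then have "inv d \<otimes> y [^] (Suc N * nat (- k)) \<in> S"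
        using S_inv dk(2) pow k(1) by (metis DiffD1)
      moreover have "N \<le> Suc N * nat (- k)" using k(2) by (cases "nat (- k)") auto
      ultimately show ?thesis using dk(1) D.m_inv_closed by blast
    qed
  qed
  \<comment> \<open>Modulo D the factor d disappears, so arbitrarily high powers of the coset return
    to the compact image of S.\<close>
  have cyclic: "\<exists>C. compactin ?TQ C \<and> (\<forall>k::int. Y [^]\<^bsub>?Q\<^esub> k \<in> C)" if Y: "Y \<in> carrier ?Q" for Y
  proof -
    obtain y where y: "y \<in> carrier G" "Y = D #> y" using Y by (auto simp: carrier_FactGroup)
    have "\<forall>N::nat. \<exists>m\<ge>N. Y [^]\<^bsub>?Q\<^esub> m \<in> (\<lambda>x. D #> x) ` S"
    proof
      fix N :: nat
      obtain d m where dm: "d \<in> D" "m \<ge> N" "d \<otimes> y [^] m \<in> S" using return[OF y(1)] by blast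
      have "D #> (d \<otimes> y [^] m) = D #> (y [^] m)"
        using dm(1) y(1) rcos_eq_iff[OF D(1), of "d \<otimes> y [^] m" "y [^] m"] by (simp add: m_assoc)
      then have "Y [^]\<^bsub>?Q\<^esub> m \<in> (\<lambda>x. D #> x) ` S"
        using dm(3) y D.FactGroup_pow by (metis image_eqI)
      then show "\<exists>m\<ge>N. Y [^]\<^bsub>?Q\<^esub> m \<in> (\<lambda>x. D #> x) ` S" using dm(2) by blast
    qed
    then show ?thesis
      using Q.recurrent_power_relatively_compact[OF Q_lc K Y] by metis
  qed
  have "x \<notin> D" using D(3) V(6) VS x(2) by blast
  then have xD: "D #> x \<in> carrier ?Q" "D #> x \<noteq> \<one>\<^bsub>?Q\<^esub>"
    using x(1) rcos_eq_self_iff[OF D(1) x(1)] by (auto simp: carrier_FactGroup)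
  obtain \<psi> where \<psi>: "character ?Q ?TQ \<psi>" "\<psi> (D #> x) \<noteq> 1"
    by (rule Q.separating_character_if_cyclic_compact[OF Q_comm Q_lc cyclic xD])
  then show thesis using that[OF pullback_character[OF D.normal_axioms \<psi>(1)]] by blast
qed

section \<open>From separation of points to the triviality of Kor\<close>

lemma ordinary_rep_of_character:
  assumes "character G T \<psi>"
  shows "ordinary_rep G T 1 (\<lambda>g. mat 1 1 (\<lambda>_. \<psi> g))"
proof (rule ordinary_repI)
  have "\<psi> \<one> * \<psi> \<one> = \<psi> \<one>" "\<psi> \<one> \<noteq> 0"
    using characterD(4)[OF assms, of \<one> \<one>] characterD(3)[OF assms, of \<one>] by auto
  then show "mat 1 1 (\<lambda>_. \<psi> \<one>) = 1\<^sub>m 1" by (intro eq_matI) auto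
  show "mat 1 1 (\<lambda>_. \<psi> (g \<otimes> h)) = mat 1 1 (\<lambda>_. \<psi> g) * mat 1 1 (\<lambda>_. \<psi> h)"
    if "g \<in> carrier G" "h \<in> carrier G" for g h
    using characterD(4)[OF assms that] by (intro eq_matI) (auto simp: scalar_prod_def)
qed (use characterD(1)[OF assms] in auto)

lemma Kor_trivialI:
  assumes sep: "\<And>x. x \<in> carrier G \<Longrightarrow> x \<noteq> \<one> \<Longrightarrow> \<exists>n \<rho>. ordinary_rep G T n \<rho> \<and> \<rho> x \<noteq> 1\<^sub>m n"
  shows "Kor G T = {\<one>}"
proof (intro equalityI subsetI)
  have one: "\<one>\<^bsub>GL n\<^esub> = 1\<^sub>m n" for n by (simp add: GL_def units_of_one ring_mat_simps)
  have mem: "y \<in> carrier G \<and> \<rho> y = 1\<^sub>m n" if "y \<in> Kor G T" "ordinary_rep G T n \<rho>" for y n \<rho>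
    using that by (auto simp: Kor_def kernel_def one)
  fix y assume y: "y \<in> Kor G T"
  \<comment> \<open>The trivial character provides at least one representation. An intersection over
    the empty family would be the whole type, not a subset of the carrier.\<close>
  have "character G T (\<lambda>_. 1)" by (simp add: character_def hom_def)
  then have "y \<in> carrier G" using mem[OF y ordinary_rep_of_character] by blast
  then show "y \<in> {\<one>}" using sep[of y] mem[OF y] by auto
next
  have "group (GL n)" for n
    unfolding GL_def by (intro monoid.units_group ring.is_monoid ring_mat)
  moreover have "\<rho> \<in> hom G (GL n)" if "ordinary_rep G T n \<rho>" for n \<rho>
    using that by (simp add: ordinary_rep_def)
  ultimately show "y \<in> Kor G T" if "y \<in> {\<one>}" for y
    using that hom_one[OF _ group_axioms] by (fastforce simp: Kor_def kernel_def)
qed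

lemma Kor_trivial_of_characters:
  assumes "\<And>x. x \<in> carrier G \<Longrightarrow> x \<noteq> \<one> \<Longrightarrow> \<exists>\<psi>. character G T \<psi> \<and> \<psi> x \<noteq> 1"
  shows "Kor G T = {\<one>}"
proof (rule Kor_trivialI)
  fix x assume x: "x \<in> carrier G" "x \<noteq> \<one>"
  obtain \<psi> where \<psi>: "character G T \<psi>" "\<psi> x \<noteq> 1" using assms[OF x] by blast
  have "mat 1 1 (\<lambda>_. \<psi> x) $$ (0, 0) \<noteq> 1\<^sub>m 1 $$ (0, 0)" using \<psi>(2) by simp
  then have "mat 1 1 (\<lambda>_. \<psi> x) \<noteq> 1\<^sub>m 1" by metis
  then show "\<exists>n \<rho>. ordinary_rep G T n \<rho> \<and> \<rho> x \<noteq> 1\<^sub>m n"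
    using ordinary_rep_of_character[OF \<psi>(1)] by blast
qed

end

text \<open>Only the charts matter: they identify open sets covering the group with open subsets of
  Euclidean space, and compact neighbourhoods pull back.\<close>

lemma locally_compact_Lie_group:
  assumes "Lie_group G T" shows "locally_compact_space T"
  unfolding locally_compact_space_def
proof
  fix x assume x: "x \<in> topspace T"
  obtain n A where "smooth_atlas T n A" using assms by (auto simp: Lie_group_def)
  then obtain U \<phi> where U: "x \<in> U" "is_chart T n (U, \<phi>)"
    using x unfolding smooth_atlas_def by blast
  then have open_U: "openin T U" and open_image: "openin (Euclidean_space n) (\<phi> ` U)"
    and homeo: "homeomorphic_map (subtopology T U) (subtopology (Euclidean_space n) (\<phi> ` U)) \<phi>"
    by (auto simp: is_chart_def)
  have "locally_compact_space (subtopology (Euclidean_space n) (\<phi> ` U))"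
    using locally_compact_space_open_subset[OF _ locally_compact_Euclidean_space open_image]
      Hausdorff_Euclidean_space by blast
  then have "locally_compact_space (subtopology T U)"
    using homeomorphic_locally_compact_space homeomorphic_map_imp_homeomorphic_space[OF homeo] by blast
  then obtain V K where "openin (subtopology T U) V" "compactin (subtopology T U) K" "x \<in> V" "V \<subseteq> K"
    using x U(1) unfolding locally_compact_space_def by (metis IntI topspace_subtopology)
  then show "\<exists>V K. openin T V \<and> compactin T K \<and> x \<in> V \<and> V \<subseteq> K"
    using openin_open_subtopology[OF open_U] by (auto simp: compactin_subtopology)
qed

text \<open>The complement of x is a neighbourhood of 1, so it contains some N with Lie quotient.
  Then x survives in G/N, which is locally compact and abelian, and a character found there pulls
  back.\<close>

theorem (in top_group) proto_Lie_abelian_character: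
  assumes comm: "comm_group G" and proto: "proto_Lie_group G T" and x: "x \<in> carrier G" "x \<noteq> \<one>"
  obtains \<psi> where "character G T \<psi>" "\<psi> x \<noteq> 1"
proof -
  have "openin T (topspace T - {x})"
    by (rule openin_diff[OF openin_topspace closedin_Hausdorff_singleton[OF Hausdorff]]) (use x in simp)
  then obtain N where N: "N \<lhd> G" "closedin T N" "N \<subseteq> topspace T - {x}"
    "Lie_group (G Mod N) (coset_topology G T N)"
    using proto x unfolding proto_Lie_group_def by force
  interpret N: normal N G by (rule N(1))
  interpret Q: top_group "G Mod N" "coset_topology G T N"
    by (rule top_group_quotient[OF N(1,2)])
  have "N #> x \<in> carrier (G Mod N)" "N #> x \<noteq> \<one>\<^bsub>G Mod N\<^esub>"
    using x N(3) rcos_eq_self_iff[OF N.subgroup_axioms x(1)] by (auto simp: carrier_FactGroup)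
  then obtain \<psi> where \<psi>: "character (G Mod N) (coset_topology G T N) \<psi>" "\<psi> (N #> x) \<noteq> 1"
    by (rule Q.locally_compact_abelian_character[OF comm_group.abelian_FactGroup[OF comm N.subgroup_axioms]
        locally_compact_Lie_group[OF N(4)]])
  then show thesis using that[OF pullback_character[OF N(1) \<psi>(1)]] by blast
qed

theorem mainTheorem8:
  fixes G :: "('a, 'b) monoid_scheme" and T :: "'a topology"
  assumes "topological_group G T"
  shows "(compact_space T \<longrightarrow> Kor G T = {\<one>\<^bsub>G\<^esub>}) \<and>
         (locally_compact_space T \<and> comm_group G \<longrightarrow> Kor G T = {\<one>\<^bsub>G\<^esub>}) \<and>
         (pro_Lie_group G T \<and> comm_group G \<longrightarrow> Kor G T = {\<one>\<^bsub>G\<^esub>}) \<and>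
         (proto_Lie_group G T \<and> comm_group G \<longrightarrow> Kor G T = {\<one>\<^bsub>G\<^esub>})"
proof -
  interpret top_group G T
    using assms by (intro top_group.intro top_group_axioms.intro) (auto simp: topological_group_def)
  have compact: "Kor G T = {\<one>\<^bsub>G\<^esub>}" if "compact_space T"
  proof -
    interpret compact_group G T by unfold_locales (rule that)
    show ?thesis
    proof (rule Kor_trivialI)
      fix x assume x: "x \<in> carrier G" "x \<noteq> \<one>\<^bsub>G\<^esub>"
      obtain n \<rho> where "ordinary_rep G T n \<rho>" "\<rho> x \<noteq> 1\<^sub>m n"
        by (rule compact_separating_rep[OF x])
      then show "\<exists>n \<rho>. ordinary_rep G T n \<rho> \<and> \<rho> x \<noteq> 1\<^sub>m n" by blast
    qed
  qed
  have lca: "Kor G T = {\<one>\<^bsub>G\<^esub>}" if a: "locally_compact_space T" "comm_group G"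
  proof (rule Kor_trivial_of_characters)
    fix x assume x: "x \<in> carrier G" "x \<noteq> \<one>\<^bsub>G\<^esub>"
    obtain \<psi> where "character G T \<psi>" "\<psi> x \<noteq> 1"
      by (rule locally_compact_abelian_character[OF a(2,1) x])
    then show "\<exists>\<psi>. character G T \<psi> \<and> \<psi> x \<noteq> 1" by blast
  qed
  have proto: "Kor G T = {\<one>\<^bsub>G\<^esub>}" if a: "proto_Lie_group G T" "comm_group G"
  proof (rule Kor_trivial_of_characters)
    fix x assume x: "x \<in> carrier G" "x \<noteq> \<one>\<^bsub>G\<^esub>"
    obtain \<psi> where "character G T \<psi>" "\<psi> x \<noteq> 1"
      by (rule proto_Lie_abelian_character[OF a(2,1) x])
    then show "\<exists>\<psi>. character G T \<psi> \<and> \<psi> x \<noteq> 1" by blast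
  qed
  show ?thesis
    using compact lca proto by (auto simp: pro_Lie_group_def)
qed

end
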